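(* Let $\alpha = v/w$ be a rational number in $(0,1/2]$ written in lowest terms ($v,w$ coprime positive integers). Then, as the positive integer $Q\to\infty$, \[ \frac{1}{\sharp \mathscr{F}(Q)} \sum_{x\in\mathscr{F}_{\alpha}(Q)} s(x) = \frac{1}{12}\left(1-\frac{1}{w^2}\right)\log Q + O_\alpha(1), \] where the implied constant depends only on $\alpha$.
   Context: For $x\in\mathbb{R}$ let $((x)) = x-\lfloor x\rfloor - \tfrac12$ if $x\notin\mathbb{Z}$ and $((x))=0$ if $x\in\mathbb{Z}$. For integers $a,b$ with $b\neq 0$ the Dedekind sum is $s(a,b)=\sum_{n=1}^{b} ((n/b))((na/b))$; since $s(ka,kb)=s(a,b)$ for nonzero integers $k$, $s(a/b):=s(a,b)$ is a well-defined function on the nonnegative rationals. For a positive integer $Q$, $\mathscr{F}(Q)=\{v'/w'\in\mathbb{Q}\cap[0,1] : 1\le w'\le Q\}$ is the set of Farey fractions of order $Q$ (each rational counted once), and for $\alpha\in(0,1)$, $\mathscr{F}_\alpha(Q)=\mathscr{F}(Q)\cap[0,\alpha)$. *)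

theory Defs
  imports Complex_Main "HOL-Library.Landau_Symbols"
begin

definition sawtooth :: "real \<Rightarrow> real" where
  "sawtooth x = (if x \<in> \<int> then 0 else x - of_int \<lfloor>x\<rfloor> - 1/2)"

(* The range is 1..|b| so that s(-a,-b) = s(a,b) also holds literally for negative b. *)
definition dedekind_sum :: "int \<Rightarrow> int \<Rightarrow> real" where
  "dedekind_sum a b =
     (\<Sum>n\<in>{1..\<bar>b\<bar>}. sawtooth (of_int n / of_int b) * sawtooth (of_int (n * a) / of_int b))"

(* Evaluated at the representation in lowest terms with positive denominator; this choice is
   immaterial since s(ka,kb) = s(a,b) for k nonzero. *)
definition dedekind_rat :: "rat \<Rightarrow> real" where
  "dedekind_rat x = (case quotient_of x of (a, b) \<Rightarrow> dedekind_sum a b)"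

definition farey :: "nat \<Rightarrow> rat set" where
  "farey Q = {of_int v' / of_int w' | v' w'. 1 \<le> w' \<and> w' \<le> int Q} \<inter> {0..1}"

definition farey_below :: "real \<Rightarrow> nat \<Rightarrow> rat set" where
  "farey_below \<alpha> Q = {x \<in> farey Q. real_of_rat x \<in> {0..<\<alpha>}}"

end

theory Submission
  imports Defs "HOL-Analysis.Analysis" "HOL-Number_Theory.Cong"
begin

text \<open>
  Instead of reduced fractions sum over all pairs \<open>0 \<le> a < \<alpha> b\<close>, \<open>b \<le> Q\<close>; the passage back only needs
  that the sum of \<open>1/k\<^sup>2\<close> over \<open>k \<ge> 2\<close> is less than \<open>1\<close>.
  By the cotangent formula \<open>4 b s(a, b) = \<Sum>k. cot (\<pi> k / b) cot (\<pi> k a / b)\<close>, valid for all \<open>a\<close>,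
  one has to study \<open>\<Sum>a<\<alpha>b. cot (\<pi> k a / b)\<close>. The poles of \<open>cot (\<pi> k x)\<close> at \<open>l/k\<close> inside the range
  turn it into \<open>- (b/k) (\<Sum>l<\<alpha>k. cot (\<pi> l b / k))\<close>, up to the half poles at the two ends. The pole at \<open>0\<close>
  contributes \<open>(b / (\<pi> k)) log (b / k)\<close>, and the end \<open>\<alpha> = v/w\<close> cancels this exactly when \<open>w\<close> divides \<open>k\<close>;
  summing over \<open>k\<close> yields the factor \<open>1 - 1/w\<^sup>2\<close>.
  The reciprocal sum is odd and periodic in \<open>b\<close> modulo \<open>k\<close>, so its average over \<open>b \<le> Q\<close> is controlled by
  its \<open>L\<^sup>1\<close> norm over a period. This norm must be \<open>O(k\<^sup>2)\<close>, without the logarithm of the trivial bound.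
  For \<open>b\<close> prime to \<open>k\<close> with inverse \<open>y\<close>, finite Fourier expansion gives a combination of the \<open>((j y / k))\<close> with
  coefficients \<open>O(k / j)\<close>; after smoothing the cutoff only \<open>j \<le> \<surd>k\<close> matter, and these are nearly orthogonal
  in \<open>y\<close>.
\<close>

section \<open>Sawtooth function, cotangent and the cotangent formula for Dedekind sums\<close>

text \<open>The number of Farey fractions has order Q^2, so errors summed over b \<le> Q may be
  O(Q^2), while one more logarithm would reach the size of the main term. For fixed k the weight cot
  (pi k / b) increases with b up to at most Q / k, so partial summation turns an L1 bound of order
  k^2 into k Q; after division by k the sum over k is O(Q^2). This is why the bound must be free of
  logarithms. Smoothing means averaging over about sqrt k shifts of the cutoff. The j-th coefficient
  of the J-fold sum is then O((k/j)^2) as well as O(J k / j), while undoing the average costs at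
  most about sqrt k cotangents at each end, each of L1 norm O(k^(3/2)). The same sqrt k keeps the
  number of frequency pairs below k, so that the errors in orthogonality do not exceed the diagonal.
  The coefficient 1/12 is 1/(2 pi^2) times pi^2/6, and the multiples of w carry the share 1/w^2 of
  the series. The Farey count obeys the same relation between pairs and dilates as the sum, so the
  sum minus its expected multiple of the exact count is inverted as one function.\<close>

lemma sawtooth_altdef: "sawtooth x = x - (of_int \<lfloor>x\<rfloor> + of_int \<lceil>x\<rceil>) / 2"
proof (cases "x \<in> \<int>")
  case True
  then show ?thesis by (auto simp: sawtooth_def elim!: Ints_cases)
next
  case False
  then have "\<lceil>x\<rceil> = \<lfloor>x\<rfloor> + 1" by (metis Ints_of_int ceiling_altdef)
  then show ?thesis using False by (simp add: sawtooth_def field_simps)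
qed

lemma sawtooth_0 [simp]: "sawtooth 0 = 0"
  by (simp add: sawtooth_def)

lemma sawtooth_add_int [simp]: "sawtooth (x + of_int n) = sawtooth x"
  by (simp add: sawtooth_altdef field_simps)

lemma sawtooth_minus: "sawtooth (- x) = - sawtooth x"
  by (simp add: sawtooth_altdef ceiling_minus floor_minus field_simps)

lemma abs_sawtooth_le: "\<bar>sawtooth x\<bar> \<le> 1/2"
  unfolding sawtooth_def abs_le_iff by (auto; linarith)

lemma sawtooth_between:
  assumes "0 < x" "x < 1" shows "sawtooth x = x - 1/2"
proof -
  have "\<lfloor>x\<rfloor> = 0" using assms by linarith
  moreover from this have "x \<notin> \<int>" using assms by (auto elim!: Ints_cases)
  ultimately show ?thesis by (simp add: sawtooth_def)
qed

lemma sawtooth_mod: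
  assumes "b > 0"
  shows "sawtooth (of_int (x mod int b) / real b) = sawtooth (of_int x / real b)"
proof -
  have "of_int x / real b = of_int (x mod int b) / real b + of_int (x div int b)"
  proof -
    have "real_of_int x = real_of_int (x mod int b + int b * (x div int b))" by simp
    also have "\<dots> = real_of_int (x mod int b) + b * real_of_int (x div int b)"
      by (simp only: of_int_add of_int_mult of_int_of_nat_eq)
    finally show ?thesis using assms by (simp add: field_simps)
  qed
  then show ?thesis by simp
qed

section \<open>Elementary estimates for the cotangent\<close>

definition cotpi :: "real \<Rightarrow> real" where
  "cotpi x = cot (pi * x)"

lemma cotpi_add_int [simp]: "cotpi (x + of_int n) = cotpi x"
proof -
  have s: "sin (pi * of_int n) = 0" by (simp add: sin_zero_iff_int2 mult.commute)
  then have "cos (pi * of_int n) \<noteq> 0" using sin_cos_squared_add[of "pi * of_int n"] by auto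
  then show ?thesis
    by (simp add: cotpi_def cot_def distrib_left sin_add cos_add s)
qed

lemma cotpi_diff_int [simp]: "cotpi (x - of_int n) = cotpi x"
  using cotpi_add_int[of x "- n"] by simp

text \<open>Division by zero returns 0, so \<open>cotpi\<close> vanishes at its poles. This default
  suits the finite formulas: terms whose argument is an integer drop out without a side
  condition.\<close>

lemma cotpi_of_int [simp]: "cotpi (of_int n) = 0"
  using cotpi_add_int[of 0 n] by (simp add: cotpi_def)

lemma cotpi_0 [simp]: "cotpi 0 = 0"
  by (simp add: cotpi_def)

lemma cotpi_minus [simp]: "cotpi (- x) = - cotpi x"
  by (simp add: cotpi_def)

lemma mult_cos_le_sin:
  assumes "0 \<le> u" "u \<le> pi/2" shows "u * cos u \<le> sin (u::real)"
proof -
  have "(\<lambda>u. sin u - u * cos u) 0 \<le> (\<lambda>u. sin u - u * cos u) u"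
  proof (rule DERIV_nonneg_imp_nondecreasing[OF assms(1)])
    fix x assume x: "0 \<le> x" "x \<le> u"
    have "((\<lambda>u. sin u - u * cos u) has_real_derivative x * sin x) (at x)"
      by (auto intro!: derivative_eq_intros)
    moreover have "x * sin x \<ge> 0" using x assms by (simp add: sin_ge_zero)
    ultimately show "\<exists>y. ((\<lambda>u. sin u - u * cos u) has_real_derivative y) (at x) \<and> 0 \<le> y" by blast
  qed
  then show ?thesis by simp
qed

lemma sin_ge_half:
  assumes "0 \<le> u" "u \<le> pi/2" shows "u / 2 \<le> sin (u::real)"
proof -
  have c: "cos (u/2) \<ge> 0" using assms by (intro cos_ge_zero) auto
  \<comment> \<open>The half angle: u (1 + cos u) / 2 = u cos^2 (u/2), and
    \<open>mult_cos_le_sin\<close> at u/2 absorbs one of the two cosines.\<close>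
  have "u / 2 \<le> u * (1 + cos u) / 2"
    using assms cos_ge_zero[of u] by (simp add: field_simps)
  also have "\<dots> = 2 * ((u/2) * cos (u/2)) * cos (u/2)"
    using cos_double_cos[of "u/2"] by (simp add: power2_eq_square algebra_simps)
  also have "\<dots> \<le> 2 * sin (u/2) * cos (u/2)"
    using mult_cos_le_sin[of "u/2"] assms c by (intro mult_right_mono mult_left_mono) auto
  also have "\<dots> = sin u" using sin_double[of "u/2"] by simp
  finally show ?thesis .
qed

lemma inverse_sin_le:
  assumes "0 < x" "x \<le> 1/2" shows "1 / sin (pi * x) \<le> 1 / x"
proof -
  have "x \<le> pi * x / 2" using assms pi_ge_two by (simp add: field_simps)
  also have "\<dots> \<le> sin (pi * x)" using sin_ge_half[of "pi * x"] assms by simp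
  finally show ?thesis using assms by (intro divide_left_mono) (auto intro!: mult_pos_pos)
qed

lemma cotpi_nonneg: "0 \<le> x \<Longrightarrow> x \<le> 1/2 \<Longrightarrow> 0 \<le> cotpi x"
  by (auto simp: cotpi_def cot_def intro!: divide_nonneg_nonneg cos_ge_zero sin_ge_zero
      intro: order_trans[of _ 0])

lemma cotpi_le:
  assumes "0 < x" "x \<le> 1/2" shows "cotpi x \<le> 1 / (pi * x)"
proof -
  have "sin (pi * x) > 0" using assms by (intro sin_gt_zero) auto
  then show ?thesis using mult_cos_le_sin[of "pi * x"] assms
    by (simp add: cotpi_def cot_def field_simps)
qed

text \<open>On the first quadrant sin u + cos u \<ge> 1, hence sin u - u cos u \<le> u (1 - cos u)
  \<le> u sin u. Together with \<open>cotpi_le\<close> this puts \<open>cotpi x\<close> within 1 of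
  its polar part 1/(pi x).\<close>

lemma cotpi_ge:
  assumes "0 < x" "x \<le> 1/2" shows "cotpi x \<ge> 1 / (pi * x) - 1"
proof -
  define u where "u = pi * x"
  have u: "0 < u" "u \<le> pi/2" using assms by (auto simp: u_def)
  have s: "sin u > 0" using u by (intro sin_gt_zero) auto
  have c: "cos u \<ge> 0" using u by (intro cos_ge_zero) auto
  have "1 \<le> (sin u + cos u)\<^sup>2"
    using sin_cos_squared_add[of u] s c by (simp add: power2_sum)
  then have "1 \<le> sin u + cos u" using s c by (intro power2_le_imp_le[of 1]) auto
  have "sin u - u * cos u \<le> u * (1 - cos u)" using sin_x_le_x[of u] u by (simp add: algebra_simps)
  also have "\<dots> \<le> u * sin u" using \<open>1 \<le> sin u + cos u\<close> u by (intro mult_left_mono) auto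
  finally have "1 / u - 1 \<le> cos u / sin u" using u s by (simp add: field_simps)
  then show ?thesis by (simp add: cotpi_def cot_def u_def)
qed

text \<open>The difference of the two cotangents is sin (pi (y - x)) / (sin (pi x) sin (pi
  y)).\<close>

lemma cotpi_antimono:
  assumes "0 < x" "x \<le> y" "y < 1" shows "cotpi y \<le> cotpi x"
proof -
  have s: "sin (pi * x) > 0" "sin (pi * y) > 0" using assms by (auto intro!: sin_gt_zero)
  have "sin (pi * y - pi * x) \<ge> 0" 
  proof (rule sin_ge_zero)
    have "pi * (y - x) \<le> pi * 1" using assms by (intro mult_left_mono) auto
    then show "pi * y - pi * x \<le> pi" by (simp add: algebra_simps)
  qed (use assms in auto)
  then show ?thesis using s by (simp add: cotpi_def cot_def sin_diff field_simps)
qed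

lemma cotpi_le_abs:
  assumes "0 < d" "d \<le> 1/2" "\<bar>x\<bar> \<ge> d" "\<bar>x\<bar> \<le> 1 - d"
  shows "\<bar>cotpi x\<bar> \<le> 1 / (2 * d)"
proof -
  have *: "\<bar>cotpi x\<bar> \<le> 1 / (2 * d)" if x: "d \<le> x" "x \<le> 1 - d" for x
  proof -
    have "cotpi d \<le> 1 / (pi * d)" using assms by (intro cotpi_le) auto
    also have "\<dots> \<le> 1 / (2 * d)" using assms pi_ge_two by (intro divide_left_mono mult_right_mono) auto
    finally have "cotpi d \<le> 1 / (2 * d)" .
    moreover have "cotpi x \<le> cotpi d" using x assms by (intro cotpi_antimono) auto
    moreover have "cotpi (1 - d) \<le> cotpi x" using x assms by (intro cotpi_antimono) auto
    moreover have "cotpi (1 - d) = - cotpi d" using cotpi_add_int[of "-d" 1] by (simp add: algebra_simps)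
    ultimately show ?thesis by linarith
  qed
  show ?thesis using *[of "\<bar>x\<bar>"] assms by (auto simp: abs_if split: if_splits)
qed

section \<open>Finite Fourier analysis of the sawtooth\<close>

lemma cis_eq_1_imp: "cis (2 * pi * of_int m / real b) = 1 \<Longrightarrow> b > 0 \<Longrightarrow> int b dvd m"
proof -
  assume "cis (2 * pi * of_int m / real b) = 1" and b: "b > 0"
  then have "cos (2 * pi * of_int m / real b) = 1" by (simp add: complex_eq_iff)
  then obtain n :: int where "2 * pi * of_int m / real b = of_int n * 2 * pi"
    by (auto simp: cos_one_2pi_int)
  then have "of_int m = (of_int (n * int b) :: real)" using b by (simp add: field_simps)
  then show ?thesis by (metis dvd_triv_right of_int_eq_iff)
qed

lemma cis_power_modulus: "b > 0 \<Longrightarrow> cis (2 * pi * of_int m / real b) ^ b = 1"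
  unfolding Complex.DeMoivre by simp

lemma sum_cis_eq_0:
  assumes "b > 0" "\<not> int b dvd m"
  shows "(\<Sum>n<b. cis (2 * pi * of_int m / real b) ^ n) = 0"
  using assms cis_power_modulus[of b m] cis_eq_1_imp[of m b] by (auto simp: sum_gp_strict)

text \<open>Summation by parts. If q^b = 1 and q is not 1, the subtracted sum vanishes and the
  weighted sum is b / (q - 1).\<close>

lemma sum_index_times_power:
  fixes q :: complex
  shows "(q - 1) * (\<Sum>n<b. of_nat n * q ^ n) = of_nat b * q ^ b - (\<Sum>n<b. q ^ Suc n)"
  by (induction b) (auto simp: algebra_simps)

text \<open>The full value is -1/2 - (i/2) cot (\<theta>/2); this is how roots of unity turn into
  cotangents.\<close>

lemma Im_inverse_cis_diff_1:
  assumes "cis \<theta> \<noteq> 1"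
  shows "Im (1 / (cis \<theta> - 1)) = - cot (\<theta>/2) / 2"
proof -
  have s0: "sin (\<theta>/2) \<noteq> 0"
  proof
    assume "sin (\<theta>/2) = 0"
    then have "cos \<theta> = 1" using cos_double_sin[of "\<theta>/2"] by simp
    then have "cis \<theta> = 1" using sin_cos_squared_add[of \<theta>] by (simp add: complex_eq_iff)
    then show False using assms by simp
  qed
  have "Im (1 / (cis \<theta> - 1)) = - sin \<theta> / ((cos \<theta> - 1)\<^sup>2 + (sin \<theta>)\<^sup>2)"
    by (simp add: Im_divide)
  also have "(cos \<theta> - 1)\<^sup>2 + (sin \<theta>)\<^sup>2 = 2 - 2 * cos \<theta>"
    using sin_cos_squared_add[of \<theta>] by (simp add: power2_eq_square algebra_simps)
  also have "\<dots> = 4 * (sin (\<theta>/2))\<^sup>2" using cos_double_sin[of "\<theta>/2"] by simp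
  also have "sin \<theta> = 2 * sin (\<theta>/2) * cos (\<theta>/2)" using sin_double[of "\<theta>/2"] by simp
  also have "- (2 * sin (\<theta>/2) * cos (\<theta>/2)) / (4 * (sin (\<theta>/2))\<^sup>2) = - cot (\<theta>/2) / 2"
    using s0 by (simp add: cot_def power2_eq_square)
  finally show ?thesis .
qed

text \<open>Eisenstein's formula, the finite Fourier coefficients of the sawtooth. With q = cis (2
  pi m / b) the sum of n q^n is b / (q - 1), whose imaginary part is -(b/2) cot (pi m / b); the
  constant -1/2 of the sawtooth contributes nothing because the plain sines sum to 0. If b divides
  m, both sides are 0.\<close>

lemma sum_sawtooth_sin:
  assumes b: "b > 0"
  shows "(\<Sum>n<b. sawtooth (n / b) * sin (2 * pi * (real n * of_int m) / b)) = - cotpi (of_int m / b) / 2"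
proof (cases "int b dvd m")
  case True
  then obtain t where t: "m = int b * t" by (auto elim: dvdE)
  have "sin (2 * pi * (real n * of_int m) / b) = 0" for n
    unfolding sin_zero_iff_int2 using b by (intro exI[of _ "2 * int n * t"]) (simp add: t field_simps)
  moreover have "cotpi (of_int m / b) = 0" using b by (simp add: t)
  ultimately show ?thesis by simp
next
  case False
  define \<theta> where "\<theta> = 2 * pi * of_int m / real b"
  define q where "q = cis \<theta>"
  have q1: "q \<noteq> 1" using cis_eq_1_imp[of m b] False b by (auto simp: q_def \<theta>_def)
  have qb: "q ^ b = 1" unfolding q_def \<theta>_def using b by (rule cis_power_modulus)
  have S1: "(\<Sum>n<b. q ^ n) = 0" unfolding q_def \<theta>_def using b False by (rule sum_cis_eq_0)
  have "(\<Sum>n<b. q ^ Suc n) = 0" using S1 by (simp flip: sum_distrib_left)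
  then have "(q - 1) * (\<Sum>n<b. of_nat n * q ^ n) = of_nat b"
    using sum_index_times_power[of q b] qb by simp
  then have S2: "(\<Sum>n<b. of_nat n * q ^ n) = of_nat b / (q - 1)"
    using q1 by (simp add: field_simps)
  have Imq: "Im (q ^ n) = sin (2 * pi * (real n * of_int m) / b)" for n
    unfolding q_def Complex.DeMoivre \<theta>_def by (simp add: algebra_simps)
  have sn: "(\<Sum>n<b. sin (2 * pi * (real n * of_int m) / b)) = 0"
    using arg_cong[OF S1, of Im] by (simp add: Imq)
  have "(\<Sum>n<b. real n * sin (2 * pi * (real n * of_int m) / b)) = Im (of_nat b / (q - 1))"
    unfolding S2[symmetric] by (simp add: Imq)
  also have "\<dots> = - (b * cotpi (of_int m / b) / 2)"
  proof -
    have "Im (1 / (q - 1)) = - cotpi (of_int m / b) / 2"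
      using Im_inverse_cis_diff_1[of \<theta>] q1 by (simp add: q_def \<theta>_def cotpi_def)
    moreover have "Im (of_nat b / (q - 1)) = b * Im (1 / (q - 1))"
      by (simp add: Im_divide)
    ultimately show ?thesis by simp
  qed
  finally have S3: "(\<Sum>n<b. real n * sin (2 * pi * (real n * of_int m) / b)) = - (b * cotpi (of_int m / b) / 2)" .
  have "(\<Sum>n<b. sawtooth (n / b) * sin (2 * pi * (real n * of_int m) / b)) =
        (\<Sum>n<b. (n / b - 1/2) * sin (2 * pi * (real n * of_int m) / b))"
  proof (rule sum.cong[OF refl])
    fix n assume "n \<in> {..<b}"
    then show "sawtooth (n / b) * sin (2 * pi * (real n * of_int m) / b) = (n / b - 1/2) * sin (2 * pi * (real n * of_int m) / b)"
      by (cases "n = 0") (auto simp: sawtooth_between)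
  qed
  also have "\<dots> = (\<Sum>n<b. real n * sin (2 * pi * (real n * of_int m) / b)) / b - (\<Sum>n<b. sin (2 * pi * (real n * of_int m) / b)) / 2"
    by (simp add: left_diff_distrib sum_subtractf sum_divide_distrib)
  finally show ?thesis using b by (simp add: sn S3)
qed

lemma sum_cos_modulus:
  assumes b: "b > 0"
  shows "(\<Sum>k<b. cos (2 * pi * (real k * of_int m) / b)) = (if int b dvd m then real b else 0)"
proof (cases "int b dvd m")
  case True
  then obtain t where t: "m = int b * t" by (auto elim: dvdE)
  have "cos (2 * pi * (real k * of_int m) / b) = 1" for k
    unfolding cos_one_2pi_int using b by (intro exI[of _ "int k * t"]) (simp add: t field_simps)
  then show ?thesis using True by simp
next
  case False
  have "(\<Sum>k<b. cos (2 * pi * (real k * of_int m) / b)) = Re (\<Sum>n<b. cis (2 * pi * of_int m / real b) ^ n)"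
    unfolding Complex.DeMoivre by (simp add: algebra_simps)
  then show ?thesis using sum_cis_eq_0[OF b False] False by simp
qed

lemma sum_sin_orthogonal:
  assumes b: "b > 0"
  shows "(\<Sum>k<b. sin (2 * pi * (real k * of_int n) / b) * sin (2 * pi * (real k * of_int m) / b)) =
    real b / 2 * ((if int b dvd n - m then 1 else 0) - (if int b dvd n + m then 1 else 0))"
proof -
  have "sin (2 * pi * (real k * of_int n) / b) * sin (2 * pi * (real k * of_int m) / b) =
     (cos (2 * pi * (real k * of_int (n - m)) / b) - cos (2 * pi * (real k * of_int (n + m)) / b)) / 2" for k
    unfolding sin_times_sin by (simp add: algebra_simps add_divide_distrib diff_divide_distrib)
  then have "(\<Sum>k<b. sin (2 * pi * (real k * of_int n) / b) * sin (2 * pi * (real k * of_int m) / b)) =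
     ((\<Sum>k<b. cos (2 * pi * (real k * of_int (n - m)) / b)) - (\<Sum>k<b. cos (2 * pi * (real k * of_int (n + m)) / b))) / 2"
    by (simp only: sum_subtractf sum_divide_distrib[symmetric])
  then show ?thesis by (simp add: sum_cos_modulus[OF b] del: of_int_diff of_int_add)
qed

lemma sum_sawtooth_residue:
  assumes b: "b > 0"
  shows "(\<Sum>n<b. sawtooth (n / b) * (if int b dvd int n - x then 1 else 0)) = sawtooth (of_int x / b)"
proof -
  define n0 where "n0 = nat (x mod int b)"
  have n0: "n0 < b" "int n0 = x mod int b" using b by (auto simp: n0_def nat_less_iff)
  have "int b dvd int n - x \<longleftrightarrow> n = n0" if "n < b" for n
    using that n0 by (metis mod_eq_dvd_iff mod_pos_pos_trivial of_nat_0_le_iff of_nat_eq_iff of_nat_less_iff)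
  then have "(\<Sum>n<b. sawtooth (n / b) * (if int b dvd int n - x then 1 else 0)) = (\<Sum>n<b. if n = n0 then sawtooth (n / b) else 0)"
    by (intro sum.cong) auto
  also have "\<dots> = sawtooth (n0 / b)" using n0 by simp
  also have "\<dots> = sawtooth (of_int x / b)" using sawtooth_mod[OF b, of x] n0 by (metis of_int_of_nat_eq)
  finally show ?thesis .
qed

lemma dedekind_sum_nat:
  assumes "b > 0"
  shows "dedekind_sum a (int b) = (\<Sum>n<b. sawtooth (n / b) * sawtooth (real n * of_int a / b))"
proof -
  have "dedekind_sum a (int b) = (\<Sum>n\<in>int ` {1..b}. sawtooth (of_int n / b) * sawtooth (of_int (n * a) / b))"
    unfolding dedekind_sum_def by (intro sum.cong) (auto simp: image_int_atLeastAtMost)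
  also have "\<dots> = (\<Sum>n\<in>{1..b}. sawtooth (n / b) * sawtooth (real n * of_int a / b))"
    by (subst sum.reindex) auto
  also have "\<dots> = (\<Sum>n\<in>{..<b} - {0}. sawtooth (n / b) * sawtooth (real n * of_int a / b))"
  proof (rule sum.mono_neutral_right)
    have "sawtooth (real b / real b) = 0" using assms sawtooth_add_int[of 0 1] by simp
    then show "\<forall>i\<in>{1..b} - ({..<b} - {0}). sawtooth (i / b) * sawtooth (real i * of_int a / b) = 0"
      by (metis DiffE DiffI atLeastAtMost_iff empty_iff insert_iff le_neq_implies_less lessThan_iff
          mult_zero_left not_one_le_zero)
  qed auto
  also have "\<dots> = (\<Sum>n<b. sawtooth (n / b) * sawtooth (real n * of_int a / b))"
    by (intro sum.mono_neutral_left) auto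
  finally show ?thesis .
qed

text \<open>Both cotangents are expanded by \<open>sum_sawtooth_sin\<close> and the sum over k is
  evaluated by orthogonality of the sines. This leaves n = n' a and n = - n' a modulo b with
  opposite signs; as the sawtooth is odd, the two contributions agree. The factor 4 b is (-2)^2 from
  the expansions, b/2 from orthogonality and 2 from this doubling.\<close>

lemma dedekind_sum_cotpi:
  assumes b: "b > 0"
  shows "dedekind_sum a (int b) = (\<Sum>k<b. cotpi (k / b) * cotpi (real k * of_int a / b)) / (4 * b)"
proof -
  let ?S = "\<lambda>n x. sin (2 * pi * (real n * of_int x) / b)"
  have c: "cotpi (of_int x / b) = -2 * (\<Sum>n<b. sawtooth (n / b) * ?S n x)" for x
    using sum_sawtooth_sin[OF b, of x] by simp
  have "(\<Sum>k<b. cotpi (k / b) * cotpi (real k * of_int a / b)) =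
        (\<Sum>k<b. \<Sum>n'<b. \<Sum>n<b. 4 * (sawtooth (n' / b) * (sawtooth (n / b) * (?S k (int n) * ?S k (int n' * a)))))"
  proof (rule sum.cong[OF refl])
    fix k
    have "cotpi (k / b) = -2 * (\<Sum>n<b. sawtooth (n / b) * ?S k (int n))"
      using c[of "int k"] by (simp add: mult.commute)
    moreover have "cotpi (real k * of_int a / b) = -2 * (\<Sum>n<b. sawtooth (n / b) * ?S k (int n * a))"
      using c[of "int k * a"] by (simp add: mult.left_commute)
    ultimately have "cotpi (k / b) * cotpi (real k * of_int a / b) =
       4 * ((\<Sum>n'<b. sawtooth (n' / b) * ?S k (int n' * a)) * (\<Sum>n<b. sawtooth (n / b) * ?S k (int n)))" by simp
    also have "\<dots> = (\<Sum>n'<b. \<Sum>n<b. 4 * (sawtooth (n' / b) * (sawtooth (n / b) * (?S k (int n) * ?S k (int n' * a)))))"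
      by (subst sum_product) (simp only: sum_distrib_left mult_ac)
    finally show "cotpi (k / b) * cotpi (real k * of_int a / b) = \<dots>" .
  qed
  also have "\<dots> = (\<Sum>n'<b. \<Sum>n<b. \<Sum>k<b. 4 * (sawtooth (n' / b) * (sawtooth (n / b) * (?S k (int n) * ?S k (int n' * a)))))"
    by (subst sum.swap, rule sum.cong[OF refl], rule sum.swap)
  also have "\<dots> = (\<Sum>n'<b. 2 * b * (sawtooth (n' / b) * ((\<Sum>n<b. sawtooth (n / b) * (if int b dvd int n - int n' * a then 1 else 0)) -
      (\<Sum>n<b. sawtooth (n / b) * (if int b dvd int n - (- (int n' * a)) then 1 else 0)))))"
    unfolding sum_distrib_left[symmetric] sum_sin_orthogonal[OF b] sum_subtractf[symmetric]
    by (simp add: sum_distrib_left algebra_simps)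
  also have "\<dots> = (\<Sum>n'<b. 2 * b * (sawtooth (n' / b) * (sawtooth (of_int (int n' * a) / b) - sawtooth (of_int (- (int n' * a)) / b))))"
    unfolding sum_sawtooth_residue[OF b] ..
  also have "\<dots> = 4 * b * dedekind_sum a (int b)"
    by (simp add: sawtooth_minus dedekind_sum_nat[OF b] sum_distrib_left mult.assoc)
  finally show ?thesis using b by simp
qed

section \<open>Reciprocity for cotangent sums\<close>

lemma sum_int_concat:
  fixes f :: "int \<Rightarrow> real"
  assumes "p \<le> q" "q \<le> r"
  shows "sum f {p..<r} = sum f {p..<q} + sum f {q..<r}"
  using assms by (subst sum.union_disjoint[symmetric]) (auto intro!: arg_cong[where f = "sum f"])

lemma sum_periodic_window:
  fixes f :: "int \<Rightarrow> real"
  assumes per: "\<And>i. f (i + N) = f i" and "N > 0"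
  shows "sum f {m..<m + N} = sum f {0..<N}"
proof -
  have step: "sum f {m + 1..<m + 1 + N} = sum f {m..<m + N}" for m
  proof -
    have "sum f {q..<q + 1} = f q" for q
    proof -
      have "{q..<q + 1} = {q}" by auto
      then show ?thesis by simp
    qed
    from this[of m] this[of "m + N"] show ?thesis
      using sum_int_concat[of m "m + 1" "m + 1 + N" f] sum_int_concat[of m "m + N" "m + 1 + N" f] per[of m] \<open>N > 0\<close>
      by (simp add: add.assoc add.commute[of N])
  qed
  show ?thesis
  proof (induction m rule: int_induct[of _ 0])
    case base then show ?case by simp
  next
    case (step1 i) then show ?case using step[of i] by simp
  next
    case (step2 i) then show ?case using step[of "i - 1"] by simp
  qed
qed

lemma sum_odd_periodic_window:
  fixes f :: "int \<Rightarrow> real"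
  assumes per: "\<And>i. f (i + N) = f i" and "N > 0" and odd: "\<And>i. f (- i) = - f i"
  shows "sum f {m..<m + N} = 0"
proof -
  \<comment> \<open>The window starting at 1 - N is the reflection of {0..<N}: its sum is the
    negative by oddness and the same by periodicity.\<close>
  have "sum f {1 - N..<1 - N + N} = sum (\<lambda>i. f (- i)) {0..<N}"
    by (rule sum.reindex_bij_witness[of _ uminus uminus]) auto
  also have "\<dots> = - sum f {0..<N}" by (simp add: odd sum_negf)
  finally have "sum f {0..<N} = - sum f {0..<N}"
    using sum_periodic_window[of f N "1 - N", OF per \<open>N > 0\<close>] by metis
  then show ?thesis using sum_periodic_window[of f N m, OF per \<open>N > 0\<close>] by linarith
qed

section \<open>Cotangent sums over one full cell around a pole\<close>

lemma sum_cotpi_multiplication_nonint: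
  assumes N: "N > 0" and x: "x \<notin> \<int>"
  shows "(\<Sum>i<N. cotpi ((x + real i) / N)) = N * cotpi x"
proof -
  define q where "q = cis (2 * pi * x / N)"
  define z where "z i = cis (2 * pi * ((x + real i) / N))" for i :: nat
  have ne: "cis (2 * pi * t) \<noteq> 1" if "t \<notin> \<int>" for t
  proof
    assume "cis (2 * pi * t) = 1"
    then have "cos (2 * pi * t) = 1" by (simp add: complex_eq_iff)
    then obtain n :: int where "2 * pi * t = of_int n * 2 * pi" by (auto simp: cos_one_2pi_int)
    then have "t = of_int n" by simp
    then show False using that by simp
  qed
  have P: "cis (2 * pi * x) \<noteq> 1" using ne x by blast
  have zq: "z i ^ n = q ^ n * cis (2 * pi * of_int (int n) / N) ^ i" for i n
    unfolding z_def q_def Complex.DeMoivre cis_mult using N by (intro arg_cong[of _ _ cis]) (simp add: field_simps)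
  have zN: "z i ^ N = cis (2 * pi * x)" for i
  proof -
    have "z i ^ N = cis (2 * pi * x + 2 * pi * of_nat i)"
      unfolding z_def Complex.DeMoivre using N by (intro arg_cong[of _ _ cis]) (simp add: field_simps)
    then show ?thesis by (simp flip: cis_mult)
  qed
  have z1: "z i \<noteq> 1" for i using zN[of i] P by auto
  \<comment> \<open>All z i are N-th roots of the one number cis (2 pi x), so 1 / (z i - 1) is a
    geometric sum in z i divided by a constant. Summed over i, only the power n = 0
    survives.\<close>
  have "(\<Sum>i<N. 1 / (z i - 1)) = (\<Sum>i<N. (\<Sum>n<N. z i ^ n) / (cis (2 * pi * x) - 1))"
  proof (intro sum.cong refl)
    fix i
    have "(\<Sum>n<N. z i ^ n) = (cis (2 * pi * x) - 1) / (z i - 1)"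
      using z1[of i] by (simp add: sum_gp_strict zN) (metis minus_diff_eq minus_divide_divide)
    then show "1 / (z i - 1) = (\<Sum>n<N. z i ^ n) / (cis (2 * pi * x) - 1)" using P by simp
  qed
  also have "\<dots> = (\<Sum>n<N. q ^ n * (\<Sum>i<N. cis (2 * pi * of_int (int n) / N) ^ i)) / (cis (2 * pi * x) - 1)"
    unfolding zq sum_divide_distrib[symmetric] sum_distrib_left by (subst sum.swap) simp
  also have "(\<Sum>n<N. q ^ n * (\<Sum>i<N. cis (2 * pi * of_int (int n) / N) ^ i)) = (\<Sum>n<N. if n = 0 then of_nat N else 0)"
  proof (rule sum.cong[OF refl])
    fix n assume "n \<in> {..<N}"
    then show "q ^ n * (\<Sum>i<N. cis (2 * pi * of_int (int n) / N) ^ i) = (if n = 0 then of_nat N else 0)"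
      using sum_cis_eq_0[OF N, of "int n"] nat_dvd_not_less[of n N] by (cases "n = 0") auto
  qed
  also have "\<dots> = of_nat N" using N by simp
  finally have *: "(\<Sum>i<N. 1 / (z i - 1)) = of_nat N / (cis (2 * pi * x) - 1)" .
  have I: "Im (1 / (cis (2 * pi * t) - 1)) = - cotpi t / 2" if "cis (2 * pi * t) \<noteq> 1" for t
    using Im_inverse_cis_diff_1[OF that] by (simp add: cotpi_def)
  have "(\<Sum>i<N. - cotpi ((x + real i) / N) / 2) = Im (\<Sum>i<N. 1 / (z i - 1))"
  proof -
    have "Im (1 / (z i - 1)) = - cotpi ((x + real i) / N) / 2" for i
      using I[of "(x + real i) / N"] z1[of i] unfolding z_def by blast
    then show ?thesis by simp
  qed
  also have "\<dots> = N * Im (1 / (cis (2 * pi * x) - 1))" unfolding * by (simp add: Im_divide)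
  also have "\<dots> = - N * cotpi x / 2" by (simp add: I P)
  finally have "(\<Sum>i<N. cotpi ((x + real i) / N)) / 2 = N * cotpi x / 2"
    by (simp add: sum_negf flip: sum_divide_distrib)
  then show ?thesis by simp
qed

text \<open>The window may start anywhere, which lets it be centred at y. At integral y both sides
  are 0, the left by oddness and the right by the default value of \<open>cotpi\<close>.\<close>

lemma sum_cotpi_multiplication:
  assumes N: "N > 0"
  shows "(\<Sum>i\<in>{m..<m + int N}. cotpi ((of_int i - y) / N)) = - (N * cotpi y)"
proof (cases "y \<in> \<int>")
  case True
  then obtain t where t: "y = of_int t" by (auto elim: Ints_cases)
  have "(\<Sum>i\<in>{m..<m + int N}. cotpi ((of_int i - y) / N)) = (\<Sum>i\<in>{m - t..<m - t + int N}. cotpi (of_int i / N))"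
    by (rule sum.reindex_bij_witness[of _ "\<lambda>i. i + t" "\<lambda>i. i - t"]) (auto simp: t)
  also have "\<dots> = 0"
  proof (rule sum_odd_periodic_window)
    fix i show "cotpi (of_int (i + int N) / N) = cotpi (of_int i / N)"
      using cotpi_add_int[of "of_int i / N" 1] N by (simp add: add_divide_distrib)
  qed (use N in auto)
  finally show ?thesis by (simp add: t)
next
  case False
  have "(\<Sum>i\<in>{m..<m + int N}. cotpi ((of_int i - y) / N)) = (\<Sum>i<N. cotpi (((of_int m - y) + real i) / N))"
    by (rule sum.reindex_bij_witness[of _ "\<lambda>i. m + int i" "\<lambda>i. nat (i - m)"]) (auto simp: algebra_simps nat_less_iff)
  also have "\<dots> = N * cotpi (of_int m - y)"
    using False by (intro sum_cotpi_multiplication_nonint N) (metis Ints_diff Ints_of_int diff_diff_eq2 add_diff_cancel_left')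
  also have "cotpi (of_int m - y) = - cotpi y"
    using cotpi_add_int[of "-y" m] by (simp add: algebra_simps)
  finally show ?thesis by simp
qed

text \<open>For \<theta> = pi z / t, this quantity divided by (t sin \<theta>)^2 is the derivative
  in t of cot (pi z / t) / t. The bound by a multiple of sin^2 \<theta> cancels the singular
  denominator.\<close>

lemma diff_sin_cos_bounds:
  assumes "0 \<le> \<theta>" "\<theta> \<le> pi/2"
  shows "0 \<le> \<theta> - sin \<theta> * cos \<theta>" "\<theta> - sin \<theta> * cos \<theta> \<le> 3 * (sin \<theta>)\<^sup>2"
proof -
  have s: "0 \<le> sin \<theta>" "sin \<theta> \<le> \<theta>" using assms by (auto intro!: sin_ge_zero sin_x_le_x)
  have c: "0 \<le> cos \<theta>" "cos \<theta> \<le> 1" using assms by (auto intro!: cos_ge_zero)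
  have "sin \<theta> * cos \<theta> \<le> \<theta> * 1" using s c by (intro mult_mono) auto
  then show "0 \<le> \<theta> - sin \<theta> * cos \<theta>" by simp
  have "(sin \<theta>)\<^sup>2 = (1 - cos \<theta>) * (1 + cos \<theta>)" using sin_cos_squared_add[of \<theta>] by (simp add: algebra_simps power2_eq_square)
  then have 1: "1 - cos \<theta> \<le> (sin \<theta>)\<^sup>2" using mult_left_mono[of 1 "1 + cos \<theta>" "1 - cos \<theta>"] c by simp
  have "\<theta> - sin \<theta> \<le> \<theta> * (1 - cos \<theta>)" using mult_cos_le_sin[OF assms] by (simp add: algebra_simps)
  also have "\<dots> \<le> 2 * (sin \<theta>)\<^sup>2" using 1 assms pi_less_4 c by (intro mult_mono) auto
  finally have "\<theta> - sin \<theta> \<le> 2 * (sin \<theta>)\<^sup>2" .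
  moreover have "sin \<theta> * (1 - cos \<theta>) \<le> 1 * (sin \<theta>)\<^sup>2" using 1 s c by (intro mult_mono) auto
  ultimately show "\<theta> - sin \<theta> * cos \<theta> \<le> 3 * (sin \<theta>)\<^sup>2" by (simp add: algebra_simps)
qed

text \<open>After division by c and N both cotangents have the same polar part 1/(pi z), so a change
  of the period from N to c is harmless even near the pole. The mean value theorem is applied in the
  period, with z fixed.\<close>

lemma cotpi_rescale_pos:
  assumes "0 < z" "z \<le> N / 2" "N \<le> c" 
  shows "\<bar>cotpi (z / c) / c - cotpi (z / N) / N\<bar> \<le> 3 * (c - N) / N\<^sup>2"
proof (cases "N = c")
  case False
  have N: "0 < N" "N < c" using assms False by auto
  define F where "F t = cos (pi * z / t) / (t * sin (pi * z / t))" for t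
  define F' where "F' t = (pi * z / t - sin (pi * z / t) * cos (pi * z / t)) / (t\<^sup>2 * (sin (pi * z / t))\<^sup>2)" for t
  have th: "0 < pi * z / t" "pi * z / t \<le> pi / 2" if "N \<le> t" for t
    using assms N that by (auto simp: field_simps)
  have sp: "sin (pi * z / t) > 0" if "N \<le> t" for t
    using th[OF that] pi_gt_zero by (intro sin_gt_zero) linarith+
  have D: "(F has_real_derivative F' t) (at t)" if "N \<le> t" for t
  proof -
    have [simp]: "t \<noteq> 0" "sin (pi * z / t) \<noteq> 0" using N sp[OF that] that by auto
    have "(sin (pi * z / t))\<^sup>2 + (cos (pi * z / t))\<^sup>2 = 1" by simp
    then show ?thesis unfolding F_def F'_def
      apply (auto intro!: derivative_eq_intros)
      apply (simp add: field_simps power2_eq_square)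
      apply (simp flip: distrib_left)
      done
  qed
  obtain t where t: "N < t" "t < c" "F c - F N = (c - N) * F' t"
    using MVT2[OF \<open>N < c\<close>, of F F'] D by auto
  have b: "0 \<le> F' t" "F' t \<le> 3 / N\<^sup>2"
  proof -
    note d = diff_sin_cos_bounds[of "pi * z / t"]
    show "0 \<le> F' t" unfolding F'_def using d th[of t] t by (intro divide_nonneg_nonneg) auto
    have "F' t \<le> (3 * (sin (pi * z / t))\<^sup>2) / (t\<^sup>2 * (sin (pi * z / t))\<^sup>2)"
      unfolding F'_def using d th[of t] t by (intro divide_right_mono) auto
    also have "\<dots> = 3 / t\<^sup>2" using sp[of t] t by simp
    also have "\<dots> \<le> 3 / N\<^sup>2" using t N by (intro divide_left_mono power_mono mult_pos_pos) auto
    finally show "F' t \<le> 3 / N\<^sup>2" .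
  qed
  have "\<bar>F c - F N\<bar> = (c - N) * F' t" using t b N by (simp add: abs_mult)
  also have "\<dots> \<le> (c - N) * (3 / N\<^sup>2)" using b N by (intro mult_left_mono) auto
  finally show ?thesis by (simp add: F_def cotpi_def cot_def mult_ac)
qed auto

lemma cotpi_rescale:
  assumes "\<bar>z\<bar> \<le> N / 2" "N \<le> c" "c \<le> N + 1" "2 \<le> N"
  shows "\<bar>cotpi (z / c) - c / N * cotpi (z / N)\<bar> \<le> 5 / N"
proof -
  have *: "\<bar>cotpi (z / c) - c / N * cotpi (z / N)\<bar> \<le> 5 / N" if z: "0 < z" "z \<le> N / 2" for z
  proof -
    have "\<bar>cotpi (z / c) - c / N * cotpi (z / N)\<bar> = c * \<bar>cotpi (z / c) / c - cotpi (z / N) / N\<bar>"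
    proof -
      have "cotpi (z / c) - c / N * cotpi (z / N) = c * (cotpi (z / c) / c - cotpi (z / N) / N)"
        using assms by (simp add: field_simps)
      then show ?thesis using assms by (simp add: abs_mult)
    qed
    also have "\<dots> \<le> c * (3 * (c - N) / N\<^sup>2)"
      using cotpi_rescale_pos[OF z assms(2)] assms by (intro mult_left_mono) auto
    \<comment> \<open>c \<le> N + 1 \<le> 3/2 * N because N \<ge> 2; the resulting 9/2 is rounded up
      to 5.\<close>
    also have "\<dots> \<le> (3/2 * N) * (3 * 1 / N\<^sup>2)"
      using assms by (intro mult_mono divide_right_mono) auto
    also have "\<dots> \<le> 5 / N" using assms by (simp add: power2_eq_square field_simps)
    finally show ?thesis .
  qed
  consider "z = 0" | "z > 0" | "z < 0" by linarith
  then show ?thesis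
  proof cases
    case 3
    then show ?thesis using *[of "- z"] assms by (simp add: abs_if split: if_splits)
  qed (use * assms in auto)
qed

text \<open>The multiplication formula needs an integral period, but a cell has real length c, later
  b/k. The formula is applied with N = floor c around the same centre and every term is rescaled, N
  errors of 5/N. The true cell holds at most one further integer at each end, where the cotangent is
  at most 3/2; in all 5 + 3/2 + 3/2 = 8. With y = l c the term \<open>c * cotpi y\<close> becomes
  the reciprocal term of the pole l.\<close>

lemma cotpi_cell:
  assumes c: "c \<ge> 2"
  shows "\<bar>(\<Sum>a\<in>{\<lceil>y - c/2\<rceil>..<\<lceil>y + c/2\<rceil>}. cotpi ((of_int a - y) / c)) + c * cotpi y\<bar> \<le> 8"
proof -
  define N where "N = nat \<lfloor>c\<rfloor>"
  have N: "real N \<le> c" "c < real N + 1" "2 \<le> real N" 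
  proof -
    have "2 \<le> \<lfloor>c\<rfloor>" using c by (simp add: le_floor_iff)
    then show "real N \<le> c" "c < real N + 1" "2 \<le> real N" unfolding N_def by linarith+
  qed
  let ?f = "\<lambda>a::int. cotpi ((of_int a - y) / c)"
  define p where "p = \<lceil>y - real N / 2\<rceil>"
  have pN: "\<lceil>y + real N / 2\<rceil> = p + int N" unfolding p_def by linarith
  have o1: "\<lceil>y - c/2\<rceil> \<le> p" unfolding p_def using N by linarith
  have o1': "p \<le> \<lceil>y - c/2\<rceil> + 1" unfolding p_def using N by linarith
  have o2: "p + int N \<le> \<lceil>y + c/2\<rceil>" unfolding pN[symmetric] using N by linarith
  have o2': "\<lceil>y + c/2\<rceil> \<le> p + int N + 1" unfolding pN[symmetric] using N by linarith
  \<comment> \<open>Past N/2 but within c/2, the quotient (a - y)/c lies between 1/3 and 1/2 in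
    absolute value, hence at distance at least 1/3 from every integer.\<close>
  have small: "\<bar>?f a\<bar> \<le> 3/2" if "\<bar>of_int a - y\<bar> \<ge> N / 2" "\<bar>of_int a - y\<bar> \<le> c / 2" for a
  proof -
    have "c \<le> 3/2 * real N" using N by linarith
    then have "c / 3 \<le> \<bar>of_int a - y\<bar>" using that by linarith
    then have "1/3 \<le> \<bar>(of_int a - y) / c\<bar>" using c by (simp add: abs_divide field_simps)
    moreover have "\<bar>(of_int a - y) / c\<bar> \<le> 1 - 1/3" using that c by (simp add: abs_divide field_simps)
    ultimately show ?thesis using cotpi_le_abs[of "1/3" "(of_int a - y) / c"] by simp
  qed
  have e1: "\<bar>sum ?f {\<lceil>y - c/2\<rceil>..<p}\<bar> \<le> 3/2"
  proof -
    have "\<bar>sum ?f {\<lceil>y - c/2\<rceil>..<p}\<bar> \<le> (\<Sum>a\<in>{\<lceil>y - c/2\<rceil>..<p}. \<bar>?f a\<bar>)" by (rule sum_abs)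
    also have "\<dots> \<le> (\<Sum>a\<in>{\<lceil>y - c/2\<rceil>..<p}. 3/2)"
    proof (rule sum_mono)
      fix a assume "a \<in> {\<lceil>y - c/2\<rceil>..<p}"
      then have "y - c/2 \<le> of_int a" "of_int a < y - real N / 2" unfolding p_def by (auto simp: ceiling_le_iff less_ceiling_iff)
      then show "\<bar>?f a\<bar> \<le> 3/2" by (intro small) auto
    qed
    also have "\<dots> \<le> 3/2" using o1 o1' by simp
    finally show ?thesis .
  qed
  have e2: "\<bar>sum ?f {p + int N..<\<lceil>y + c/2\<rceil>}\<bar> \<le> 3/2"
  proof -
    have "\<bar>sum ?f {p + int N..<\<lceil>y + c/2\<rceil>}\<bar> \<le> (\<Sum>a\<in>{p + int N..<\<lceil>y + c/2\<rceil>}. \<bar>?f a\<bar>)" by (rule sum_abs)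
    also have "\<dots> \<le> (\<Sum>a\<in>{p + int N..<\<lceil>y + c/2\<rceil>}. 3/2)"
    proof (rule sum_mono)
      fix a assume "a \<in> {p + int N..<\<lceil>y + c/2\<rceil>}"
      then have "y + real N / 2 \<le> of_int a" "of_int a < y + c / 2" unfolding pN[symmetric] by (auto simp: ceiling_le_iff less_ceiling_iff)
      then show "\<bar>?f a\<bar> \<le> 3/2" by (intro small) auto
    qed
    also have "\<dots> \<le> 3/2" using o2 o2' by simp
    finally show ?thesis .
  qed
  have e3: "\<bar>sum ?f {p..<p + int N} + c * cotpi y\<bar> \<le> 5"
  proof -
    have "c * cotpi y = - (c / N) * (- (N * cotpi y))" using N by simp
    also have "\<dots> = - (c / N) * (\<Sum>a\<in>{p..<p + int N}. cotpi ((of_int a - y) / N))"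
      using N by (subst sum_cotpi_multiplication) auto
    finally have "sum ?f {p..<p + int N} + c * cotpi y = (\<Sum>a\<in>{p..<p + int N}. ?f a - c / N * cotpi ((of_int a - y) / N))"
      by (simp add: sum_subtractf sum_distrib_left sum_negf)
    also have "\<bar>\<dots>\<bar> \<le> (\<Sum>a\<in>{p..<p + int N}. \<bar>?f a - c / N * cotpi ((of_int a - y) / N)\<bar>)" by (rule sum_abs)
    also have "\<dots> \<le> (\<Sum>a\<in>{p..<p + int N}. 5 / N)"
    proof (rule sum_mono)
      fix a assume "a \<in> {p..<p + int N}"
      then have "y - real N / 2 \<le> of_int a" "of_int a < y + real N / 2" unfolding pN[symmetric] unfolding p_def by (auto simp: ceiling_le_iff less_ceiling_iff)
      then have "\<bar>of_int a - y\<bar> \<le> real N / 2" by linarith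
      then show "\<bar>?f a - c / N * cotpi ((of_int a - y) / N)\<bar> \<le> 5 / N" using N by (intro cotpi_rescale) auto
    qed
    also have "\<dots> = 5" using N by simp
    finally show ?thesis .
  qed
  have "sum ?f {\<lceil>y - c/2\<rceil>..<\<lceil>y + c/2\<rceil>} =
     sum ?f {\<lceil>y - c/2\<rceil>..<p} + (sum ?f {p..<p + int N} + sum ?f {p + int N..<\<lceil>y + c/2\<rceil>})"
    using o1 o2 by (simp flip: sum_int_concat)
  then show ?thesis using e1 e2 e3 by linarith
qed

section \<open>Half cells, whose pole lies at an end and yields a logarithm\<close>

lemma harm_le_ln: "n > 0 \<Longrightarrow> harm n \<le> ln (real n) + 1"
  using euler_mascheroni_sequence_decreasing[of 1 n] by (simp add: harm_expand)

text \<open>z0 is the distance from the pole to the next integer. Each cotangent is replaced by its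
  polar part c / (pi (z0 + i)) with error at most 1. The sum of 1/(z0 + i) is harmonic apart from
  its first term, which z0 \<ge> 1/w limits to w. The conditions on n say that the points just fill
  the half cell.\<close>

lemma cotpi_near_sum:
  assumes c: "c \<ge> 2" and w: "w \<ge> 1" and z0: "1 / w \<le> z0" "z0 \<le> 1"
    and n: "c / 2 - 1 \<le> real n" "\<And>i. i < n \<Longrightarrow> z0 + real i \<le> c / 2"
  shows "\<bar>(\<Sum>i<n. cotpi ((z0 + real i) / c)) - c / pi * ln c\<bar> \<le> (w + 3) * c"
proof -
  define S where "S = (\<Sum>i<n. 1 / (z0 + real i))"
  have z0p: "z0 > 0" using z0 w by (smt (verit) divide_pos_pos)
  have nc: "real n \<le> c"
  proof (cases "n = 0")
    case False
    then show ?thesis using n(2)[of "n - 1"] z0p c by (simp add: of_nat_diff)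
  qed (use c in auto)
  have d: "\<bar>(\<Sum>i<n. cotpi ((z0 + real i) / c)) - c / pi * S\<bar> \<le> c"
  proof -
    have "(\<Sum>i<n. cotpi ((z0 + real i) / c)) - c / pi * S = (\<Sum>i<n. cotpi ((z0 + real i) / c) - 1 / (pi * ((z0 + real i) / c)))"
      by (simp add: S_def sum_subtractf sum_distrib_left)
    also have "\<bar>\<dots>\<bar> \<le> (\<Sum>i<n. \<bar>cotpi ((z0 + real i) / c) - 1 / (pi * ((z0 + real i) / c))\<bar>)" by (rule sum_abs)
    also have "\<dots> \<le> (\<Sum>i<n. 1)"
    proof (rule sum_mono)
      fix i assume i: "i \<in> {..<n}"
      have "0 < (z0 + real i) / c" "(z0 + real i) / c \<le> 1/2" using z0p c n(2)[of i] i by (auto simp: field_simps)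
      then show "\<bar>cotpi ((z0 + real i) / c) - 1 / (pi * ((z0 + real i) / c))\<bar> \<le> 1"
        using cotpi_le[of "(z0 + real i) / c"] cotpi_ge[of "(z0 + real i) / c"] by linarith
    qed
    also have "\<dots> \<le> c" using nc by simp
    finally show ?thesis .
  qed
  have lo: "S \<ge> ln c - 1"
  proof -
    have "ln c = ln (c / 2) + ln 2" using c by (simp add: ln_div)
    also have "ln (c / 2) \<le> ln (real (n + 1))" using n c by (intro ln_mono) auto
    also have "\<dots> \<le> harm n" using ln_le_harm[of n] by (simp add: add.commute)
    also have "harm n \<le> S" unfolding harm_def S_def One_nat_def sum.atLeast1_atMost_eq
      using z0 z0p by (intro sum_mono) (auto simp: inverse_eq_divide intro!: divide_left_mono mult_pos_pos)
    finally show ?thesis using ln_2_less_1 by simp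
  qed
  have up: "S \<le> w + 1 + ln c"
  proof (cases "n = 0")
    case True
    then show ?thesis using c w by (simp add: S_def)
  next
    case False
    then obtain m where m: "n = Suc m" by (cases n) auto
    have "S = 1 / z0 + (\<Sum>i<m. 1 / (z0 + real (Suc i)))"
      unfolding S_def m sum.lessThan_Suc_shift by simp
    also have "1 / z0 \<le> w" using z0 z0p w by (simp add: field_simps)
    also have "(\<Sum>i<m. 1 / (z0 + real (Suc i))) \<le> harm m"
      unfolding harm_def One_nat_def sum.atLeast1_atMost_eq using z0p
      by (intro sum_mono) (auto simp: inverse_eq_divide intro!: divide_left_mono mult_pos_pos)
    also have "harm m \<le> 1 + ln c"
    proof (cases "m = 0")
      case False
      then have "harm m \<le> ln (real m) + 1" by (intro harm_le_ln) auto
      also have "ln (real m) \<le> ln c" using False nc m by (intro ln_mono) auto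
      finally show ?thesis by simp
    qed (use c in \<open>auto simp: harm_def\<close>)
    finally show ?thesis by simp
  qed
  have "\<bar>S - ln c\<bar> \<le> w + 1" using lo up w by linarith
  then have "c / pi * \<bar>S - ln c\<bar> \<le> c * (w + 1)"
    using c pi_ge_two w by (intro mult_mono) (auto simp: field_simps)
  then have "\<bar>c / pi * S - c / pi * ln c\<bar> \<le> c * (w + 1)"
  proof -
    have "c / pi * S - c / pi * ln c = c / pi * (S - ln c)" by (simp add: right_diff_distrib)
    then show ?thesis using \<open>c / pi * \<bar>S - ln c\<bar> \<le> c * (w + 1)\<close> c by (simp only: abs_mult) simp
  qed
  then have "\<bar>(\<Sum>i<n. cotpi ((z0 + real i) / c)) - c / pi * ln c\<bar> \<le> c * (w + 1) + c"
  proof -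
    have "\<bar>x - z\<bar> \<le> q + p" if "\<bar>y - z\<bar> \<le> q" "\<bar>x - y\<bar> \<le> p" for x y z p q :: real
      using that by linarith
    from this[OF _ d] show ?thesis using \<open>\<bar>c / pi * S - c / pi * ln c\<bar> \<le> c * (w + 1)\<close> by blast
  qed
  also have "\<dots> \<le> (w + 3) * c" using c by (simp add: algebra_simps)
  finally show ?thesis .
qed

lemma cotpi_half_cell:
  assumes c: "c \<ge> 2"
  shows "\<bar>(\<Sum>a\<in>{0..<\<lceil>c/2\<rceil>}. cotpi (of_int a / c)) - c / pi * ln c\<bar> \<le> 4 * c"
proof -
  define n where "n = nat (\<lceil>c/2\<rceil> - 1)"
  have nc: "real n = of_int \<lceil>c/2\<rceil> - 1" unfolding n_def using c by simp
  have "(\<Sum>a\<in>{0..<\<lceil>c/2\<rceil>}. cotpi (of_int a / c)) = (\<Sum>a\<in>{1..<\<lceil>c/2\<rceil>}. cotpi (of_int a / c))"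
  proof (rule sum.mono_neutral_right)
    show "\<forall>i\<in>{0..<\<lceil>c/2\<rceil>} - {1..<\<lceil>c/2\<rceil>}. cotpi (of_int i / c) = 0"
    proof
      fix i assume "i \<in> {0..<\<lceil>c/2\<rceil>} - {1..<\<lceil>c/2\<rceil>}"
      then have "i = 0" by auto
      then show "cotpi (of_int i / c) = 0" by simp
    qed
  qed auto
  also have "\<dots> = (\<Sum>i<n. cotpi ((1 + real i) / c))"
    by (rule sum.reindex_bij_witness[of _ "\<lambda>i. 1 + int i" "\<lambda>a. nat (a - 1)"]) (auto simp: n_def nat_less_iff simp del: one_less_ceiling)
  finally have "(\<Sum>a\<in>{0..<\<lceil>c/2\<rceil>}. cotpi (of_int a / c)) = (\<Sum>i<n. cotpi ((1 + real i) / c))" .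
  moreover have "\<bar>(\<Sum>i<n. cotpi ((1 + real i) / c)) - c / pi * ln c\<bar> \<le> (1 + 3) * c"
  proof (rule cotpi_near_sum)
    show "c / 2 - 1 \<le> real n" unfolding nc by linarith
    fix i assume "i < n" then show "1 + real i \<le> c / 2" using nc by linarith
  qed (use c in auto)
  ultimately show ?thesis by simp
qed

text \<open>The pole m c is a multiple of 1/w, so the last integer strictly below it, e - 1, has
  distance z0 between 1/w and 1 from it. Reflection at the pole changes the sign of the cotangents,
  which makes the logarithm negative.\<close>

lemma cotpi_half_cell_left:
  fixes m :: int
  assumes c: "c \<ge> 2" and w: "w \<ge> 1" and mc: "of_int m * c = of_int u / of_nat w"
  shows "\<bar>(\<Sum>a\<in>{\<lceil>of_int m * c - c/2\<rceil>..<\<lceil>of_int m * c\<rceil>}. cotpi (of_int a / c)) + c / pi * ln c\<bar> \<le> (of_nat w + 3) * c"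
proof -
  define e where "e = \<lceil>of_int m * c\<rceil>"
  define z0 where "z0 = of_int m * c - of_int (e - 1)"
  define n where "n = nat (e - \<lceil>of_int m * c - c/2\<rceil>)"
  have le: "\<lceil>of_int m * c - c/2\<rceil> \<le> e" unfolding e_def using c by (intro ceiling_mono) auto
  have nr: "real n = of_int e - of_int \<lceil>of_int m * c - c/2\<rceil>" unfolding n_def using le by simp
  have z0: "0 < z0" "z0 \<le> 1" unfolding z0_def e_def by linarith+
  have "z0 \<ge> 1 / real w"
  proof -
    have "z0 * w = of_int (u - int w * (e - 1))" using w unfolding z0_def mc by (simp add: field_simps)
    moreover have "z0 * w > 0" using z0 w by simp
    ultimately have "z0 * w \<ge> 1" by (metis of_int_0_less_iff of_int_1_le_iff int_one_le_iff_zero_less)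
    then show ?thesis using w by (simp add: field_simps)
  qed
  have "(\<Sum>a\<in>{\<lceil>of_int m * c - c/2\<rceil>..<e}. cotpi (of_int a / c)) = (\<Sum>i<n. cotpi (of_int (e - 1 - int i) / c))"
    by (rule sum.reindex_bij_witness[of _ "\<lambda>i. e - 1 - int i" "\<lambda>a. nat (e - 1 - a)"]) (use le in \<open>auto simp: n_def nat_less_iff\<close>)
  also have "\<dots> = (\<Sum>i<n. - cotpi ((z0 + real i) / c))"
  proof (rule sum.cong[OF refl])
    fix i
    have "of_int (e - 1 - int i) / c = - ((z0 + real i) / c) + of_int m" using c by (simp add: z0_def field_simps)
    then show "cotpi (of_int (e - 1 - int i) / c) = - cotpi ((z0 + real i) / c)" by (metis cotpi_add_int cotpi_minus)
  qed
  finally have 1: "(\<Sum>a\<in>{\<lceil>of_int m * c - c/2\<rceil>..<e}. cotpi (of_int a / c)) = - (\<Sum>i<n. cotpi ((z0 + real i) / c))" by (simp add: sum_negf)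
  have 2: "\<bar>(\<Sum>i<n. cotpi ((z0 + real i) / c)) - c / pi * ln c\<bar> \<le> (of_nat w + 3) * c"
  proof (rule cotpi_near_sum)
    show "c / 2 - 1 \<le> real n" unfolding nr e_def by linarith
    fix i assume "i < n"
    then have "real i + 1 \<le> real n" by linarith
    moreover have "of_int \<lceil>of_int m * c - c/2\<rceil> \<ge> of_int m * c - c/2" by linarith
    moreover have "z0 = of_int m * c - of_int e + 1" by (simp add: z0_def)
    ultimately show "z0 + real i \<le> c / 2" using nr by linarith
  qed (use c w z0 \<open>z0 \<ge> 1 / real w\<close> in auto)
  show ?thesis using 2 unfolding 1[unfolded e_def] by linarith
qed

text \<open>All arguments keep distance d from the integers, so a term is at most 1/(2 d), and the
  range holds at most c + 1 \<le> 2 c integers.\<close>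

lemma cotpi_far_sum:
  fixes L :: int
  assumes c: "c \<ge> 2" and d: "0 < d" "d \<le> 1/2" and p: "of_int L + d \<le> p" "p \<le> q" "q \<le> of_int L + 1 - d"
  shows "\<bar>\<Sum>a\<in>{\<lceil>p * c\<rceil>..<\<lceil>q * c\<rceil>}. cotpi (of_int a / c)\<bar> \<le> c / d"
proof -
  have "\<bar>\<Sum>a\<in>{\<lceil>p * c\<rceil>..<\<lceil>q * c\<rceil>}. cotpi (of_int a / c)\<bar> \<le> (\<Sum>a\<in>{\<lceil>p * c\<rceil>..<\<lceil>q * c\<rceil>}. \<bar>cotpi (of_int a / c)\<bar>)" by (rule sum_abs)
  also have "\<dots> \<le> (\<Sum>a\<in>{\<lceil>p * c\<rceil>..<\<lceil>q * c\<rceil>}. 1 / (2 * d))"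
  proof (rule sum_mono)
    fix a assume "a \<in> {\<lceil>p * c\<rceil>..<\<lceil>q * c\<rceil>}"
    then have "p * c \<le> of_int a" "of_int a < q * c" by (auto simp: ceiling_le_iff less_ceiling_iff)
    then have "p \<le> of_int a / c" "of_int a / c < q" using c by (auto simp: field_simps)
    then have "\<bar>cotpi (of_int a / c - of_int L)\<bar> \<le> 1 / (2 * d)" using p d by (intro cotpi_le_abs) auto
    then show "\<bar>cotpi (of_int a / c)\<bar> \<le> 1 / (2 * d)" by simp
  qed
  also have "\<dots> = of_int (\<lceil>q * c\<rceil> - \<lceil>p * c\<rceil>) * (1 / (2 * d))" using p c by (simp add: ceiling_mono mult_right_mono)
  also have "\<dots> \<le> (2 * c) * (1 / (2 * d))"
  proof (rule mult_right_mono)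
    have "(q - p) * c \<le> 1 * c" using p c d by (intro mult_right_mono) auto
    then show "real_of_int (\<lceil>q * c\<rceil> - \<lceil>p * c\<rceil>) \<le> 2 * c" using c by (simp add: algebra_simps) linarith
  qed (use d in auto)
  finally show ?thesis using d by simp
qed

text \<open>The cell with number l is centred at l c, where a/c passes the pole l; translation by
  the integer l reduces it to \<open>cotpi_cell\<close>, and the errors 8 add up.\<close>

lemma cotpi_cells:
  assumes c: "c \<ge> 2"
  shows "\<bar>(\<Sum>a\<in>{\<lceil>c/2\<rceil>..<\<lceil>(real L + 1/2) * c\<rceil>}. cotpi (of_int a / c)) + c * (\<Sum>l=1..L. cotpi (real l * c))\<bar> \<le> 8 * real L"
proof (induction L)
  case (Suc L)
  have "sum (\<lambda>a. cotpi (of_int a / c)) {\<lceil>c/2\<rceil>..<\<lceil>(real (Suc L) + 1/2) * c\<rceil>} =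
     sum (\<lambda>a. cotpi (of_int a / c)) {\<lceil>c/2\<rceil>..<\<lceil>(real L + 1/2) * c\<rceil>} +
     sum (\<lambda>a. cotpi (of_int a / c)) {\<lceil>(real L + 1/2) * c\<rceil>..<\<lceil>(real (Suc L) + 1/2) * c\<rceil>}"
    using c by (intro sum_int_concat ceiling_mono) (auto simp: algebra_simps)
  moreover have "\<bar>sum (\<lambda>a. cotpi (of_int a / c)) {\<lceil>(real L + 1/2) * c\<rceil>..<\<lceil>(real (Suc L) + 1/2) * c\<rceil>} + c * cotpi (real (Suc L) * c)\<bar> \<le> 8"
  proof -
    have "cotpi ((of_int a - real (Suc L) * c) / c) = cotpi (of_int a / c)" for a
      using cotpi_diff_int[of "of_int a / c" "int (Suc L)"] c by (simp add: diff_divide_distrib)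
    moreover have "real (Suc L) * c - c / 2 = (real L + 1/2) * c" "real (Suc L) * c + c / 2 = (real (Suc L) + 1/2) * c"
      by (auto simp: algebra_simps)
    ultimately show ?thesis using cotpi_cell[OF c, of "real (Suc L) * c"] by simp
  qed
  ultimately show ?case using Suc.IH by (simp add: algebra_simps)
qed simp

text \<open>Since b = k c, the range is a/c < \<alpha> k: a half cell at 0, L full cells for the
  poles 0 < l < \<alpha> k, and a last piece. If w divides k, then \<alpha> k is itself a pole, not
  counted by L, and the last piece is a left half cell whose logarithm cancels that of the pole 0.
  Otherwise the last piece, an excess or a deficit against the half-integer L + 1/2, keeps distance
  1/w from all poles and is at most w c.\<close>

lemma cotpi_sum_reciprocity:
  fixes v w k :: nat
  assumes c: "c \<ge> 2" and v: "v > 0" and w: "w > 0" and cop: "coprime v w" and k: "k > 0"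
    and kc: "real k * c = real b"
  defines "L \<equiv> nat (\<lceil>real v / real w * real k\<rceil> - 1)"
  shows "\<bar>(\<Sum>a\<in>{0..<\<lceil>real v / real w * b\<rceil>}. cotpi (of_int a / c)) + c * (\<Sum>l=1..L. cotpi (real l * c))
      - (if w dvd k then 0 else c / pi * ln c)\<bar> \<le> 8 * real L + (2 * real w + 7) * c"
proof -
  let ?f = "\<lambda>a::int. cotpi (of_int a / c)"
  define \<alpha> where "\<alpha> = real v / real w"
  have \<alpha>: "\<alpha> * b = \<alpha> * k * c" using kc by (simp add: mult.assoc)
  have ak: "\<alpha> * k > 0" using v w k by (simp add: \<alpha>_def)
  have Lr: "real L = of_int \<lceil>\<alpha> * k\<rceil> - 1" unfolding L_def \<alpha>_def[symmetric] using ak by simp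
  note A = cotpi_cells[OF c, of L] and B = cotpi_half_cell[OF c]
  have s1: "sum ?f {0..<\<lceil>(real L + 1/2) * c\<rceil>} = sum ?f {0..<\<lceil>c/2\<rceil>} + sum ?f {\<lceil>c/2\<rceil>..<\<lceil>(real L + 1/2) * c\<rceil>}"
    using c by (intro sum_int_concat ceiling_mono) (auto simp: algebra_simps intro: order_trans[of _ 0])
  show ?thesis
  proof (cases "w dvd k")
    case True
    then obtain k' where k': "k = w * k'" by (auto elim: dvdE)
    define m where "m = v * k'"
    have am: "\<alpha> * k = m" using w by (simp add: \<alpha>_def k' m_def)
    have Lm: "real L = real m - 1" using Lr am by simp
    have "sum ?f {0..<\<lceil>real m * c\<rceil>} = sum ?f {0..<\<lceil>(real L + 1/2) * c\<rceil>} + sum ?f {\<lceil>(real L + 1/2) * c\<rceil>..<\<lceil>real m * c\<rceil>}"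
    proof (intro sum_int_concat)
      have "0 \<le> (real L + 1/2) * c" using c by simp
      then show "0 \<le> \<lceil>(real L + 1/2) * c\<rceil>" by linarith
      show "\<lceil>(real L + 1/2) * c\<rceil> \<le> \<lceil>real m * c\<rceil>" using c Lm by (intro ceiling_mono mult_right_mono) auto
    qed
    moreover have "(real L + 1/2) * c = of_int (int m) * c - c / 2" unfolding Lm by (simp add: algebra_simps)
    moreover have "of_int (int m) * c = of_int (int v * int b) / real w"
      using am \<alpha> by (simp add: \<alpha>_def)
    ultimately have s2: "sum ?f {0..<\<lceil>real m * c\<rceil>} = sum ?f {0..<\<lceil>(real L + 1/2) * c\<rceil>} + sum ?f {\<lceil>(real L + 1/2) * c\<rceil>..<\<lceil>real m * c\<rceil>}"
      and D: "\<bar>sum ?f {\<lceil>(real L + 1/2) * c\<rceil>..<\<lceil>real m * c\<rceil>} + c / pi * ln c\<bar> \<le> (real w + 3) * c"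
      using cotpi_half_cell_left[of c w "int m" "int v * int b"] c w by auto
    have "(real w + 3) * c + 4 * c \<le> (2 * real w + 7) * c" using c w by (simp add: algebra_simps)
    then show ?thesis using s1 s2 A B D True unfolding \<alpha>_def[symmetric] \<alpha> am by simp
  next
    case False
    \<comment> \<open>The fractional part of \<alpha> k. By coprimality it is not 0, and \<tau> w is
      an integer strictly between 0 and w, so both \<tau> and 1 - \<tau> are at least 1/w.\<close>
    define \<tau> where "\<tau> = \<alpha> * k - L"
    have nint: "\<alpha> * k \<noteq> of_int i" for i
    proof
      assume "\<alpha> * k = of_int i"
      then have "real_of_int (int v * int k) = of_int (i * int w)" using w by (simp add: \<alpha>_def field_simps)
      then have "int w dvd int v * int k" by (metis dvd_triv_right of_int_eq_iff)
      then have "w dvd v * k" by (metis int_dvd_int_iff of_nat_mult)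
      then show False using False cop by (simp add: coprime_commute coprime_dvd_mult_right_iff)
    qed
    have t0: "0 < \<tau>" "\<tau> < 1"
      using nint[of "\<lceil>\<alpha> * k\<rceil>"] Lr unfolding \<tau>_def by linarith+
    have tw: "\<tau> * w = of_int (int v * int k - int L * int w)" using w by (simp add: \<tau>_def \<alpha>_def field_simps)
    have t1: "\<tau> \<ge> 1 / w"
    proof -
      have "\<tau> * w > 0" using t0 w by simp
      then have "\<tau> * w \<ge> 1" unfolding tw by (metis of_int_0_less_iff of_int_1_le_iff int_one_le_iff_zero_less)
      then show ?thesis using w by (simp add: field_simps)
    qed
    have t2: "\<tau> \<le> 1 - 1 / w"
    proof -
      have "\<tau> * w < w" using t0 w by simp
      then have "int v * int k - int L * int w < int w" unfolding tw by linarith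
      then have "\<tau> * w \<le> real w - 1" unfolding tw by linarith
      then show ?thesis using w by (simp add: field_simps)
    qed
    have nonneg_ceil: "0 \<le> \<lceil>x * c\<rceil>" if "x \<ge> 0" for x
    proof -
      have "0 \<le> x * c" using that c by simp
      then show ?thesis by linarith
    qed
    have w2: "w \<ge> 2" using False w by (cases "w = 1") auto
    have ak': "\<alpha> * k = real L + \<tau>" by (simp add: \<tau>_def)
    have "\<bar>sum ?f {0..<\<lceil>(real L + \<tau>) * c\<rceil>} - sum ?f {0..<\<lceil>(real L + 1/2) * c\<rceil>}\<bar> \<le> c / (1 / w)"
    proof (cases "\<tau> \<le> 1/2")
      case True
      have "sum ?f {0..<\<lceil>(real L + 1/2) * c\<rceil>} = sum ?f {0..<\<lceil>(real L + \<tau>) * c\<rceil>} + sum ?f {\<lceil>(real L + \<tau>) * c\<rceil>..<\<lceil>(real L + 1/2) * c\<rceil>}"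
        using c t0 True by (intro sum_int_concat ceiling_mono mult_right_mono nonneg_ceil) auto
      moreover have "\<bar>sum ?f {\<lceil>(real L + \<tau>) * c\<rceil>..<\<lceil>(real L + 1/2) * c\<rceil>}\<bar> \<le> c / (1 / w)"
        using t1 t2 True w2 c by (intro cotpi_far_sum[where L = "int L"]) (auto simp: field_simps)
      ultimately show ?thesis by linarith
    next
      case False
      have "sum ?f {0..<\<lceil>(real L + \<tau>) * c\<rceil>} = sum ?f {0..<\<lceil>(real L + 1/2) * c\<rceil>} + sum ?f {\<lceil>(real L + 1/2) * c\<rceil>..<\<lceil>(real L + \<tau>) * c\<rceil>}"
        using c t0 False by (intro sum_int_concat ceiling_mono mult_right_mono nonneg_ceil) auto
      moreover have "\<bar>sum ?f {\<lceil>(real L + 1/2) * c\<rceil>..<\<lceil>(real L + \<tau>) * c\<rceil>}\<bar> \<le> c / (1 / w)"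
        using t1 t2 False w2 c by (intro cotpi_far_sum[where L = "int L"]) (auto simp: field_simps)
      ultimately show ?thesis by linarith
    qed
    then have far: "\<bar>sum ?f {0..<\<lceil>\<alpha> * b\<rceil>} - sum ?f {0..<\<lceil>(real L + 1/2) * c\<rceil>}\<bar> \<le> w * c"
      unfolding \<alpha> ak' by (simp add: mult.commute)
    have "w * c + 4 * c \<le> (2 * real w + 7) * c" using c w by (simp add: algebra_simps)
    then show ?thesis using far A B s1 False unfolding \<alpha>_def[symmetric] by simp
  qed
qed

section \<open>Correlations of dilated sawtooth functions\<close>

lemma sum_shift_periodic_nat:
  fixes F :: "nat \<Rightarrow> real"
  assumes per: "\<And>t. F (t + N) = F t"
  shows "(\<Sum>t<N. F (t + c)) = (\<Sum>t<N. F t)"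
proof (induction c)
  case (Suc c)
  have "(\<Sum>t<N. F (t + Suc c)) + F c = (\<Sum>t<Suc N. F (t + c))"
    unfolding sum.lessThan_Suc_shift by simp
  also have "\<dots> = (\<Sum>t<N. F (t + c)) + F c" using per[of c] by (simp add: add.commute)
  finally show ?case using Suc.IH by simp
qed simp

lemma periodic_nat_mult:
  fixes F :: "nat \<Rightarrow> real"
  assumes per: "\<And>t. F (t + N) = F t"
  shows "F (t + m * N) = F t"
proof (induction m)
  case (Suc m) then show ?case using per[of "t + m * N"] by (simp add: algebra_simps)
qed simp

lemma periodic_nat_mod:
  fixes F :: "nat \<Rightarrow> real"
  assumes per: "\<And>t. F (t + N) = F t"
  shows "F (t mod N) = F t"
  using periodic_nat_mult[of F N "t mod N" "t div N", OF per] by (simp add: mult.commute)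

lemma sum_coprime_permute:
  fixes F :: "nat \<Rightarrow> real"
  assumes per: "\<And>t. F (t + u) = F t" and cop: "coprime v u" and u: "u > 0"
  shows "(\<Sum>i<u. F (i * v)) = (\<Sum>i<u. F i)"
proof -
  have inj: "inj_on (\<lambda>i. i * v mod u) {..<u}"
  proof (rule linorder_inj_onI)
    fix i j assume ij: "i < j" "i \<in> {..<u}" "j \<in> {..<u}"
    show "i * v mod u \<noteq> j * v mod u"
    proof
      assume "i * v mod u = j * v mod u"
      then have "u dvd (j - i) * v" using ij mod_eq_dvd_iff_nat[of "i * v" "j * v" u] by (simp add: diff_mult_distrib)
      then have "u dvd j - i" using cop by (simp add: coprime_commute coprime_dvd_mult_left_iff)
      then show False using ij by (auto dest: dvd_imp_le)
    qed
  qed auto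
  have "(\<lambda>i. i * v mod u) ` {..<u} = {..<u}"
    using inj u by (intro endo_inj_surj) auto
  then have "(\<Sum>i<u. F i) = (\<Sum>i<u. F (i * v mod u))"
    using sum.reindex[OF inj, of F] by simp
  then show ?thesis by (simp add: periodic_nat_mod[of F, OF per])
qed

lemma sum_of_nat_lessThan: "(\<Sum>i<u. real i) = real u * (real u - 1) / 2"
  by (induction u) (auto simp: field_simps)

text \<open>Moving x by 1/u shifts the index i cyclically on the left and u x by an integer on the
  right, so x may be taken in [0, 1/u). There every summand is affine, except that for x = 0 the
  term i = 0 is 0 instead of -1/2.\<close>

lemma sawtooth_multiplication:
  fixes x :: real
  assumes u: "u > 0"
  shows "(\<Sum>i<u. sawtooth (x + real i / u)) = sawtooth (u * x)"
proof -
  have shift: "(\<Sum>i<u. sawtooth (x + real (i + c) / u)) = (\<Sum>i<u. sawtooth (x + real i / u))" for x :: real and c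
  proof (rule sum_shift_periodic_nat[of "\<lambda>i. sawtooth (x + real i / u)"])
    fix t show "sawtooth (x + real (t + u) / u) = sawtooth (x + real t / u)"
      using sawtooth_add_int[of "x + real t / u" 1] u by (simp add: add_divide_distrib algebra_simps)
  qed
  define r where "r = \<lfloor>u * x\<rfloor>"
  define m where "m = nat (r mod int u)"
  define q where "q = r div int u"
  define x0 where "x0 = x - of_int r / u"
  have r: "r = int m + int u * q" using u by (simp add: m_def q_def)
  have x: "x = x0 + real m / u + of_int q"
    unfolding x0_def r using u by (simp add: field_simps)
  have "of_int r \<le> u * x" "u * x < of_int r + 1" unfolding r_def by linarith+
  moreover have "u * x0 = u * x - of_int r" using u by (simp add: x0_def field_simps)
  ultimately have "0 \<le> u * x0" and ux0: "u * x0 < 1" by linarith+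
  then have x0: "0 \<le> x0" "u * x0 < 1" using u by (auto simp: zero_le_mult_iff)
  have "(\<Sum>i<u. sawtooth (x + real i / u)) = (\<Sum>i<u. sawtooth (x0 + real (i + m) / u))"
  proof (rule sum.cong[OF refl])
    fix i
    have "x + real i / u = x0 + real (i + m) / u + of_int q" by (simp add: x add_divide_distrib)
    then show "sawtooth (x + real i / u) = sawtooth (x0 + real (i + m) / u)" by (metis sawtooth_add_int)
  qed
  also have "\<dots> = (\<Sum>i<u. sawtooth (x0 + real i / u))" by (rule shift)
  also have "\<dots> = sawtooth (u * x0)"
  proof (cases "x0 = 0")
    case True
    have "(\<Sum>i<u. sawtooth (x0 + real i / u)) = (\<Sum>i<u. (real i / u - 1/2) + (if i = 0 then 1/2 else 0))"
      using True by (intro sum.cong refl) (auto simp: sawtooth_between)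
    also have "\<dots> = (\<Sum>i<u. real i) / u - u / 2 + 1 / 2"
      using u by (simp add: sum.distrib sum_subtractf flip: sum_divide_distrib)
    also have "\<dots> = 0" using u by (simp add: sum_of_nat_lessThan field_simps)
    finally show ?thesis using True by simp
  next
    case False
    have "sawtooth (x0 + real i / u) = x0 + real i / u - 1/2" if "i < u" for i
    proof (rule sawtooth_between)
      show "0 < x0 + real i / u" using x0 False by (intro add_pos_nonneg) auto
      have "u * x0 + real i < u" using that x0 by linarith
      then show "x0 + real i / u < 1" using u by (simp add: field_simps)
    qed
    then have "(\<Sum>i<u. sawtooth (x0 + real i / u)) = (\<Sum>i<u. x0 + real i / u - 1/2)" by (intro sum.cong) auto
    also have "\<dots> = u * x0 + (\<Sum>i<u. real i) / u - u / 2"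
      using u by (simp add: sum.distrib sum_subtractf flip: sum_divide_distrib)
    also have "\<dots> = u * x0 - 1/2"
      using u by (simp add: sum_of_nat_lessThan field_simps)
    also have "\<dots> = sawtooth (u * x0)" using x0 False u by (subst sawtooth_between) auto
    finally show ?thesis .
  qed
  also have "\<dots> = sawtooth (u * x)"
    using sawtooth_add_int[of "u * x0" r] u by (simp add: x0_def right_diff_distrib)
  finally show ?thesis .
qed

lemma sawtooth_add_nat [simp]: "sawtooth (x + real n) = sawtooth x"
  using sawtooth_add_int[of x "int n"] by simp

text \<open>Discrete form of the integral of ((u x)) ((v x)) over a period, which equals 1/(12 u v).
  Shifting t by multiples of m v fixes the first factor and, averaged, turns the second into the
  sawtooth of frequency g u v; shifting by multiples of m then fixes that one and raises the first
  to the same frequency. So u v S is a sum of squares, at most N/4.\<close>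

lemma sum_sawtooth_product_exact:
  fixes g u v m :: nat
  assumes pos: "g > 0" "u > 0" "v > 0" "m > 0" and cop: "coprime u v"
  defines "N \<equiv> m * (g * u * v)"
  shows "\<bar>\<Sum>t<N. sawtooth (real (g * u) * real t / real N) * sawtooth (real (g * v) * real t / real N)\<bar> \<le> real N / (4 * u * v)"
proof -
  let ?s = "\<lambda>j t. sawtooth (real j * real t / N)"
  have N: "N > 0" using pos by (simp add: N_def)
  have per: "?s j (t + N) = ?s j t" for j t
    using N sawtooth_add_nat[of "real j * real t / N" j] by (simp add: field_simps)
  define S where "S = (\<Sum>t<N. ?s (g * u) t * ?s (g * v) t)"
  have S1: "S = (\<Sum>t<N. ?s (g * u) t * sawtooth (real (g * v) * real t / real N + real (i * v) / u))" for i
  proof -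
    define A where "A = m * v"
    have "S = (\<Sum>t<N. ?s (g * u) (t + i * A) * ?s (g * v) (t + i * A))"
      unfolding S_def by (rule sum_shift_periodic_nat[symmetric, of "\<lambda>t. ?s (g * u) t * ?s (g * v) t"]) (simp only: per)
    moreover have "?s (g * u) (t + i * A) = ?s (g * u) t" for t
    proof -
      have "real (g * u) * real (t + i * A) / N = real (g * u) * real t / real N + real i"
        using pos by (simp add: N_def A_def field_simps)
      then show ?thesis by simp
    qed
    moreover have "?s (g * v) (t + i * A) = sawtooth (real (g * v) * real t / real N + real (i * v) / u)" for t
    proof -
      have "real (g * v) * real (t + i * A) / N = real (g * v) * real t / real N + real (i * v) / u"
        using pos by (simp add: N_def A_def field_simps)
      then show ?thesis by simp
    qed
    ultimately show ?thesis by simp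
  qed
  have perm: "(\<Sum>i<u. sawtooth (x + real (i * v) / u)) = sawtooth (real u * x)" for x :: real
  proof -
    have "(\<Sum>i<u. sawtooth (x + real (i * v) / u)) = (\<Sum>i<u. sawtooth (x + real i / u))"
    proof (rule sum_coprime_permute[of "\<lambda>i. sawtooth (x + real i / u)"])
      fix t show "sawtooth (x + real (t + u) / u) = sawtooth (x + real t / u)"
        using sawtooth_add_int[of "x + real t / u" 1] pos by (simp add: add_divide_distrib algebra_simps)
    qed (use cop pos in \<open>auto simp: coprime_commute\<close>)
    then show ?thesis using sawtooth_multiplication[of u x] pos by simp
  qed
  have "u * S = (\<Sum>i<u. \<Sum>t<N. ?s (g * u) t * sawtooth (real (g * v) * real t / real N + real (i * v) / u))"
    using S1 by simp
  also have "\<dots> = (\<Sum>t<N. ?s (g * u) t * (\<Sum>i<u. sawtooth (real (g * v) * real t / real N + real (i * v) / u)))"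
    by (subst sum.swap) (simp add: sum_distrib_left)
  also have "\<dots> = (\<Sum>t<N. ?s (g * u) t * ?s (g * u * v) t)" 
  proof (rule sum.cong[OF refl])
    fix t
    show "?s (g * u) t * (\<Sum>i<u. sawtooth (real (g * v) * real t / real N + real (i * v) / u)) = ?s (g * u) t * ?s (g * u * v) t"
      unfolding perm by (simp add: mult_ac)
  qed
  finally have uS: "u * S = (\<Sum>t<N. ?s (g * u) t * ?s (g * u * v) t)" .
  have S2: "u * S = (\<Sum>t<N. ?s (g * u * v) t * sawtooth (real (g * u) * real t / real N + real i / v))" for i
  proof -
    have "u * S = (\<Sum>t<N. ?s (g * u) (t + i * m) * ?s (g * u * v) (t + i * m))"
      unfolding uS by (rule sum_shift_periodic_nat[symmetric, of "\<lambda>t. ?s (g * u) t * ?s (g * u * v) t"]) (simp only: per)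
    moreover have "?s (g * u * v) (t + i * m) = ?s (g * u * v) t" for t
    proof -
      have "real (g * u * v) * real (t + i * m) / N = real (g * u * v) * real t / real N + real i"
        using pos by (simp add: N_def field_simps)
      then show ?thesis by simp
    qed
    moreover have "?s (g * u) (t + i * m) = sawtooth (real (g * u) * real t / real N + real i / v)" for t
    proof -
      have "real (g * u) * real (t + i * m) / N = real (g * u) * real t / real N + real i / v"
        using pos by (simp add: N_def field_simps)
      then show ?thesis by simp
    qed
    ultimately show ?thesis by (simp add: mult.commute)
  qed
  have "v * (u * S) = (\<Sum>i<v. \<Sum>t<N. ?s (g * u * v) t * sawtooth (real (g * u) * real t / real N + real i / v))"
    using S2 by simp
  also have "\<dots> = (\<Sum>t<N. ?s (g * u * v) t * (\<Sum>i<v. sawtooth (real (g * u) * real t / real N + real i / v)))"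
    by (subst sum.swap) (simp add: sum_distrib_left)
  also have "\<dots> = (\<Sum>t<N. ?s (g * u * v) t * ?s (g * u * v) t)"
    using pos by (simp add: sawtooth_multiplication mult_ac)
  finally have "\<bar>v * (u * S)\<bar> = \<bar>\<Sum>t<N. ?s (g * u * v) t * ?s (g * u * v) t\<bar>" by simp
  also have "\<dots> \<le> (\<Sum>t<N. \<bar>?s (g * u * v) t * ?s (g * u * v) t\<bar>)" by (rule sum_abs)
  also have "\<dots> \<le> (\<Sum>t<N. (1/2) * (1/2))"
    unfolding abs_mult by (intro sum_mono mult_mono abs_sawtooth_le) auto
  also have "\<dots> = N / 4" by simp
  finally have "v * u * \<bar>S\<bar> \<le> N / 4" by (simp add: abs_mult)
  then show ?thesis using pos unfolding S_def by (simp add: field_simps)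
qed

text \<open>By \<open>sawtooth_altdef\<close> the sawtooth is a difference of two nondecreasing
  functions. The right side is the increment of their sum, so it telescopes over adjacent
  intervals.\<close>

lemma sawtooth_variation:
  assumes "x \<le> z" "z \<le> x'"
  shows "\<bar>sawtooth z - sawtooth x\<bar> \<le> (x' - x) + (of_int \<lfloor>x'\<rfloor> - of_int \<lfloor>x\<rfloor> + of_int \<lceil>x'\<rceil> - of_int \<lceil>x\<rceil>) / 2"
proof -
  have "\<lfloor>x\<rfloor> \<le> \<lfloor>z\<rfloor>" "\<lfloor>z\<rfloor> \<le> \<lfloor>x'\<rfloor>" "\<lceil>x\<rceil> \<le> \<lceil>z\<rceil>" "\<lceil>z\<rceil> \<le> \<lceil>x'\<rceil>"
    using assms by (auto intro: floor_mono ceiling_mono)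
  then have "real_of_int \<lfloor>x\<rfloor> \<le> \<lfloor>z\<rfloor>" "real_of_int \<lfloor>z\<rfloor> \<le> \<lfloor>x'\<rfloor>" "real_of_int \<lceil>x\<rceil> \<le> \<lceil>z\<rceil>" "real_of_int \<lceil>z\<rceil> \<le> \<lceil>x'\<rceil>"
    by linarith+
  moreover have "\<bar>z - (a2 + b2) / 2 - (x - (a1 + b1) / 2)\<bar> \<le> (x' - x) + (a3 - a1 + b3 - b1) / 2"
    if "a1 \<le> a2" "a2 \<le> a3" "b1 \<le> b2" "b2 \<le> b3" for a1 a2 a3 b1 b2 b3 :: real
    using that assms unfolding abs_le_iff by (auto simp: field_simps)
  ultimately show ?thesis unfolding sawtooth_altdef by blast
qed

text \<open>The exact evaluation needs a number of points divisible by g u v, which refining the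
  mesh 1/k by a factor M provides. The price is a total variation over the unit interval: 2 j and 2
  j' for the two factors, half from the slope and half from the jumps, each times the bound 1/2 for
  the other factor.\<close>

lemma sum_sawtooth_product_refine:
  fixes j j' :: nat
  assumes k: "k > 0" and M: "M > 0"
  defines "F \<equiv> \<lambda>x. sawtooth (real j * x) * sawtooth (real j' * x)"
  shows "\<bar>(\<Sum>y<k. F (real y / real k)) - (\<Sum>t<k * M. F (real t / real (k * M))) / M\<bar> \<le> real j + real j'"
proof -
  define V where "V j y = (real j * ((y + 1) / real k) - real j * (y / real k)) +
     (of_int \<lfloor>real j * ((y + 1) / real k)\<rfloor> - of_int \<lfloor>real j * (y / real k)\<rfloor> + of_int \<lceil>real j * ((y + 1) / real k)\<rceil> - of_int \<lceil>real j * (y / real k)\<rceil>) / 2"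
     for j :: nat and y :: real
  have VS: "(\<Sum>y<k. V j (real y)) = 2 * real j" for j
  proof -
    define G where "G y = real j * (y / real k) + (of_int \<lfloor>real j * (y / real k)\<rfloor> + of_int \<lceil>real j * (y / real k)\<rceil>) / 2" for y :: real
    have "V j (real y) = G (real (Suc y)) - G (real y)" for y :: nat
      by (simp add: V_def G_def field_simps)
    then have "(\<Sum>y<k. V j (real y)) = G k - G 0" using sum_lessThan_telescope[of "\<lambda>y. G (real y)" k] by simp
    then show ?thesis using k by (simp add: G_def)
  qed
  have pw: "\<bar>F (real y / real k) - F (real t / real (k * M))\<bar> \<le> (V j (real y) + V j' (real y)) / 2" if t: "t \<in> {y * M..<y * M + M}" for y t :: nat
  proof -
    have x: "real y / real k \<le> real t / real (k * M)" "real t / real (k * M) \<le> (y + 1) / real k"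
    proof -
      have "real (y * M) \<le> real t" "real t \<le> real (y * M + M)" using t by (auto simp del: of_nat_mult of_nat_add)
      then show "real y / real k \<le> real t / real (k * M)" "real t / real (k * M) \<le> (y + 1) / real k"
        using k M by (auto simp: field_simps)
    qed
    have d: "\<bar>sawtooth (real j * (real t / real (k * M))) - sawtooth (real j * (real y / real k))\<bar> \<le> V j (real y)" for j
      unfolding V_def by (intro sawtooth_variation mult_left_mono) (use x in \<open>auto simp: add.commute\<close>)
    have "F (real t / real (k * M)) - F (real y / real k) =
       sawtooth (real j * (real t / real (k * M))) * (sawtooth (real j' * (real t / real (k * M))) - sawtooth (real j' * (real y / real k))) +
       (sawtooth (real j * (real t / real (k * M))) - sawtooth (real j * (real y / real k))) * sawtooth (real j' * (real y / real k))"
      by (simp add: F_def algebra_simps)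
    also have "\<bar>\<dots>\<bar> \<le> 1/2 * V j' (real y) + V j (real y) * (1/2)"
    proof (rule order_trans[OF abs_triangle_ineq], rule add_mono)
      show "\<bar>sawtooth (real j * (real t / real (k * M))) * (sawtooth (real j' * (real t / real (k * M))) - sawtooth (real j' * (real y / real k)))\<bar> \<le> 1/2 * V j' (real y)"
        unfolding abs_mult by (intro mult_mono d abs_sawtooth_le) auto
      show "\<bar>(sawtooth (real j * (real t / real (k * M))) - sawtooth (real j * (real y / real k))) * sawtooth (real j' * (real y / real k))\<bar> \<le> V j (real y) * (1/2)"
        unfolding abs_mult by (intro mult_mono d abs_sawtooth_le) (auto intro: order_trans[OF _ d])
    qed
    finally show ?thesis by (simp add: abs_minus_commute)
  qed
  have "(\<Sum>t<k * M. F (real t / real (k * M))) = (\<Sum>y<k. \<Sum>t\<in>{y * M..<y * M + M}. F (real t / real (k * M)))"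
    by (rule sum.nat_group[symmetric])
  then have eq: "(\<Sum>y<k. F (real y / real k)) - (\<Sum>t<k * M. F (real t / real (k * M))) / M =
     (\<Sum>y<k. (\<Sum>t\<in>{y * M..<y * M + M}. F (real y / real k) - F (real t / real (k * M))) / M)"
    using M by (simp add: sum_subtractf sum_divide_distrib diff_divide_distrib)
  have "\<bar>\<Sum>y<k. (\<Sum>t\<in>{y * M..<y * M + M}. F (real y / real k) - F (real t / real (k * M))) / M\<bar>
      \<le> (\<Sum>y<k. \<bar>(\<Sum>t\<in>{y * M..<y * M + M}. F (real y / real k) - F (real t / real (k * M))) / M\<bar>)" by (rule sum_abs)
  also have "\<dots> \<le> (\<Sum>y<k. (V j (real y) + V j' (real y)) / 2)"
  proof (rule sum_mono)
    fix y
    have "\<bar>\<Sum>t\<in>{y * M..<y * M + M}. F (real y / real k) - F (real t / real (k * M))\<bar> \<le> (\<Sum>t\<in>{y * M..<y * M + M}. \<bar>F (real y / real k) - F (real t / real (k * M))\<bar>)"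
      by (rule sum_abs)
    also have "\<dots> \<le> (\<Sum>t\<in>{y * M..<y * M + M}. (V j (real y) + V j' (real y)) / 2)" by (rule sum_mono) (rule pw)
    also have "\<dots> = M * ((V j (real y) + V j' (real y)) / 2)" by simp
    finally have "\<bar>\<Sum>t\<in>{y * M..<y * M + M}. F (real y / real k) - F (real t / real (k * M))\<bar> / M \<le> M * ((V j (real y) + V j' (real y)) / 2) / M"
      by (rule divide_right_mono) simp
    also have "\<dots> = (V j (real y) + V j' (real y)) / 2" using M by simp
    finally show "\<bar>(\<Sum>t\<in>{y * M..<y * M + M}. F (real y / real k) - F (real t / real (k * M))) / M\<bar> \<le> (V j (real y) + V j' (real y)) / 2"
      by (simp only: abs_divide abs_of_nat)
  qed
  also have "\<dots> = real j + real j'" by (simp add: VS sum.distrib flip: sum_divide_distrib)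
  finally show ?thesis unfolding eq .
qed

lemma sum_sawtooth_product_le:
  assumes k: "k > 0" and j: "j > 0" "j' > 0"
  shows "\<bar>\<Sum>y<k. sawtooth (real j * real y / real k) * sawtooth (real j' * real y / real k)\<bar>
     \<le> k * (real (gcd j j'))\<^sup>2 / (4 * j * j') + (real j + real j')"
proof -
  define g where "g = gcd j j'"
  obtain u v where uv: "j = u * g" "j' = v * g" "coprime u v"
    using gcd_coprime_exists[of j j'] j unfolding g_def by auto
  have pos: "g > 0" "u > 0" "v > 0" using uv j by (auto intro!: Nat.gr0I)
  define M where "M = g * u * v"
  define F where "F = (\<lambda>x. sawtooth (real j * x) * sawtooth (real j' * x))"
  have M: "M > 0" using pos by (simp add: M_def)
  have "\<bar>(\<Sum>t<k * M. F (real t / real (k * M)))\<bar> \<le> (k * M) / (4 * u * v)"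
    using sum_sawtooth_product_exact[OF pos k uv(3)] by (simp add: F_def M_def uv mult_ac)
  then have "\<bar>(\<Sum>t<k * M. F (real t / real (k * M))) / M\<bar> \<le> k / (4 * u * v)"
    using M pos by (simp add: abs_divide field_simps)
  also have "\<dots> = k * (real g)\<^sup>2 / (4 * j * j')" using pos by (simp add: uv power2_eq_square field_simps)
  finally have "\<bar>(\<Sum>t<k * M. F (real t / real (k * M))) / M\<bar> \<le> k * (real g)\<^sup>2 / (4 * j * j')" .
  then have "\<bar>\<Sum>y<k. F (real y / real k)\<bar> \<le> k * (real g)\<^sup>2 / (4 * j * j') + (real j + real j')"
  proof -
    have "\<bar>(\<Sum>y<k. F (real y / real k)) - (\<Sum>t<k * M. F (real t / real (k * M))) / M\<bar> \<le> real j + real j'"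
      unfolding F_def by (rule sum_sawtooth_product_refine[OF k M])
    then show ?thesis
      using \<open>\<bar>(\<Sum>t<k * M. F (real t / real (k * M))) / M\<bar> \<le> k * (real g)\<^sup>2 / (4 * j * j')\<close> by linarith
  qed
  then show ?thesis unfolding g_def[symmetric] by (simp add: F_def)
qed

section \<open>Near-orthogonality of sawtooths of low frequency\<close>

lemma sum_inverse_squares_le: "(\<Sum>j\<in>{1..J}. 1 / (real j)\<^sup>2) \<le> 2 - (if J = 0 then 2 else 1 / J)"
proof (induction J)
  case (Suc J)
  show ?case
  proof (cases "J = 0")
    case False
    have "1 / (real (Suc J))\<^sup>2 \<le> 1 / J - 1 / Suc J"
    proof -
      have "1 / (real (Suc J))\<^sup>2 \<le> 1 / (real J * real (Suc J))"
        unfolding power2_eq_square using False by (intro divide_left_mono mult_right_mono) auto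
      also have "\<dots> = 1 / J - 1 / Suc J" using False by (simp add: field_simps)
      finally show ?thesis .
    qed
    then show ?thesis using Suc.IH False by simp
  qed simp
qed simp

text \<open>With g the gcd, j = g u and j' = g v, the summand is 1/(g u v)^2. The map to (g, u, v)
  is injective, so the double sum is at most the cube of the sum of 1/n^2, that is 2^3.\<close>

lemma sum_gcd_squares_le:
  "(\<Sum>j\<in>{1..J}. \<Sum>j'\<in>{1..J}. (real (gcd j j'))\<^sup>2 / (real j * real j')\<^sup>2) \<le> 8"
proof -
  let ?h = "\<lambda>n::nat. 1 / (real n)\<^sup>2"
  let ?\<phi> = "\<lambda>(j, j'). (gcd j j', j div gcd j j', j' div gcd j j')"
  have inj: "inj_on ?\<phi> ({1..J} \<times> {1..J})"
  proof (rule inj_onI, clarify)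
    fix a b c d :: nat
    assume "gcd a b = gcd c d" "a div gcd a b = c div gcd c d" "b div gcd a b = d div gcd c d"
    then show "a = c \<and> b = d" by (metis dvd_div_mult_self gcd_dvd1 gcd_dvd2)
  qed
  have im: "?\<phi> ` ({1..J} \<times> {1..J}) \<subseteq> {1..J} \<times> {1..J} \<times> {1..J}"
  proof (rule image_subsetI)
    fix p assume p: "p \<in> {1..J} \<times> {1..J}"
    obtain j j' where pj: "p = (j, j')" by (cases p)
    have *: "j \<in> {1..J}" "j' \<in> {1..J}" using p by (auto simp: pj)
    have "gcd j j' \<le> j" "j div gcd j j' \<le> j" "j' div gcd j j' \<le> j'" using * by auto
    then have "gcd j j' \<le> J" "j div gcd j j' \<le> J" "j' div gcd j j' \<le> J" using * by (meson atLeastAtMost_iff order_trans)+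
    moreover have "gcd j j' \<ge> 1" "j div gcd j j' \<ge> 1" "j' div gcd j j' \<ge> 1"
      using * by (auto simp: Suc_le_eq div_greater_zero_iff intro!: gcd_le1_nat gcd_le2_nat)
    ultimately show "?\<phi> p \<in> {1..J} \<times> {1..J} \<times> {1..J}" by (simp add: pj)
  qed
  have "(\<Sum>j\<in>{1..J}. \<Sum>j'\<in>{1..J}. (real (gcd j j'))\<^sup>2 / (real j * real j')\<^sup>2) =
    (\<Sum>p\<in>{1..J} \<times> {1..J}. case ?\<phi> p of (g, u, v) \<Rightarrow> ?h g * (?h u * ?h v))"
    unfolding sum.cartesian_product
  proof (rule sum.cong[OF refl])
    fix p assume p: "p \<in> {1..J} \<times> {1..J}"
    obtain j j' where pj: "p = (j, j')" by (cases p)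
    have *: "j \<in> {1..J}" "j' \<in> {1..J}" using p by (auto simp: pj)
    define g where "g = gcd j j'"
    obtain u v where uv: "j = u * g" "j' = v * g" by (metis dvd_div_mult_self gcd_dvd1 gcd_dvd2 g_def)
    have "g > 0" using * by (simp add: g_def)
    then have "(real g)\<^sup>2 / (real j * real j')\<^sup>2 = ?h g * (?h (j div g) * ?h (j' div g))"
      using * by (simp add: uv power2_eq_square field_simps)
    then show "(case p of (j, j') \<Rightarrow> (real (gcd j j'))\<^sup>2 / (real j * real j')\<^sup>2) = (case ?\<phi> p of (g, u, v) \<Rightarrow> ?h g * (?h u * ?h v))"
      by (simp add: pj g_def)
  qed
  also have "\<dots> = (\<Sum>p\<in>?\<phi> ` ({1..J} \<times> {1..J}). case p of (g, u, v) \<Rightarrow> ?h g * (?h u * ?h v))"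
    by (subst sum.reindex[OF inj]) (simp add: o_def)
  also have "\<dots> \<le> (\<Sum>p\<in>{1..J} \<times> {1..J} \<times> {1..J}. case p of (g, u, v) \<Rightarrow> ?h g * (?h u * ?h v))"
    by (rule sum_mono2[OF _ im]) auto
  also have "\<dots> = (\<Sum>g\<in>{1..J}. ?h g) * ((\<Sum>g\<in>{1..J}. ?h g) * (\<Sum>g\<in>{1..J}. ?h g))"
    by (simp only: sum.cartesian_product[symmetric] sum_distrib_left[symmetric] sum_distrib_right[symmetric])
  also have "\<dots> \<le> 2 * (2 * 2)"
  proof -
    have *: "(\<Sum>g\<in>{1..J}. ?h g) \<le> 2" "(\<Sum>g\<in>{1..J}. ?h g) \<ge> 0"
    proof -
      have "0 \<le> (if J = 0 then 2 else 1 / real J)" by simp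
      then show "(\<Sum>g\<in>{1..J}. ?h g) \<le> 2" using sum_inverse_squares_le[of J] by linarith
    qed (auto intro!: sum_nonneg)
    show ?thesis using * by (intro mult_mono) auto
  qed
  finally show ?thesis by simp
qed

text \<open>Squared out, the correlations contribute A^2 k / 4 times the gcd sum, at most 2 A^2 k.
  Their errors are A^2 (1/j + 1/j') \<le> 2 A^2 for each of J^2 pairs, and J^2 \<le> k makes this 2
  A^2 k as well.\<close>

lemma sum_sawtooth_quadratic_form:
  assumes k: "k > 0" and J: "J * J \<le> k" and A: "A \<ge> 0" and \<theta>: "\<And>j. j \<in> {1..J} \<Longrightarrow> \<bar>\<theta> j\<bar> \<le> A / real j"
  shows "(\<Sum>y<k. (\<Sum>j\<in>{1..J}. sawtooth (real j * real y / real k) * \<theta> j)\<^sup>2) \<le> 4 * A\<^sup>2 * k"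
proof -
  let ?s = "\<lambda>j y. sawtooth (real j * real y / real k)"
  have "(\<Sum>y<k. (\<Sum>j\<in>{1..J}. ?s j y * \<theta> j)\<^sup>2) = (\<Sum>y<k. \<Sum>j\<in>{1..J}. \<Sum>j'\<in>{1..J}. \<theta> j * \<theta> j' * (?s j y * ?s j' y))"
    by (simp add: power2_eq_square sum_product mult_ac)
  also have "\<dots> = (\<Sum>j\<in>{1..J}. \<Sum>j'\<in>{1..J}. \<theta> j * \<theta> j' * (\<Sum>y<k. ?s j y * ?s j' y))"
    unfolding sum_distrib_left by (subst sum.swap, rule sum.cong[OF refl], rule sum.swap)
  also have "\<dots> \<le> (\<Sum>j\<in>{1..J}. \<Sum>j'\<in>{1..J}. A\<^sup>2 * (k / 4 * ((real (gcd j j'))\<^sup>2 / (real j * real j')\<^sup>2) + 2))"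
  proof (intro sum_mono)
    fix j j' assume j: "j \<in> {1..J}" "j' \<in> {1..J}"
    have "\<theta> j * \<theta> j' * (\<Sum>y<k. ?s j y * ?s j' y) \<le> \<bar>\<theta> j\<bar> * \<bar>\<theta> j'\<bar> * \<bar>\<Sum>y<k. ?s j y * ?s j' y\<bar>"
      using abs_ge_self[of "\<theta> j * \<theta> j' * (\<Sum>y<k. ?s j y * ?s j' y)"] by (simp add: abs_mult)
    also have "\<dots> \<le> (A / j) * (A / j') * (k * (real (gcd j j'))\<^sup>2 / (4 * j * j') + (real j + real j'))"
    proof (rule mult_mono)
      show "\<bar>\<theta> j\<bar> * \<bar>\<theta> j'\<bar> \<le> (A / j) * (A / j')"
        by (rule mult_mono) (use A j \<theta> in auto)
      show "\<bar>\<Sum>y<k. ?s j y * ?s j' y\<bar> \<le> k * (real (gcd j j'))\<^sup>2 / (4 * j * j') + (real j + real j')"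
        using sum_sawtooth_product_le[of k j j'] k j by simp
    qed (use A in auto)
    also have "\<dots> = A\<^sup>2 * (k / 4 * ((real (gcd j j'))\<^sup>2 / (real j * real j')\<^sup>2) + (1 / j + 1 / j'))"
      using j by (simp add: field_simps power2_eq_square)
    also have "\<dots> \<le> A\<^sup>2 * (k / 4 * ((real (gcd j j'))\<^sup>2 / (real j * real j')\<^sup>2) + 2)"
    proof (intro mult_left_mono add_left_mono)
      have "1 / real j \<le> 1" "1 / real j' \<le> 1" using j by auto
      then show "1 / real j + 1 / real j' \<le> 2" by linarith
    qed simp
    finally show "\<theta> j * \<theta> j' * (\<Sum>y<k. ?s j y * ?s j' y) \<le> A\<^sup>2 * (k / 4 * ((real (gcd j j'))\<^sup>2 / (real j * real j')\<^sup>2) + 2)" .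
  qed
  also have "\<dots> = A\<^sup>2 * (k / 4 * (\<Sum>j\<in>{1..J}. \<Sum>j'\<in>{1..J}. (real (gcd j j'))\<^sup>2 / (real j * real j')\<^sup>2) + 2 * (real J * real J))"
    by (simp only: sum_distrib_left[symmetric] sum.distrib sum_constant) simp
  also have "\<dots> \<le> A\<^sup>2 * (k / 4 * 8 + 2 * real k)"
    using J by (intro mult_left_mono add_mono sum_gcd_squares_le) (auto simp flip: of_nat_mult)
  also have "\<dots> = 4 * A\<^sup>2 * k" by simp
  finally show ?thesis .
qed

section \<open>Mean size of a single cotangent\<close>

lemma sum_symmetric_halves:
  fixes h :: "nat \<Rightarrow> real"
  assumes k: "k > 0" and h0: "h 0 = 0" and sym: "\<And>j. 0 < j \<Longrightarrow> j < k \<Longrightarrow> h (k - j) = h j"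
    and mid: "\<And>j. 2 * j = k \<Longrightarrow> h j = 0"
  shows "(\<Sum>j<k. h j) = 2 * (\<Sum>j\<in>{1..(k - 1) div 2}. h j)"
proof -
  let ?A = "{1..(k - 1) div 2}"
  have sub: "?A \<union> (\<lambda>j. k - j) ` ?A \<subseteq> {..<k}" using k by auto
  have "(\<Sum>j<k. h j) = (\<Sum>j\<in>?A \<union> (\<lambda>j. k - j) ` ?A. h j)"
  proof (rule sum.mono_neutral_right[OF _ sub])
    show "\<forall>i\<in>{..<k} - (?A \<union> (\<lambda>j. k - j) ` ?A). h i = 0"
    proof
      fix i assume i: "i \<in> {..<k} - (?A \<union> (\<lambda>j. k - j) ` ?A)"
      have "i = 0 \<or> 2 * i = k"
      proof (rule ccontr)
        assume "\<not> (i = 0 \<or> 2 * i = k)"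
        then have "i \<in> ?A \<or> (k - i \<in> ?A \<and> i = k - (k - i))" using i by auto
        then show False using i by blast
      qed
      then show "h i = 0" using h0 mid by auto
    qed
  qed simp
  also have "\<dots> = (\<Sum>j\<in>?A. h j) + (\<Sum>j\<in>(\<lambda>j. k - j) ` ?A. h j)"
    by (rule sum.union_disjoint) auto
  also have "(\<Sum>j\<in>(\<lambda>j. k - j) ` ?A. h j) = (\<Sum>j\<in>?A. h (k - j))"
    by (subst sum.reindex) (auto simp: inj_on_def)
  also have "\<dots> = (\<Sum>j\<in>?A. h j)" by (intro sum.cong refl sym) auto
  finally show ?thesis by simp
qed

text \<open>A power instead of the logarithm suffices: it gives \<open>sum_abs_cotpi_le\<close> the
  order k^(3/2), and about sqrt k boundary terms of this size make k^2.\<close>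

lemma sum_inverse_le_sqrt: "(\<Sum>r\<in>{1..n}. 1 / real r) \<le> 2 * sqrt n"
proof (induction n)
  case (Suc n)
  define s where "s = sqrt (Suc n)"
  define t where "t = sqrt n"
  have st: "s * s = real n + 1" "t * t = n" "0 \<le> t" "t \<le> s" "s > 0" by (auto simp: s_def t_def)
  have "(s - t) * (s + t) = 1" using st by (simp add: algebra_simps)
  then have "s - t = 1 / (s + t)" using st by (simp add: field_simps)
  moreover have "1 / (2 * s) \<le> 1 / (s + t)" using st by (intro divide_left_mono) auto
  ultimately have "1 / (2 * s) \<le> s - t" by simp
  then have "2 * (1 / (2 * s)) \<le> 2 * (s - t)" by (rule mult_left_mono) simp
  then have "1 / s \<le> 2 * (s - t)" by simp
  moreover have "1 / (s * s) \<le> 1 / s"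
  proof -
    have "s \<ge> 1" by (simp add: s_def)
    then have "s * 1 \<le> s * s" by (intro mult_left_mono) auto
    then show ?thesis using st by (intro divide_left_mono) auto
  qed
  ultimately have "1 / real (Suc n) \<le> 2 * s - 2 * t" using st by (simp add: add.commute)
  then show ?case using Suc.IH by (simp add: s_def t_def)
qed simp

lemma sum_abs_cotpi_le:
  assumes k: "k > 0"
  shows "(\<Sum>r<k. \<bar>cotpi (real r / k)\<bar>) \<le> 2 * k * sqrt k"
proof -
  have "(\<Sum>r<k. \<bar>cotpi (real r / k)\<bar>) = 2 * (\<Sum>r\<in>{1..(k - 1) div 2}. \<bar>cotpi (real r / k)\<bar>)"
  proof (rule sum_symmetric_halves[OF k])
    fix j assume "0 < j" "j < k"
    then have "real (k - j) / k = - (real j / k) + of_int 1" using k by (simp add: of_nat_diff field_simps)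
    then show "\<bar>cotpi (real (k - j) / k)\<bar> = \<bar>cotpi (real j / k)\<bar>" by (metis abs_minus_cancel cotpi_add_int cotpi_minus)
  next
    fix j assume "2 * j = k"
    then have "real j / k = 1/2" using k by (simp add: field_simps flip: of_nat_mult)
    then show "\<bar>cotpi (real j / k)\<bar> = 0" by (simp add: cotpi_def cot_def)
  qed simp
  also have "\<dots> \<le> 2 * (\<Sum>r\<in>{1..(k - 1) div 2}. k / 2 * (1 / r))"
  proof (intro mult_left_mono sum_mono)
    fix r assume r: "r \<in> {1..(k - 1) div 2}"
    then have x: "0 < real r / k" "real r / k \<le> 1/2" using k by (auto simp: field_simps)
    have "\<bar>cotpi (real r / k)\<bar> \<le> 1 / (pi * (real r / k))" using cotpi_le[OF x] cotpi_nonneg[of "real r / k"] x by simp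
    also have "\<dots> \<le> 1 / (2 * (real r / k))" using x pi_ge_two k r by (intro divide_left_mono mult_right_mono) auto
    finally show "\<bar>cotpi (real r / k)\<bar> \<le> k / 2 * (1 / r)" using r k by (simp add: field_simps)
  qed simp
  also have "\<dots> = k * (\<Sum>r\<in>{1..(k - 1) div 2}. 1 / real r)" by (simp add: sum_distrib_left)
  also have "\<dots> \<le> k * (2 * sqrt ((k - 1) div 2))" by (intro mult_left_mono sum_inverse_le_sqrt) auto
  also have "\<dots> \<le> k * (2 * sqrt k)"
  proof (intro mult_left_mono real_sqrt_le_mono)
    have "(k - 1) div 2 \<le> k" by linarith
    then show "real ((k - 1) div 2) \<le> real k" by simp
  qed auto
  finally show ?thesis by simp
qed

lemma cotpi_periodic_nat:
  assumes "k > 0" shows "cotpi (real l * real (b + k) / k) = cotpi (real l * real b / k)"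
proof -
  have "real l * real (b + k) / k = real l * real b / k + of_int (int l)" using assms by (simp add: field_simps)
  then show ?thesis by (metis cotpi_add_int)
qed

text \<open>In lowest terms l/k = l'/k' the sum runs through e periods modulo k', and l' permutes
  the residues of each. The bound is uniform in l.\<close>

lemma sum_abs_cotpi_mult_le:
  assumes k: "k > 0"
  shows "(\<Sum>b<k. \<bar>cotpi (real l * real b / k)\<bar>) \<le> 2 * k * sqrt k"
proof -
  define e where "e = gcd l k"
  obtain l' k' where lk: "l = l' * e" "k = k' * e" "coprime l' k'"
    using gcd_coprime_exists[of l k] k unfolding e_def by auto
  have pos: "e > 0" "k' > 0" using lk k by (auto intro!: Nat.gr0I)
  define F where "F b = \<bar>cotpi (real l' * real b / k')\<bar>" for b :: nat
  have per: "F (b + k') = F b" for b unfolding F_def using cotpi_periodic_nat[OF pos(2)] by metis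
  have "(\<Sum>b<k. \<bar>cotpi (real l * real b / k)\<bar>) = (\<Sum>b<e * k'. F b)"
    unfolding F_def lk using pos by (simp add: mult.commute mult.left_commute)
  also have "\<dots> = (\<Sum>q<e. \<Sum>b\<in>{q * k'..<q * k' + k'}. F b)" by (rule sum.nat_group[symmetric])
  also have "\<dots> = (\<Sum>q<e. \<Sum>b<k'. F b)"
  proof (rule sum.cong[OF refl])
    fix q
    have "(\<Sum>b\<in>{q * k'..<q * k' + k'}. F b) = (\<Sum>b<k'. F (b + q * k'))"
      by (rule sum.reindex_bij_witness[of _ "\<lambda>b. b + q * k'" "\<lambda>b. b - q * k'"]) auto
    then show "(\<Sum>b\<in>{q * k'..<q * k' + k'}. F b) = (\<Sum>b<k'. F b)" using periodic_nat_mult[of F k', OF per] by simp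
  qed
  also have "(\<Sum>b<k'. F b) = (\<Sum>b<k'. \<bar>cotpi (real b / k')\<bar>)"
  proof -
    have "(\<Sum>b<k'. \<bar>cotpi (real (b * l') / k')\<bar>) = (\<Sum>b<k'. \<bar>cotpi (real b / k')\<bar>)"
    proof (rule sum_coprime_permute[of "\<lambda>b. \<bar>cotpi (real b / k')\<bar>"])
      fix t show "\<bar>cotpi (real (t + k') / k')\<bar> = \<bar>cotpi (real t / k')\<bar>"
        using cotpi_periodic_nat[OF pos(2), of 1 t] by simp
    qed (use lk pos in auto)
    then show ?thesis by (simp add: F_def mult.commute)
  qed
  also have "(\<Sum>q<e. \<Sum>b<k'. \<bar>cotpi (real b / k')\<bar>) \<le> e * (2 * k' * sqrt k')"
    using sum_abs_cotpi_le[OF pos(2)] by (simp add: mult_left_mono)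
  also have "\<dots> = 2 * k * sqrt k'" by (simp add: lk)
  also have "\<dots> \<le> 2 * k * sqrt k" using pos by (intro mult_left_mono real_sqrt_le_mono) (auto simp: lk)
  finally show ?thesis by simp
qed

section \<open>Mean values of cotangent sums over residue classes\<close>

lemma cmod_cis_diff_1: "cmod (cis \<theta> - 1) = 2 * \<bar>sin (\<theta> / 2)\<bar>"
proof -
  have "(cmod (cis \<theta> - 1))\<^sup>2 = (cos \<theta> - 1)\<^sup>2 + (sin \<theta>)\<^sup>2" by (simp add: cmod_power2)
  also have "\<dots> = 2 - 2 * cos \<theta>" using sin_cos_squared_add[of \<theta>] by (simp add: power2_eq_square algebra_simps)
  also have "\<dots> = (2 * \<bar>sin (\<theta> / 2)\<bar>)\<^sup>2" using cos_double_sin[of "\<theta> / 2"] by (simp add: power_mult_distrib)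
  finally show ?thesis by (rule power2_eq_imp_eq) auto
qed

lemma cmod_geometric_cis_le:
  assumes j: "j \<ge> 1" "2 * j \<le> k"
  shows "cmod (\<Sum>l<n. cis (2 * pi * real j / real k) ^ l) \<le> real k / real j"
proof -
  define q where "q = cis (2 * pi * real j / real k)"
  define x where "x = real j / real k"
  have x: "0 < x" "x \<le> 1/2" using j by (auto simp: x_def field_simps)
  have sp: "sin (pi * x) > 0" using x by (intro sin_gt_zero) auto
  have nq: "cmod (q - 1) = 2 * sin (pi * x)"
    using cmod_cis_diff_1[of "2 * pi * real j / real k"] sp by (simp add: q_def x_def)
  then have "q \<noteq> 1" using sp by auto
  then have "(\<Sum>l<n. q ^ l) = (q ^ n - 1) / (q - 1)"
    by (simp add: sum_gp_strict) (metis minus_diff_eq minus_divide_divide)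
  then have "cmod (\<Sum>l<n. q ^ l) = cmod (q ^ n - 1) / (2 * sin (pi * x))" by (simp add: norm_divide nq)
  also have "cmod (q ^ n - 1) \<le> 2"
  proof -
    have "cmod (q ^ n) = 1" by (simp add: norm_power q_def)
    then show ?thesis using norm_triangle_ineq4[of "q ^ n" 1] by simp
  qed
  also have "2 / (2 * sin (pi * x)) \<le> 1 / x" using inverse_sin_le[OF x] by simp
  finally show ?thesis using sp unfolding q_def by (simp add: x_def divide_right_mono)
qed

text \<open>The gain from smoothing. The sum over l and the shift i factors into two geometric sums,
  so it stays below (k/j)^2 however many shifts W are taken, whereas adding up W single sums gives W
  k / j. The second bound is the better one for j > k / W.\<close>

lemma sum_sin_shift_le:
  assumes j: "j \<ge> 1" "2 * j \<le> k"
  shows "\<bar>\<Sum>l\<in>{1..L}. sin (2 * pi * (real j * real (l + i)) / real k)\<bar> \<le> real k / real j"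
    and "\<bar>\<Sum>i<W. \<Sum>l\<in>{1..L}. sin (2 * pi * (real j * real (l + i)) / real k)\<bar> \<le> (real k / real j)\<^sup>2"
proof -
  define q where "q = cis (2 * pi * real j / real k)"
  have s: "sin (2 * pi * (real j * real m) / real k) = Im (q ^ m)" for m
    unfolding q_def Complex.DeMoivre by (simp add: algebra_simps)
  have r: "(\<Sum>l\<in>{1..L}. q ^ (l + i)) = q ^ Suc i * (\<Sum>l<L. q ^ l)" for i
    unfolding One_nat_def sum.atLeast1_atMost_eq sum_distrib_left by (simp add: power_add mult_ac)
  have nq: "cmod (q ^ m) = 1" for m by (simp add: q_def norm_power)
  have "\<bar>\<Sum>l\<in>{1..L}. sin (2 * pi * (real j * real (l + i)) / real k)\<bar> = \<bar>Im (q ^ Suc i * (\<Sum>l<L. q ^ l))\<bar>"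
    unfolding s r[symmetric] by simp
  also have "\<dots> \<le> cmod (q ^ Suc i * (\<Sum>l<L. q ^ l))" by (rule abs_Im_le_cmod)
  also have "\<dots> = cmod (\<Sum>l<L. q ^ l)" by (simp only: norm_mult nq mult_1_left)
  also have "\<dots> \<le> real k / real j" unfolding q_def by (rule cmod_geometric_cis_le[OF j])
  finally show "\<bar>\<Sum>l\<in>{1..L}. sin (2 * pi * (real j * real (l + i)) / real k)\<bar> \<le> real k / real j" .
  have "(\<Sum>i<W. \<Sum>l\<in>{1..L}. sin (2 * pi * (real j * real (l + i)) / real k)) = Im (\<Sum>i<W. q ^ Suc i * (\<Sum>l<L. q ^ l))"
    unfolding s r[symmetric] by simp
  also have "(\<Sum>i<W. q ^ Suc i * (\<Sum>l<L. q ^ l)) = q ^ 1 * ((\<Sum>i<W. q ^ i) * (\<Sum>l<L. q ^ l))"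
    by (simp add: sum_distrib_left sum_distrib_right mult_ac)
  finally have "\<bar>\<Sum>i<W. \<Sum>l\<in>{1..L}. sin (2 * pi * (real j * real (l + i)) / real k)\<bar> \<le> cmod (q ^ 1 * ((\<Sum>i<W. q ^ i) * (\<Sum>l<L. q ^ l)))"
    using abs_Im_le_cmod by metis
  also have "\<dots> = cmod (\<Sum>i<W. q ^ i) * cmod (\<Sum>l<L. q ^ l)" by (simp only: norm_mult nq mult_1_left)
  also have "\<dots> \<le> (real k / real j) * (real k / real j)"
    unfolding q_def by (intro mult_mono cmod_geometric_cis_le[OF j]) auto
  finally show "\<bar>\<Sum>i<W. \<Sum>l\<in>{1..L}. sin (2 * pi * (real j * real (l + i)) / real k)\<bar> \<le> (real k / real j)\<^sup>2"
    by (simp add: power2_eq_square)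
qed

text \<open>In the finite Fourier expansion the index is replaced by n = j y, a permutation of the
  residues because y is a unit. As y b = 1, the sine loses b, which survives only through y in the
  sawtooth; the coefficients are the same for all units.\<close>

lemma cotpi_unit_expansion:
  assumes k: "k > 0" and y: "[y * b = 1] (mod k)"
  shows "cotpi (real m * real b / real k) = -2 * (\<Sum>j<k. sawtooth (real j * real y / real k) * sin (2 * pi * (real j * real m) / real k))"
proof -
  define F where "F n = sawtooth (real n / k) * sin (2 * pi * (real n * of_int (int (m * b))) / k)" for n :: nat
  have sper: "sin (x + 2 * pi * of_int t) = sin x" for x and t :: int
    by (simp add: sin_add)
  have per: "F (n + k) = F n" for n
  proof -
    have "real (n + k) / k = real n / k + of_int 1" using k by (simp add: field_simps)
    then have "sawtooth (real (n + k) / k) = sawtooth (real n / k)" by (metis sawtooth_add_int)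
    moreover have "2 * pi * (real (n + k) * of_int (int (m * b))) / k = 2 * pi * (real n * of_int (int (m * b))) / k + 2 * pi * of_int (int (m * b))"
      using k by (simp add: field_simps)
    ultimately show ?thesis unfolding F_def by (metis sper)
  qed
  have cop: "coprime y k" using y by (metis cong_imp_coprime cong_sym coprime_1_left coprime_mult_left_iff)
  have "int k dvd int (y * b) - 1"
    using y by (metis cong_iff_dvd_diff cong_int_iff of_nat_1)
  then obtain t where t: "int (y * b) - 1 = int k * t" by (auto elim: dvdE)
  have yb: "real y * real b = 1 + real k * of_int t"
  proof -
    have "real_of_int (int (y * b) - 1) = real_of_int (int k * t)" by (simp only: t)
    then show ?thesis by (simp add: algebra_simps)
  qed
  have Fy: "F (j * y) = sawtooth (real j * real y / real k) * sin (2 * pi * (real j * real m) / real k)" for j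
  proof -
    have "2 * pi * (real (j * y) * of_int (int (m * b))) / k = 2 * pi * (real j * real m * (real y * real b)) / k" by simp
    also have "\<dots> = 2 * pi * (real j * real m) / real k + 2 * pi * of_int (int j * int m * t)"
      unfolding yb using k by (simp add: field_simps)
    finally show ?thesis unfolding F_def sper by (metis of_nat_mult sper)
  qed
  have "cotpi (real m * real b / real k) = -2 * (\<Sum>n<k. F n)"
    using sum_sawtooth_sin[OF k, of "int (m * b)"] by (simp add: F_def)
  also have "(\<Sum>n<k. F n) = (\<Sum>j<k. F (j * y))" using sum_coprime_permute[of F k y, OF per cop k] by simp
  finally show ?thesis unfolding Fy .
qed

lemma sum_inverse_squares_tail_le:
  assumes "J \<ge> 1" shows "(\<Sum>j\<in>{J+1..H}. 1 / (real j)\<^sup>2) \<le> 1 / J"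
proof -
  have "(\<Sum>j\<in>{J+1..J+n}. 1 / (real j)\<^sup>2) \<le> 1 / J - 1 / (J + n)" for n
  proof (induction n)
    case (Suc n)
    have "1 / (real (J + Suc n))\<^sup>2 \<le> 1 / (real (J + n) * real (J + Suc n))"
      unfolding power2_eq_square using assms by (intro divide_left_mono mult_right_mono mult_pos_pos) auto
    also have "\<dots> = 1 / real (J + n) - 1 / real (J + Suc n)" using assms by (simp add: field_simps)
    finally show ?case using Suc.IH by simp
  qed simp
  from this[of "H - J"] show ?thesis
    by (cases "J \<le> H") (auto intro: order_trans)
qed

lemma sum_abs_le_quadratic:
  fixes f :: "nat \<Rightarrow> real"
  assumes "(\<Sum>y<k. (f y)\<^sup>2) \<le> B" "0 \<le> C" "k * B \<le> C\<^sup>2"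
  shows "(\<Sum>y<k. \<bar>f y\<bar>) \<le> C"
proof (rule power2_le_imp_le)
  have "(\<Sum>y<k. \<bar>f y\<bar> * 1)\<^sup>2 \<le> (\<Sum>y<k. \<bar>f y\<bar>\<^sup>2) * (\<Sum>y<k. 1\<^sup>2)"
    by (rule Cauchy_Schwarz_ineq_sum)
  also have "\<dots> \<le> B * k" using assms by (simp add: mult_right_mono)
  also have "\<dots> \<le> C\<^sup>2" using assms by (simp add: mult.commute)
  finally show "(\<Sum>y<k. \<bar>f y\<bar>)\<^sup>2 \<le> C\<^sup>2" by (simp only: mult_1_right)
qed fact

text \<open>J, the integer part of sqrt k, is both the number of shifts and the frequency cutoff.
  Over the units, the J-fold smoothed sum has low frequencies of L1 norm at most 8 J k^2, by
  near-orthogonality and Cauchy-Schwarz, and a tail of at most 8 J k^2. Division by J leaves 16 k^2,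
  and removing the shifts adds 4 k^2.\<close>

lemma sum_cotpi_units_le:
  assumes k: "k > 0"
  shows "(\<Sum>b | b < k \<and> coprime b k. \<bar>\<Sum>l\<in>{1..L}. cotpi (real l * real b / real k)\<bar>) \<le> 20 * (real k)\<^sup>2"
proof -
  define B where "B = {b. b < k \<and> coprime b k}"
  have finB: "finite B" and BS: "B \<subseteq> {..<k}" by (auto simp: B_def)
  define J where "J = nat \<lfloor>sqrt k\<rfloor>"
  have J1: "J \<ge> 1" using k by (simp add: J_def le_nat_iff le_floor_iff)
  have Js: "real J \<le> sqrt k" by (simp add: J_def)
  have sJ: "sqrt k \<le> 2 * real J"
  proof -
    have "sqrt k < real J + 1" unfolding J_def by (simp add: real_of_int_floor_add_one_gt)
    then show ?thesis using J1 by linarith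
  qed
  have JJ: "J * J \<le> k"
  proof -
    have "real J * real J \<le> sqrt k * sqrt k" using Js by (intro mult_mono) auto
    then show ?thesis by (simp flip: of_nat_mult)
  qed
  have kJ: "real k \<le> 4 * (real J * real J)"
  proof -
    have "sqrt k * sqrt k \<le> (2 * real J) * (2 * real J)" using sJ by (intro mult_mono) auto
    then show ?thesis by simp
  qed
  have JsJ: "real J * sqrt k \<le> k"
  proof -
    have "real J * sqrt k \<le> sqrt k * sqrt k" using Js by (intro mult_right_mono) auto
    then show ?thesis by simp
  qed
  define H where "H = (k - 1) div 2"
  define P where "P j = (\<Sum>i<J. \<Sum>l\<in>{1..L}. sin (2 * pi * (real j * real (l + i)) / real k))" for j
  define Z where "Z b = (\<Sum>i<J. \<Sum>l\<in>{1..L}. cotpi (real (l + i) * real b / real k))" for b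
  \<comment> \<open>For small k the cutoff J may exceed H, the last frequency after folding; hence
    the minimum.\<close>
  define M where "M y = (\<Sum>j\<in>{1..min J H}. sawtooth (real j * real y / real k) * P j)" for y :: nat
  have P1: "\<bar>P j\<bar> \<le> J * k / real j" if "j \<in> {1..H}" for j
  proof -
    have "\<bar>P j\<bar> \<le> (\<Sum>i<J. \<bar>\<Sum>l\<in>{1..L}. sin (2 * pi * (real j * real (l + i)) / real k)\<bar>)"
      unfolding P_def by (rule sum_abs)
    also have "\<dots> \<le> (\<Sum>i<J. real k / real j)"
      using that by (intro sum_mono sum_sin_shift_le(1)) (auto simp: H_def)
    finally show ?thesis by simp
  qed
  have P2: "\<bar>P j\<bar> \<le> (k / real j)\<^sup>2" if "j \<in> {1..H}" for j
    unfolding P_def using that by (intro sum_sin_shift_le(2)) (auto simp: H_def)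
  \<comment> \<open>The factor 4 is 2 from the expansion times 2 from folding j with k - j, under
    which sawtooth and sine both change sign. The tail over j > J uses the coefficients (k/j)^2 and
    the bound 1/2 for the sawtooth.\<close>
  have ZM: "\<bar>Z b\<bar> \<le> 4 * \<bar>M y\<bar> + 2 * (real k)\<^sup>2 / J" if y: "[y * b = 1] (mod k)" for y b
  proof -
    let ?h = "\<lambda>j. sawtooth (real j * real y / real k) * P j"
    have "Z b = (\<Sum>i<J. \<Sum>l\<in>{1..L}. -2 * (\<Sum>j<k. sawtooth (real j * real y / real k) * sin (2 * pi * (real j * real (l + i)) / real k)))"
      unfolding Z_def by (simp only: cotpi_unit_expansion[OF k y])
    also have "\<dots> = -2 * (\<Sum>i<J. \<Sum>l\<in>{1..L}. \<Sum>j<k. sawtooth (real j * real y / real k) * sin (2 * pi * (real j * real (l + i)) / real k))"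
      by (simp only: sum_distrib_left)
    also have "(\<Sum>i<J. \<Sum>l\<in>{1..L}. \<Sum>j<k. sawtooth (real j * real y / real k) * sin (2 * pi * (real j * real (l + i)) / real k))
       = (\<Sum>j<k. ?h j)"
      unfolding P_def sum_distrib_left
      by (subst sum.swap[of _ "{..<k}" "{1..L}"], subst sum.swap[of _ "{..<k}" "{..<J}"]) (rule refl)
    also have "(\<Sum>j<k. ?h j) = 2 * (\<Sum>j\<in>{1..H}. ?h j)" unfolding H_def
    proof (rule sum_symmetric_halves[OF k])
      fix j assume j: "0 < j" "j < k"
      have "real (k - j) * real y / k = - (real j * real y / k) + of_int (int y)" using j by (simp add: of_nat_diff field_simps)
      then have 1: "sawtooth (real (k - j) * real y / k) = - sawtooth (real j * real y / k)" by (metis sawtooth_add_int sawtooth_minus)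
      have "sin (2 * pi * (real (k - j) * real m) / real k) = - sin (2 * pi * (real j * real m) / real k)" for m
      proof -
        have "2 * pi * (real (k - j) * real m) / real k = 2 * pi * of_int (int m) - 2 * pi * (real j * real m) / real k"
          using j by (simp add: of_nat_diff field_simps)
        then show ?thesis using sin_integer_2pi[of "real m"] cos_integer_2pi[of "real m"] by (simp add: sin_diff)
      qed
      then have "P (k - j) = - P j" unfolding P_def by (simp only: sum_negf)
      then show "?h (k - j) = ?h j" using 1 by simp
    next
      fix j assume j: "2 * j = k"
      have "sin (2 * pi * (real j * real m) / real k) = 0" for m
      proof -
        have "2 * pi * (real j * real m) / real k = of_int (int m) * pi" using j k by (simp add: field_simps flip: j)
        then show ?thesis by (metis sin_zero_iff_int2)
      qed
      then have "P j = 0" unfolding P_def by (simp only: sum.neutral_const)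
      then show "?h j = 0" by simp
    qed simp
    also have "(\<Sum>j\<in>{1..H}. ?h j) = M y + (\<Sum>j\<in>{J+1..H}. ?h j)"
    proof -
      have "{1..H} = {1..min J H} \<union> {J+1..H}" by auto
      then show ?thesis unfolding M_def by (simp add: sum.union_disjoint)
    qed
    finally have "\<bar>Z b\<bar> \<le> 4 * \<bar>M y\<bar> + 4 * \<bar>\<Sum>j\<in>{J+1..H}. ?h j\<bar>" by (simp add: abs_mult)
    also have "\<bar>\<Sum>j\<in>{J+1..H}. ?h j\<bar> \<le> (\<Sum>j\<in>{J+1..H}. \<bar>?h j\<bar>)" by (rule sum_abs)
    also have "\<dots> \<le> (\<Sum>j\<in>{J+1..H}. 1/2 * (k / real j)\<^sup>2)"
      unfolding abs_mult by (intro sum_mono mult_mono abs_sawtooth_le P2) auto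
    also have "\<dots> = (real k)\<^sup>2 / 2 * (\<Sum>j\<in>{J+1..H}. 1 / (real j)\<^sup>2)" by (simp add: sum_distrib_left power_divide)
    also have "\<dots> \<le> (real k)\<^sup>2 / 2 * (1 / J)" by (intro mult_left_mono sum_inverse_squares_tail_le J1) auto
    finally show ?thesis by simp
  qed
  \<comment> \<open>The coefficients are at most A/j with A = J k, so the squares sum to at most 4
    (J k)^2 k, and k times this is (2 J k^2)^2.\<close>
  have MS: "(\<Sum>y<k. \<bar>M y\<bar>) \<le> 2 * J * (real k)\<^sup>2"
  proof (rule sum_abs_le_quadratic)
    show "(\<Sum>y<k. (M y)\<^sup>2) \<le> 4 * (real (J * k))\<^sup>2 * k"
      unfolding M_def
    proof (rule sum_sawtooth_quadratic_form[OF k])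
      have "min J H * min J H \<le> J * J" by (intro mult_mono) auto
      then show "min J H * min J H \<le> k" using JJ by linarith
      fix j assume "j \<in> {1..min J H}"
      then show "\<bar>P j\<bar> \<le> real (J * k) / real j" using P1[of j] by simp
    qed simp
    show "real k * (4 * (real (J * k))\<^sup>2 * real k) \<le> (real (2 * J) * (real k)\<^sup>2)\<^sup>2"
      by (simp add: power2_eq_square mult_ac)
  qed simp
  have "\<exists>y<k. [y * b = 1] (mod k)" if "b \<in> B" for b
  proof -
    have "coprime b k" using that by (simp add: B_def)
    then obtain x where "[b * x = Suc 0] (mod k)" using cong_solve_coprime_nat[of b k] by auto
    then have "[(x mod k) * b = 1] (mod k)" by (simp add: cong_def mult.commute mod_mult_left_eq mod_mult_right_eq)
    moreover have "x mod k < k" using k by simp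
    ultimately show ?thesis by blast
  qed
  then obtain \<iota> where io: "\<And>b. b \<in> B \<Longrightarrow> \<iota> b < k" "\<And>b. b \<in> B \<Longrightarrow> [\<iota> b * b = 1] (mod k)" by metis
  have inj: "inj_on \<iota> B"
  proof (rule inj_onI)
    fix b c assume bc: "b \<in> B" "c \<in> B" "\<iota> b = \<iota> c"
    have "[b * (\<iota> b * c) = b * 1] (mod k)" using io(2)[OF bc(2)] bc(3) by (intro cong_mult) auto
    moreover have "[c * (\<iota> b * b) = c * 1] (mod k)" using io(2)[OF bc(1)] by (intro cong_mult) auto
    ultimately have "[b = c] (mod k)" by (simp add: mult_ac) (metis cong_sym cong_trans)
    then show "b = c" using bc by (intro cong_less_modulus_unique_nat) (auto simp: B_def)
  qed
  have cardB: "real (card B) \<le> k" using card_mono[OF _ BS] by simp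
  have "(\<Sum>b\<in>B. \<bar>Z b\<bar>) \<le> (\<Sum>b\<in>B. 4 * \<bar>M (\<iota> b)\<bar> + 2 * (real k)\<^sup>2 / J)"
    using io(2) by (intro sum_mono ZM)
  also have "\<dots> = 4 * (\<Sum>b\<in>B. \<bar>M (\<iota> b)\<bar>) + card B * (2 * (real k)\<^sup>2 / J)" by (simp add: sum.distrib sum_distrib_left)
  also have "(\<Sum>b\<in>B. \<bar>M (\<iota> b)\<bar>) = (\<Sum>y\<in>\<iota> ` B. \<bar>M y\<bar>)" by (simp add: sum.reindex[OF inj])
  also have "\<dots> \<le> (\<Sum>y<k. \<bar>M y\<bar>)" using io(1) by (intro sum_mono2) auto
  also have "\<dots> \<le> 2 * J * (real k)\<^sup>2" by (rule MS)
  \<comment> \<open>Here k \<le> 4 J^2 converts the tail k * 2 k^2 / J into a multiple of J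
    k^2.\<close>
  also have "card B * (2 * (real k)\<^sup>2 / J) \<le> 8 * J * (real k)\<^sup>2"
  proof -
    have "card B * (2 * (real k)\<^sup>2 / J) \<le> (4 * (real J * real J)) * (2 * (real k)\<^sup>2 / J)"
      using cardB kJ by (intro mult_right_mono) auto
    also have "\<dots> = 8 * J * (real k)\<^sup>2" using J1 by simp
    finally show ?thesis .
  qed
  finally have ZS: "(\<Sum>b\<in>B. \<bar>Z b\<bar>) \<le> 16 * J * (real k)\<^sup>2" by simp
  define g where "g b = (\<Sum>l\<in>{1..L}. cotpi (real l * real b / real k))" for b
  \<comment> \<open>A shift by i changes the sum by i terms at each end, each of L1 norm at most 2 k
    sqrt k, and i < J \<le> sqrt k.\<close>
  have dS: "(\<Sum>b\<in>B. \<bar>(\<Sum>l\<in>{1..L}. cotpi (real (l + i) * real b / real k)) - g b\<bar>) \<le> 4 * (real k)\<^sup>2" if i: "i < J" for i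
  proof -
    let ?c = "\<lambda>b l. cotpi (real l * real b / real k)"
    have "\<bar>(\<Sum>l\<in>{1..L}. ?c b (l + i)) - g b\<bar> \<le> (\<Sum>l\<in>{L+1..L+i}. \<bar>?c b l\<bar>) + (\<Sum>l\<in>{1..i}. \<bar>?c b l\<bar>)" for b
    proof -
      have "(\<Sum>l\<in>{1..L}. ?c b (l + i)) = (\<Sum>l\<in>{1+i..L+i}. ?c b l)" by (rule sum.shift_bounds_cl_nat_ivl[symmetric])
      moreover have "(\<Sum>l\<in>{1..i}. ?c b l) + (\<Sum>l\<in>{1+i..L+i}. ?c b l) = (\<Sum>l\<in>{1..L+i}. ?c b l)"
        by (subst sum.union_disjoint[symmetric]) (auto intro!: sum.cong)
      moreover have "(\<Sum>l\<in>{1..L}. ?c b l) + (\<Sum>l\<in>{L+1..L+i}. ?c b l) = (\<Sum>l\<in>{1..L+i}. ?c b l)"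
        by (subst sum.union_disjoint[symmetric]) (auto intro!: sum.cong)
      ultimately have "(\<Sum>l\<in>{1..L}. ?c b (l + i)) - g b = (\<Sum>l\<in>{L+1..L+i}. ?c b l) - (\<Sum>l\<in>{1..i}. ?c b l)" by (simp add: g_def)
      then show ?thesis using sum_abs[of "?c b" "{L+1..L+i}"] sum_abs[of "?c b" "{1..i}"] by linarith
    qed
    then have "(\<Sum>b\<in>B. \<bar>(\<Sum>l\<in>{1..L}. ?c b (l + i)) - g b\<bar>) \<le> (\<Sum>b\<in>B. (\<Sum>l\<in>{L+1..L+i}. \<bar>?c b l\<bar>) + (\<Sum>l\<in>{1..i}. \<bar>?c b l\<bar>))"
      by (intro sum_mono)
    also have "\<dots> \<le> (\<Sum>b<k. (\<Sum>l\<in>{L+1..L+i}. \<bar>?c b l\<bar>) + (\<Sum>l\<in>{1..i}. \<bar>?c b l\<bar>))"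
      by (intro sum_mono2 BS add_nonneg_nonneg sum_nonneg) auto
    also have "\<dots> = (\<Sum>l\<in>{L+1..L+i}. \<Sum>b<k. \<bar>?c b l\<bar>) + (\<Sum>l\<in>{1..i}. \<Sum>b<k. \<bar>?c b l\<bar>)"
      by (subst (1 2) sum.swap) (simp add: sum.distrib)
    also have "\<dots> \<le> (\<Sum>l\<in>{L+1..L+i}. 2 * real k * sqrt k) + (\<Sum>l\<in>{1..i}. 2 * real k * sqrt k)"
      by (intro add_mono sum_mono sum_abs_cotpi_mult_le k)
    also have "\<dots> = 4 * k * (real i * sqrt k)" by simp
    also have "\<dots> \<le> 4 * k * real k"
    proof (rule mult_left_mono)
      have "real i * sqrt k \<le> real J * sqrt k" using i by (intro mult_right_mono) auto
      then show "real i * sqrt k \<le> k" using JsJ by linarith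
    qed simp
    finally show ?thesis by (simp add: power2_eq_square)
  qed
  have "J * (\<Sum>b\<in>B. \<bar>g b\<bar>) = (\<Sum>b\<in>B. \<bar>J * g b\<bar>)" by (simp add: abs_mult sum_distrib_left)
  also have "\<dots> \<le> (\<Sum>b\<in>B. \<bar>Z b\<bar> + (\<Sum>i<J. \<bar>(\<Sum>l\<in>{1..L}. cotpi (real (l + i) * real b / real k)) - g b\<bar>))"
  proof (rule sum_mono)
    fix b
    have "Z b - J * g b = (\<Sum>i<J. (\<Sum>l\<in>{1..L}. cotpi (real (l + i) * real b / real k)) - g b)"
      by (simp add: Z_def sum_subtractf)
    then have "\<bar>Z b - J * g b\<bar> \<le> (\<Sum>i<J. \<bar>(\<Sum>l\<in>{1..L}. cotpi (real (l + i) * real b / real k)) - g b\<bar>)"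
      using sum_abs[of "\<lambda>i. (\<Sum>l\<in>{1..L}. cotpi (real (l + i) * real b / real k)) - g b" "{..<J}"] by simp
    then show "\<bar>J * g b\<bar> \<le> \<bar>Z b\<bar> + (\<Sum>i<J. \<bar>(\<Sum>l\<in>{1..L}. cotpi (real (l + i) * real b / real k)) - g b\<bar>)" by linarith
  qed
  also have "\<dots> = (\<Sum>b\<in>B. \<bar>Z b\<bar>) + (\<Sum>i<J. \<Sum>b\<in>B. \<bar>(\<Sum>l\<in>{1..L}. cotpi (real (l + i) * real b / real k)) - g b\<bar>)"
    unfolding sum.distrib by (subst (2) sum.swap) simp
  also have "\<dots> \<le> 16 * J * (real k)\<^sup>2 + (\<Sum>i<J. 4 * (real k)\<^sup>2)"
    by (intro add_mono ZS sum_mono dS) auto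
  also have "\<dots> = J * (20 * (real k)\<^sup>2)" by simp
  finally have "(\<Sum>b\<in>B. \<bar>g b\<bar>) \<le> 20 * (real k)\<^sup>2" using J1 by simp
  then show ?thesis by (simp add: g_def B_def)
qed

text \<open>The residues with gcd d are d times the units modulo k/d, with the same cutoff L; the
  bound for units is therefore wanted for every L. Summing (k/d)^2 over d at most doubles the
  constant.\<close>

lemma sum_cotpi_L1_le:
  assumes k: "k > 0"
  shows "(\<Sum>b<k. \<bar>\<Sum>l\<in>{1..L}. cotpi (real l * real b / real k)\<bar>) \<le> 40 * (real k)\<^sup>2"
proof -
  let ?h = "\<lambda>b. \<bar>\<Sum>l\<in>{1..L}. cotpi (real l * real b / real k)\<bar>"
  let ?D = "{d. d dvd k}"
  have D: "finite ?D" "?D \<subseteq> {1..k}" using k by (auto dest: dvd_imp_le intro!: Nat.gr0I simp: Suc_le_eq)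
  have "(\<Sum>b<k. ?h b) = (\<Sum>d\<in>?D. \<Sum>b\<in>{b\<in>{..<k}. gcd b k = d}. ?h b)"
    by (rule sum.group[symmetric]) (use D in auto)
  also have "\<dots> \<le> (\<Sum>d\<in>?D. 20 * (real k)\<^sup>2 * (1 / (real d)\<^sup>2))"
  proof (rule sum_mono)
    fix d assume "d \<in> ?D"
    then obtain k' where k': "k = d * k'" by (auto elim: dvdE)
    have pos: "d > 0" "k' > 0" using k k' by (auto intro!: Nat.gr0I)
    have "(\<Sum>b\<in>{b\<in>{..<k}. gcd b k = d}. ?h b) = (\<Sum>b\<in>{b. b < k' \<and> coprime b k'}. \<bar>\<Sum>l\<in>{1..L}. cotpi (real l * real b / real k')\<bar>)"
    proof (rule sum.reindex_bij_witness[of _ "\<lambda>b. d * b" "\<lambda>b. b div d"])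
      fix b assume b: "b \<in> {b\<in>{..<k}. gcd b k = d}"
      then obtain c where c: "b = d * c" by (metis (mono_tags, lifting) dvdE gcd_dvd1 mem_Collect_eq)
      show "d * (b div d) = b" using c pos by simp
      have "gcd c k' = 1" using b pos by (simp add: c k' gcd_mult_distrib_nat[symmetric])
      then show "b div d \<in> {b. b < k' \<and> coprime b k'}" using b pos by (simp add: c k' coprime_iff_gcd_eq_1)
      show "\<bar>\<Sum>l\<in>{1..L}. cotpi (real l * real (b div d) / real k')\<bar> = ?h b"
        using pos by (simp add: c k' mult.left_commute)
    next
      fix b assume b: "b \<in> {b. b < k' \<and> coprime b k'}"
      show "d * b div d = b" using pos by simp
      show "d * b \<in> {b\<in>{..<k}. gcd b k = d}" using b pos by (simp add: k' gcd_mult_distrib_nat[symmetric] coprime_iff_gcd_eq_1)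
    qed
    also have "\<dots> \<le> 20 * (real k')\<^sup>2" by (rule sum_cotpi_units_le[OF pos(2)])
    also have "\<dots> = 20 * (real k)\<^sup>2 * (1 / (real d)\<^sup>2)" using pos by (simp add: k' power_mult_distrib)
    finally show "(\<Sum>b\<in>{b\<in>{..<k}. gcd b k = d}. ?h b) \<le> 20 * (real k)\<^sup>2 * (1 / (real d)\<^sup>2)" .
  qed
  also have "\<dots> = 20 * (real k)\<^sup>2 * (\<Sum>d\<in>?D. 1 / (real d)\<^sup>2)" by (simp only: sum_distrib_left)
  also have "\<dots> \<le> 20 * (real k)\<^sup>2 * (\<Sum>d\<in>{1..k}. 1 / (real d)\<^sup>2)"
    using D by (intro mult_left_mono sum_mono2) auto
  also have "\<dots> \<le> 20 * (real k)\<^sup>2 * 2"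
  proof (rule mult_left_mono)
    have "0 \<le> (if k = 0 then 2 else 1 / real k)" by simp
    then show "(\<Sum>d\<in>{1..k}. 1 / (real d)\<^sup>2) \<le> 2" using sum_inverse_squares_le[of k] by linarith
  qed simp
  finally show ?thesis by simp
qed

section \<open>Averages over all pairs\<close>

text \<open>Because the weights increase, only the last one enters; this fits cot (pi k / b), which
  grows with b.\<close>

lemma abel_summation_monotone:
  fixes \<omega> g :: "nat \<Rightarrow> real"
  assumes mn: "m \<le> n" and mono: "\<And>b. m \<le> b \<Longrightarrow> b < n \<Longrightarrow> \<omega> b \<le> \<omega> (Suc b)" and pos: "\<omega> m \<ge> 0"
    and P: "\<And>n'. \<bar>\<Sum>b\<in>{m..n'}. g b\<bar> \<le> P"
  shows "\<bar>\<Sum>b\<in>{m..n}. \<omega> b * g b\<bar> \<le> 2 * P * \<omega> n"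
proof -
  have P0: "P \<ge> 0" using P[of m] by linarith
  have "\<bar>(\<Sum>b\<in>{m..n}. \<omega> b * g b) - \<omega> n * (\<Sum>b\<in>{m..n}. g b)\<bar> \<le> P * (\<omega> n - \<omega> m) \<and> \<omega> m \<le> \<omega> n"
    using mn mono
  proof (induction n rule: dec_induct)
    case (step n)
    have IH: "\<bar>(\<Sum>b\<in>{m..n}. \<omega> b * g b) - \<omega> n * (\<Sum>b\<in>{m..n}. g b)\<bar> \<le> P * (\<omega> n - \<omega> m)" "\<omega> m \<le> \<omega> n"
      using step by auto
    have inc: "\<omega> n \<le> \<omega> (Suc n)" using step by simp
    have "(\<Sum>b\<in>{m..Suc n}. \<omega> b * g b) - \<omega> (Suc n) * (\<Sum>b\<in>{m..Suc n}. g b) =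
      ((\<Sum>b\<in>{m..n}. \<omega> b * g b) - \<omega> n * (\<Sum>b\<in>{m..n}. g b)) - (\<omega> (Suc n) - \<omega> n) * (\<Sum>b\<in>{m..n}. g b)"
      using step by (simp add: sum.nat_ivl_Suc' algebra_simps)
    moreover have "\<bar>(\<omega> (Suc n) - \<omega> n) * (\<Sum>b\<in>{m..n}. g b)\<bar> \<le> (\<omega> (Suc n) - \<omega> n) * P"
      using P[of n] inc by (simp add: abs_mult mult_left_mono)
    ultimately have "\<bar>(\<Sum>b\<in>{m..Suc n}. \<omega> b * g b) - \<omega> (Suc n) * (\<Sum>b\<in>{m..Suc n}. g b)\<bar>
       \<le> P * (\<omega> n - \<omega> m) + (\<omega> (Suc n) - \<omega> n) * P" using IH by linarith
    also have "\<dots> = P * (\<omega> (Suc n) - \<omega> m)" by (simp add: algebra_simps)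
    finally show ?case using IH inc by linarith
  qed simp
  moreover have "\<bar>\<omega> n * (\<Sum>b\<in>{m..n}. g b)\<bar> \<le> \<omega> n * P"
    using calculation pos P[of n] by (simp add: abs_mult mult_left_mono)
  moreover have "P * (\<omega> n - \<omega> m) \<le> P * \<omega> n" using P0 pos by (intro mult_left_mono) auto
  ultimately show ?thesis by (simp add: algebra_simps) linarith
qed

lemma sum_cotpi_period_zero:
  assumes k: "k > 0"
  shows "(\<Sum>b<k. \<Sum>l\<in>{1..L}. cotpi (real l * real b / real k)) = 0"
proof -
  have "(\<Sum>b<k. cotpi (real l * real b / real k)) = 0" for l
  proof -
    have "(\<Sum>b<k. cotpi (real l * real b / real k)) = (\<Sum>i\<in>{0..<0 + int k}. cotpi (real l * of_int i / real k))"
      by (rule sum.reindex_bij_witness[of _ nat int]) auto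
    also have "\<dots> = 0"
    proof (rule sum_odd_periodic_window)
      fix i
      have "real l * of_int (i + int k) / real k = real l * of_int i / real k + of_int (int l)" using k by (simp add: field_simps)
      then show "cotpi (real l * of_int (i + int k) / real k) = cotpi (real l * of_int i / real k)" by (metis cotpi_add_int)
    qed (use k in auto)
    finally show ?thesis .
  qed
  then show ?thesis by (subst sum.swap) simp
qed

text \<open>The inner sum is odd and periodic in b, so complete periods cancel; the fewer than k
  remaining terms are bounded by the L1 norm over a period.\<close>

lemma sum_cotpi_partial_le:
  assumes k: "k > 0"
  shows "\<bar>\<Sum>b\<in>{m..n}. \<Sum>l\<in>{1..L}. cotpi (real l * real b / real k)\<bar> \<le> 40 * (real k)\<^sup>2"
proof -
  define g where "g b = (\<Sum>l\<in>{1..L}. cotpi (real l * real b / real k))" for b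
  define h where "h t = g (t + m)" for t
  have perg: "g (b + k) = g b" for b unfolding g_def by (simp only: cotpi_periodic_nat[OF k])
  have per: "h (t + k) = h t" for t using perg[of "t + m"] by (simp add: h_def add_ac)
  define N where "N = Suc n - m"
  define q r where "q = N div k" and "r = N mod k"
  have N: "N = q * k + r" "r < k" using k by (auto simp: q_def r_def)
  have z: "(\<Sum>t<k. h t) = 0"
    unfolding h_def using sum_shift_periodic_nat[of g k m, OF perg] sum_cotpi_period_zero[OF k, of L] by (simp add: g_def)
  have blk: "(\<Sum>t\<in>{i * k..<i * k + r}. h t) = (\<Sum>t<r. h t)" for i r
  proof -
    have "(\<Sum>t\<in>{i * k..<i * k + r}. h t) = (\<Sum>t<r. h (t + i * k))"
      by (rule sum.reindex_bij_witness[of _ "\<lambda>t. t + i * k" "\<lambda>t. t - i * k"]) auto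
    then show ?thesis by (simp add: periodic_nat_mult[of h k, OF per])
  qed
  have "(\<Sum>b\<in>{m..n}. g b) = (\<Sum>t<N. h t)"
    by (rule sum.reindex_bij_witness[of _ "\<lambda>t. t + m" "\<lambda>b. b - m"]) (auto simp: N_def h_def)
  also have "\<dots> = (\<Sum>t<q * k. h t) + (\<Sum>t\<in>{q * k..<q * k + r}. h t)"
    unfolding N lessThan_atLeast0 by (rule sum.atLeastLessThan_concat[symmetric]) auto
  also have "(\<Sum>t<q * k. h t) = 0" unfolding sum.nat_group[symmetric] by (simp add: blk z)
  also have "(\<Sum>t\<in>{q * k..<q * k + r}. h t) = (\<Sum>t<r. h t)" by (rule blk)
  finally have "\<bar>\<Sum>b\<in>{m..n}. g b\<bar> \<le> (\<Sum>t<r. \<bar>h t\<bar>)" by (simp add: sum_abs)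
  also have "\<dots> \<le> (\<Sum>t<k. \<bar>h t\<bar>)" using N by (intro sum_mono2) auto
  also have "\<dots> = (\<Sum>t<k. \<bar>g t\<bar>)"
    unfolding h_def by (rule sum_shift_periodic_nat[of "\<lambda>t. \<bar>g t\<bar>"]) (simp only: perg)
  also have "\<dots> \<le> 40 * (real k)\<^sup>2" unfolding g_def by (rule sum_cotpi_L1_le[OF k])
  finally show ?thesis unfolding g_def .
qed

text \<open>The range b \<ge> 2 k + 1 is what folding k with b - k leaves: k/b < 1/2, so the weight
  is nonnegative, and the last one is at most Q/k.\<close>

lemma sum_cotpi_weighted_le:
  assumes k: "k > 0"
  shows "\<bar>\<Sum>b\<in>{2*k+1..Q}. cotpi (real k / real b) * (\<Sum>l\<in>{1..L}. cotpi (real l * real b / real k))\<bar> \<le> 80 * real k * real Q"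
proof (cases "2 * k + 1 \<le> Q")
  case True
  have "\<bar>\<Sum>b\<in>{2*k+1..Q}. cotpi (real k / real b) * (\<Sum>l\<in>{1..L}. cotpi (real l * real b / real k))\<bar>
      \<le> 2 * (40 * (real k)\<^sup>2) * cotpi (real k / real Q)"
  proof (rule abel_summation_monotone[OF True])
    fix b assume b: "2 * k + 1 \<le> b" "b < Q"
    show "cotpi (real k / real b) \<le> cotpi (real k / real (Suc b))"
      using b k by (intro cotpi_antimono divide_left_mono) auto
  next
    have "real k / real (2 * k + 1) \<le> 1 / 2" by (simp add: field_simps)
    then show "0 \<le> cotpi (real k / real (2 * k + 1))" by (intro cotpi_nonneg) auto
  qed (rule sum_cotpi_partial_le[OF k])
  also have "\<dots> \<le> 2 * (40 * (real k)\<^sup>2) * (1 / (1 * (real k / real Q)))"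
  proof (rule mult_left_mono)
    have "cotpi (real k / real Q) \<le> 1 / (pi * (real k / real Q))"
      using True k by (intro cotpi_le) (auto simp: field_simps)
    also have "\<dots> \<le> 1 / (1 * (real k / real Q))"
      using True k pi_ge_two by (intro divide_left_mono mult_right_mono) auto
    finally show "cotpi (real k / real Q) \<le> 1 / (1 * (real k / real Q))" .
  qed simp
  also have "\<dots> = 80 * real k * real Q"
    using k by (simp add: power2_eq_square)
  finally show ?thesis .
qed auto

text \<open>The Basel series with an explicit remainder; 2/(n + 1) instead of 1/n covers n = 0,
  which occurs for small b.\<close>

lemma inverse_squares_tail:
  "(\<Sum>k\<in>{1..n}. 1 / (real k)\<^sup>2) \<le> pi\<^sup>2 / 6" "pi\<^sup>2 / 6 - (\<Sum>k\<in>{1..n}. 1 / (real k)\<^sup>2) \<le> 2 / real (n + 1)"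
proof -
  define S where "S n = (\<Sum>k\<in>{1..n}. 1 / (real k)\<^sup>2)" for n
  have "S = (\<lambda>n. \<Sum>k<n. 1 / (real k + 1)\<^sup>2)"
    unfolding S_def One_nat_def sum.atLeast1_atMost_eq by (simp add: add.commute)
  then have lim: "S \<longlonglongrightarrow> pi\<^sup>2 / 6" using inverse_squares_sums by (simp add: sums_def add.commute)
  have mono: "S n \<le> S m" if "n \<le> m" for n m unfolding S_def using that by (intro sum_mono2) auto
  have "S n \<le> pi\<^sup>2 / 6" by (rule LIMSEQ_le_const[OF lim]) (use mono in blast)
  then show "(\<Sum>k\<in>{1..n}. 1 / (real k)\<^sup>2) \<le> pi\<^sup>2 / 6" by (simp add: S_def)
  have "pi\<^sup>2 / 6 \<le> S n + 2 / real (n + 1)"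
  proof (rule LIMSEQ_le_const2[OF lim], intro exI allI impI)
    fix m assume m: "n \<le> m"
    show "S m \<le> S n + 2 / real (n + 1)"
    proof (cases "n = 0")
      case True
      have "0 \<le> (if m = 0 then 2 else 1 / real m)" by simp
      then show ?thesis using sum_inverse_squares_le[of m] True by (simp add: S_def)
    next
      case False
      have "{1..m} = {1..n} \<union> {n+1..m}" using m by auto
      then have "S m = S n + (\<Sum>k\<in>{n+1..m}. 1 / (real k)\<^sup>2)" unfolding S_def by (simp add: sum.union_disjoint)
      also have "\<dots> \<le> S n + 1 / n" using False by (intro add_left_mono sum_inverse_squares_tail_le) auto
      also have "1 / real n \<le> 2 / real (n + 1)" using False by (simp add: field_simps)
      finally show ?thesis by simp
    qed
  qed
  then show "pi\<^sup>2 / 6 - (\<Sum>k\<in>{1..n}. 1 / (real k)\<^sup>2) \<le> 2 / real (n + 1)" by (simp add: S_def)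
qed

text \<open>From ln n = 2 ln (sqrt n) \<le> 2 sqrt n the series has the majorant 2 n^(-3/2).\<close>

lemma sum_ln_over_squares_bounded: "\<exists>K. \<forall>n. (\<Sum>k\<in>{1..n}. ln (real k) / (real k)\<^sup>2) \<le> K"
proof -
  have "summable (\<lambda>k. ln (real k) / (real k)\<^sup>2)"
  proof (rule summable_comparison_test)
    show "summable (\<lambda>k. 2 * real k powr (-3/2))" by (intro summable_mult) (simp add: summable_real_powr_iff)
    show "\<exists>N. \<forall>n\<ge>N. norm (ln (real n) / (real n)\<^sup>2) \<le> 2 * real n powr (-3/2)"
    proof (intro exI allI impI)
      fix n :: nat assume n: "1 \<le> n"
      have "ln (real n) = 2 * ln (sqrt n)" using n by (simp add: ln_sqrt)
      also have "\<dots> \<le> 2 * sqrt n" using ln_le_minus_one[of "sqrt n"] n by simp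
      finally have "ln (real n) / (real n)\<^sup>2 \<le> 2 * sqrt n / (real n)\<^sup>2" by (rule divide_right_mono) simp
      also have "\<dots> = 2 * real n powr (-3/2)"
      proof -
        have "real n powr (-3/2) = real n powr (1/2 - 2)" by simp
        also have "\<dots> = sqrt n / (real n)\<^sup>2" unfolding powr_diff using n by (simp add: powr_half_sqrt)
        finally show ?thesis by simp
      qed
      finally show "norm (ln (real n) / (real n)\<^sup>2) \<le> 2 * real n powr (-3/2)" using n by simp
    qed
  qed
  then have "(\<Sum>k\<in>{1..n}. ln (real k) / (real k)\<^sup>2) \<le> (\<Sum>k. ln (real k) / (real k)\<^sup>2)" for n
  proof (rule sum_le_suminf)
    fix k :: nat
    show "0 \<le> ln (real k) / (real k)\<^sup>2" by (cases "k = 0") auto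
  qed simp
  then show ?thesis by blast
qed

text \<open>Both cotangents are odd under k to b - k, so the product folds, and the middle k = b/2
  drops out as cot (pi/2) = 0. Folding also secures b/k \<ge> 2, the least cell length that the
  reciprocity admits.\<close>

lemma dedekind_sum_initial_eq:
  assumes b: "b > 0"
  shows "(\<Sum>a\<in>A. dedekind_sum a (int b)) =
    (\<Sum>k\<in>{1..(b - 1) div 2}. cotpi (real k / real b) * (\<Sum>a\<in>A. cotpi (real k * of_int a / real b))) / (2 * b)"
proof -
  have "(\<Sum>a\<in>A. dedekind_sum a (int b)) = (\<Sum>a\<in>A. \<Sum>k<b. cotpi (real k / b) * cotpi (real k * of_int a / b)) / (4 * b)"
    by (simp add: dedekind_sum_cotpi[OF b] sum_divide_distrib)
  also have "(\<Sum>a\<in>A. \<Sum>k<b. cotpi (real k / b) * cotpi (real k * of_int a / b)) = (\<Sum>k<b. cotpi (real k / b) * (\<Sum>a\<in>A. cotpi (real k * of_int a / b)))"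
    by (subst sum.swap) (simp add: sum_distrib_left)
  also have "\<dots> = 2 * (\<Sum>k\<in>{1..(b - 1) div 2}. cotpi (real k / b) * (\<Sum>a\<in>A. cotpi (real k * of_int a / b)))"
  proof (rule sum_symmetric_halves[OF b])
    fix j assume j: "0 < j" "j < b"
    have r: "cotpi (real (b - j) * of_int a / b) = - cotpi (real j * of_int a / b)" for a
    proof -
      have "real (b - j) * of_int a / b = - (real j * of_int a / b) + of_int a" using j b by (simp add: of_nat_diff field_simps)
      then show ?thesis by (metis cotpi_add_int cotpi_minus)
    qed
    show "cotpi (real (b - j) / b) * (\<Sum>a\<in>A. cotpi (real (b - j) * of_int a / b)) = cotpi (real j / b) * (\<Sum>a\<in>A. cotpi (real j * of_int a / b))"
      using r[of 1] by (simp add: r sum_negf)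
  next
    fix j assume "2 * j = b"
    then have "real j / b = 1/2" using b by (simp add: field_simps flip: of_nat_mult)
    then show "cotpi (real j / b) * (\<Sum>a\<in>A. cotpi (real j * of_int a / b)) = 0" by (simp add: cotpi_def cot_def)
  qed simp
  finally show ?thesis by simp
qed

section \<open>Sums over all numerators, for one denominator and then on average\<close>

locale rational_cutoff =
  fixes v w :: nat
  assumes v: "v > 0" and vw: "v \<le> w" and cop: "coprime v w"
begin

definition \<alpha> :: real where "\<alpha> = real v / real w"

text \<open>The number of poles l/k with 0 < l/k < \<alpha>; a pole at \<alpha> itself is left
  out.\<close>

definition L :: "nat \<Rightarrow> nat" where "L k = nat (\<lceil>\<alpha> * real k\<rceil> - 1)"

definition g :: "nat \<Rightarrow> nat \<Rightarrow> real" where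
  "g k b = (\<Sum>l\<in>{1..L k}. cotpi (real l * real b / real k))"

definition \<kappa> :: real where "\<kappa> = 1/12 * (1 - 1 / (real w)\<^sup>2)"

lemma w: "w > 0" using v vw by simp

lemma \<alpha>: "0 < \<alpha>" "\<alpha> \<le> 1" using v w vw by (auto simp: \<alpha>_def)

lemma L_le: "L k \<le> k"
proof -
  have "\<alpha> * real k \<le> 1 * real k" using \<alpha> by (intro mult_right_mono) auto
  then show ?thesis unfolding L_def by (simp add: nat_le_iff) linarith
qed

definition T :: "nat \<Rightarrow> real" where
  "T b = (\<Sum>a\<in>{0..<\<lceil>\<alpha> * real b\<rceil>}. dedekind_sum a (int b))"

text \<open>The contribution of the reciprocal sums: b/k from the reciprocity and 1/(2 b) from the
  folded cotangent formula combine to 1/(2 k).\<close>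

definition R :: "nat \<Rightarrow> real" where
  "R b = - (\<Sum>k\<in>{1..(b - 1) div 2}. cotpi (real k / real b) * g k b / real k) / 2"

text \<open>The part of the pole at 0 that the end \<alpha> does not cancel.\<close>

definition main :: "nat \<Rightarrow> real" where
  "main b = (\<Sum>k\<in>{1..(b - 1) div 2}. if w dvd k then 0 else cotpi (real k / real b) * ln (real b / real k) / real k) / (2 * pi)"

lemma half_range:
  assumes "k \<in> {1..(b - 1) div 2}" "b > 0"
  shows "0 < real k / real b" "real k / real b \<le> 1/2" "2 \<le> real b / real k" "k > 0"
  using assms by (auto simp: field_simps)

text \<open>The reciprocity error 8 k + (2 w + 7) b/k is multiplied by cot (pi k / b) \<le> b/(2 k),
  summed over k < b/2 and divided by 2 b. Its two parts give b and (w + 7/2) b.\<close>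

lemma T_approx:
  assumes b: "b > 0"
  shows "\<bar>T b - R b - main b\<bar> \<le> (real w + 6) * b"
proof -
  let ?H = "{1..(b - 1) div 2}"
  let ?C = "\<lambda>k. \<Sum>a\<in>{0..<\<lceil>\<alpha> * real b\<rceil>}. cotpi (real k * of_int a / real b)"
  let ?m = "\<lambda>k. if w dvd k then 0 else (real b / real k) / pi * ln (real b / real k)"
  have rec: "\<bar>?C k + (real b / real k) * g k b - ?m k\<bar> \<le> 8 * real k + (2 * real w + 7) * (real b / real k)" if k: "k \<in> ?H" for k
  proof -
    note hr = half_range[OF k b]
    have "\<bar>(\<Sum>a\<in>{0..<\<lceil>real v / real w * real b\<rceil>}. cotpi (of_int a / (real b / real k)))
        + (real b / real k) * (\<Sum>l = 1..nat (\<lceil>real v / real w * real k\<rceil> - 1). cotpi (real l * (real b / real k)))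
      - (if w dvd k then 0 else (real b / real k) / pi * ln (real b / real k))\<bar>
      \<le> 8 * real (nat (\<lceil>real v / real w * real k\<rceil> - 1)) + (2 * real w + 7) * (real b / real k)"
      by (rule cotpi_sum_reciprocity) (use hr v w cop in auto)
    then have "\<bar>?C k + (real b / real k) * g k b - ?m k\<bar> \<le> 8 * real (L k) + (2 * real w + 7) * (real b / real k)"
      by (simp add: g_def L_def \<alpha>_def mult.commute)
    then show ?thesis using L_le[of k] by linarith
  qed
  have eq: "T b - R b - main b = (\<Sum>k\<in>?H. cotpi (real k / real b) * (?C k + (real b / real k) * g k b - ?m k)) / (2 * b)"
  proof -
    have "(\<Sum>k\<in>?H. cotpi (real k / real b) * (?C k + (real b / real k) * g k b - ?m k)) / (2 * b) =
      (\<Sum>k\<in>?H. cotpi (real k / real b) * ?C k) / (2 * b)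
      + (\<Sum>k\<in>?H. cotpi (real k / real b) * ((real b / real k) * g k b)) / (2 * b)
      - (\<Sum>k\<in>?H. cotpi (real k / real b) * ?m k) / (2 * b)"
      by (simp only: distrib_left right_diff_distrib sum.distrib sum_subtractf add_divide_distrib diff_divide_distrib)
    also have "(\<Sum>k\<in>?H. cotpi (real k / real b) * ?C k) / (2 * b) = T b"
      unfolding T_def using dedekind_sum_initial_eq[OF b] by simp
    also have "(\<Sum>k\<in>?H. cotpi (real k / real b) * ((real b / real k) * g k b)) / (2 * b) = - R b"
      unfolding R_def sum_divide_distrib using b by (simp add: sum_negf[symmetric] sum_divide_distrib field_simps)
    also have "(\<Sum>k\<in>?H. cotpi (real k / real b) * ?m k) / (2 * b) = main b"
      unfolding main_def sum_divide_distrib using b by (intro sum.cong refl) auto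
    finally show ?thesis by simp
  qed
  have "\<bar>(\<Sum>k\<in>?H. cotpi (real k / real b) * (?C k + (real b / real k) * g k b - ?m k)) / (2 * b)\<bar>
    \<le> (\<Sum>k\<in>?H. 4 * real b + (real w + 7/2) * (real b)\<^sup>2 * (1 / (real k)\<^sup>2)) / (2 * b)"
  proof -
    have "\<bar>\<Sum>k\<in>?H. cotpi (real k / real b) * (?C k + (real b / real k) * g k b - ?m k)\<bar>
        \<le> (\<Sum>k\<in>?H. \<bar>cotpi (real k / real b) * (?C k + (real b / real k) * g k b - ?m k)\<bar>)" by (rule sum_abs)
    also have "\<dots> \<le> (\<Sum>k\<in>?H. 4 * real b + (real w + 7/2) * (real b)\<^sup>2 * (1 / (real k)\<^sup>2))"
    proof (rule sum_mono)
      fix k assume k: "k \<in> ?H"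
      note hr = half_range[OF k b]
      have "\<bar>cotpi (real k / real b)\<bar> \<le> 1 / (pi * (real k / real b))" using cotpi_le[OF hr(1,2)] cotpi_nonneg[of "real k / real b"] hr by simp
      also have "\<dots> \<le> 1 / (2 * (real k / real b))" using hr pi_ge_two b by (intro divide_left_mono mult_right_mono) auto
      finally have c: "\<bar>cotpi (real k / real b)\<bar> \<le> real b / (2 * real k)" by simp
      have "\<bar>cotpi (real k / real b) * (?C k + (real b / real k) * g k b - ?m k)\<bar>
         \<le> real b / (2 * real k) * (8 * real k + (2 * real w + 7) * (real b / real k))"
        unfolding abs_mult by (intro mult_mono c rec k) auto
      also have "\<dots> = 4 * real b + (real w + 7/2) * (real b)\<^sup>2 * (1 / (real k)\<^sup>2)"
        using hr by (simp add: field_simps power2_eq_square)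
      finally show "\<bar>cotpi (real k / real b) * (?C k + (real b / real k) * g k b - ?m k)\<bar> \<le> 4 * real b + (real w + 7/2) * (real b)\<^sup>2 * (1 / (real k)\<^sup>2)" .
    qed
    finally show ?thesis using b by (simp add: abs_divide divide_right_mono)
  qed
  also have "\<dots> = (real ((b - 1) div 2) * (4 * real b) + (real w + 7/2) * (real b)\<^sup>2 * (\<Sum>k\<in>?H. 1 / (real k)\<^sup>2)) / (2 * b)"
    by (simp only: sum.distrib sum_distrib_left[symmetric] sum_constant card_atLeastAtMost) simp
  also have "\<dots> \<le> (real b / 2 * (4 * real b) + (real w + 7/2) * (real b)\<^sup>2 * 2) / (2 * b)"
  proof (intro divide_right_mono add_mono mult_left_mono mult_right_mono)
    show "real ((b - 1) div 2) \<le> real b / 2" by linarith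
    have "0 \<le> (if (b - 1) div 2 = 0 then 2 else 1 / real ((b - 1) div 2))" by simp
    then show "(\<Sum>k\<in>?H. 1 / (real k)\<^sup>2) \<le> 2" using sum_inverse_squares_le[of "(b - 1) div 2"] by linarith
  qed auto
  also have "\<dots> \<le> (real w + 6) * b" using b by (simp add: field_simps power2_eq_square)
  finally show ?thesis unfolding eq .
qed

text \<open>The cancellation takes place in b, so the summations are exchanged; each k \<le> Q then
  contributes at most 80 Q, and the factor 1/2 in \<open>R\<close> leaves 40 Q^2.\<close>

lemma sum_R_le: "\<bar>\<Sum>b\<in>{1..Q}. R b\<bar> \<le> 40 * (real Q)\<^sup>2"
proof -
  have "R b = - (\<Sum>k\<in>{1..Q}. if 2 * k + 1 \<le> b then cotpi (real k / real b) * g k b / real k else 0) / 2" if "b \<in> {1..Q}" for b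
  proof -
    have "(\<Sum>k\<in>{1..(b - 1) div 2}. cotpi (real k / real b) * g k b / real k) = (\<Sum>k\<in>{1..Q}. if 2 * k + 1 \<le> b then cotpi (real k / real b) * g k b / real k else 0)"
      using that by (intro sum.mono_neutral_cong_left) auto
    then show ?thesis by (simp only: R_def)
  qed
  then have "(\<Sum>b\<in>{1..Q}. R b) = (\<Sum>b\<in>{1..Q}. - (\<Sum>k\<in>{1..Q}. if 2 * k + 1 \<le> b then cotpi (real k / real b) * g k b / real k else 0) / 2)"
    by (intro sum.cong refl)
  also have "\<dots> = - (\<Sum>b\<in>{1..Q}. \<Sum>k\<in>{1..Q}. if 2 * k + 1 \<le> b then cotpi (real k / real b) * g k b / real k else 0) / 2"
    by (simp only: sum_divide_distrib[symmetric] sum_negf)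
  also have "(\<Sum>b\<in>{1..Q}. \<Sum>k\<in>{1..Q}. if 2 * k + 1 \<le> b then cotpi (real k / real b) * g k b / real k else 0)
     = (\<Sum>k\<in>{1..Q}. (\<Sum>b\<in>{2*k+1..Q}. cotpi (real k / real b) * g k b) / real k)"
    unfolding sum_divide_distrib
  proof (subst sum.swap, rule sum.cong[OF refl])
    fix k
    show "(\<Sum>b\<in>{1..Q}. if 2 * k + 1 \<le> b then cotpi (real k / real b) * g k b / real k else 0)
        = (\<Sum>b\<in>{2*k+1..Q}. cotpi (real k / real b) * g k b / real k)"
      by (rule sum.mono_neutral_cong_right) auto
  qed
  finally have "\<bar>\<Sum>b\<in>{1..Q}. R b\<bar> = \<bar>\<Sum>k\<in>{1..Q}. (\<Sum>b\<in>{2*k+1..Q}. cotpi (real k / real b) * g k b) / real k\<bar> / 2"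
    by (simp only: abs_divide abs_minus_cancel abs_numeral)
  also have "\<dots> \<le> (\<Sum>k\<in>{1..Q}. \<bar>(\<Sum>b\<in>{2*k+1..Q}. cotpi (real k / real b) * g k b) / real k\<bar>) / 2"
    by (rule divide_right_mono[OF sum_abs]) simp
  also have "\<dots> \<le> (\<Sum>k\<in>{1..Q}. 80 * real Q) / 2"
  proof (intro divide_right_mono sum_mono)
    fix k assume k: "k \<in> {1..Q}"
    then have "\<bar>\<Sum>b\<in>{2*k+1..Q}. cotpi (real k / real b) * g k b\<bar> \<le> 80 * real k * real Q"
      unfolding g_def by (intro sum_cotpi_weighted_le) auto
    then show "\<bar>(\<Sum>b\<in>{2*k+1..Q}. cotpi (real k / real b) * g k b) / real k\<bar> \<le> 80 * real Q"
      using k by (simp add: abs_divide pos_divide_le_eq mult_ac)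
  qed simp
  finally show ?thesis by (simp add: power2_eq_square)
qed

text \<open>The multiples of w form the series over j \<le> n div w, scaled by 1/w^2. The rate 1/n
  matters, since the difference is later multiplied by ln b with n about b/2.\<close>

lemma sum_not_dvd_inverse_squares:
  "\<bar>(\<Sum>k\<in>{1..n}. if w dvd k then 0 else 1 / (real k)\<^sup>2) - pi\<^sup>2 / 6 * (1 - 1 / (real w)\<^sup>2)\<bar> \<le> 4 * real w / real (n + 1)"
proof -
  define S where "S n = (\<Sum>k\<in>{1..n}. 1 / (real k)\<^sup>2)" for n
  have "(\<Sum>k\<in>{1..n}. if w dvd k then 1 / (real k)\<^sup>2 else 0) = (\<Sum>k\<in>{k\<in>{1..n}. w dvd k}. 1 / (real k)\<^sup>2)"
    by (rule sum.mono_neutral_cong_right) auto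
  also have "\<dots> = (\<Sum>j\<in>{1..n div w}. 1 / (real (w * j))\<^sup>2)"
    by (rule sum.reindex_bij_witness[of _ "\<lambda>j. w * j" "\<lambda>k. k div w"])
      (use w in \<open>auto elim!: dvdE simp: Suc_le_eq less_eq_div_iff_mult_less_eq mult.commute div_le_mono\<close>)
  also have "\<dots> = S (n div w) / (real w)\<^sup>2" by (simp add: S_def power_mult_distrib sum_divide_distrib mult.commute)
  finally have m: "(\<Sum>k\<in>{1..n}. if w dvd k then 1 / (real k)\<^sup>2 else 0) = S (n div w) / (real w)\<^sup>2" .
  have split: "(\<Sum>k\<in>{1..n}. if w dvd k then 0 else 1 / (real k)\<^sup>2) + (\<Sum>k\<in>{1..n}. if w dvd k then 1 / (real k)\<^sup>2 else 0) = S n"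
    unfolding S_def sum.distrib[symmetric] by (intro sum.cong) auto
  have e: "(\<Sum>k\<in>{1..n}. if w dvd k then 0 else 1 / (real k)\<^sup>2) - pi\<^sup>2 / 6 * (1 - 1 / (real w)\<^sup>2) =
     (pi\<^sup>2 / 6 - S (n div w)) / (real w)\<^sup>2 - (pi\<^sup>2 / 6 - S n)"
  proof -
    have "(\<Sum>k\<in>{1..n}. if w dvd k then 0 else 1 / (real k)\<^sup>2) = S n - S (n div w) / (real w)\<^sup>2"
      using split unfolding m by linarith
    then show ?thesis by (simp add: right_diff_distrib diff_divide_distrib)
  qed
  have t1: "0 \<le> pi\<^sup>2 / 6 - S n" "pi\<^sup>2 / 6 - S n \<le> 2 / real (n + 1)" using inverse_squares_tail[of n] by (auto simp: S_def)
  have t2: "0 \<le> pi\<^sup>2 / 6 - S (n div w)" "pi\<^sup>2 / 6 - S (n div w) \<le> 2 / real (n div w + 1)" using inverse_squares_tail[where n = "n div w"] by (auto simp: S_def)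
  have "real (n + 1) \<le> real w * real (n div w + 1)"
  proof -
    have "n + 1 \<le> w * (n div w + 1)" using dividend_less_div_times[of w n] w by (simp add: algebra_simps)
    then show ?thesis by (metis of_nat_le_iff of_nat_mult)
  qed
  then have "2 / real (n div w + 1) \<le> 2 * real w / real (n + 1)" by (simp add: field_simps)
  moreover have "(pi\<^sup>2 / 6 - S (n div w)) / (real w)\<^sup>2 \<le> pi\<^sup>2 / 6 - S (n div w)"
    using t2 w by (simp add: divide_le_eq mult_le_cancel_left1)
  moreover have "2 / real (n + 1) \<le> 2 * real w / real (n + 1)" using w by (intro divide_right_mono) auto
  moreover have "0 \<le> (pi\<^sup>2 / 6 - S (n div w)) / (real w)\<^sup>2" using t2 by simp
  moreover have "\<bar>x - y\<bar> \<le> 2 * c" if "0 \<le> x" "x \<le> c" "0 \<le> y" "y \<le> c" for x y c :: real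
    using that by linarith
  ultimately have "\<bar>(pi\<^sup>2 / 6 - S (n div w)) / (real w)\<^sup>2 - (pi\<^sup>2 / 6 - S n)\<bar> \<le> 2 * (2 * real w / real (n + 1))"
    using t1 t2 by (meson order_trans)
  then show ?thesis unfolding e by simp
qed

text \<open>cot (pi k / b) is replaced by b/(pi k), and ln (b/k) is split into ln b - ln k. The
  first part yields b ln b / (2 pi^2) times the sum of 1/k^2 over k not divisible by w, which is
  \<kappa> b ln b up to O(b); the second is O(b) because ln k / k^2 is summable.\<close>

lemma main_approx: "\<exists>C. \<forall>b>0. \<bar>main b - \<kappa> * b * ln b\<bar> \<le> C * b"
proof -
  obtain K where K: "\<And>n. (\<Sum>k\<in>{1..n}. ln (real k) / (real k)\<^sup>2) \<le> K" using sum_ln_over_squares_bounded by blast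
  have "\<bar>main b - \<kappa> * b * ln b\<bar> \<le> (2 + K + 8 * w) * b" if b: "b > 0" for b
  proof -
    let ?H = "{1..(b - 1) div 2}"
    let ?m' = "\<lambda>k. if w dvd k then 0 else (b / (pi * k)) * ln (real b / real k) / real k"
    let ?m = "\<lambda>k. if w dvd k then 0 else cotpi (real k / real b) * ln (real b / real k) / real k"
    have sq: "(\<Sum>k\<in>?H. 1 / (real k)\<^sup>2) \<le> 2"
    proof -
      have "0 \<le> (if (b - 1) div 2 = 0 then 2 else 1 / real ((b - 1) div 2))" by simp
      then show ?thesis using sum_inverse_squares_le[of "(b - 1) div 2"] by linarith
    qed
    have lb: "0 \<le> ln (real b)" "ln (real b) \<le> b" using b ln_le_minus_one[of "real b"] by auto
    have "\<bar>(\<Sum>k\<in>?H. ?m k) - (\<Sum>k\<in>?H. ?m' k)\<bar> \<le> (\<Sum>k\<in>?H. \<bar>?m k - ?m' k\<bar>)"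
      unfolding sum_subtractf[symmetric] by (rule sum_abs)
    also have "\<dots> \<le> (\<Sum>k\<in>?H. b * (1 / (real k)\<^sup>2))"
    proof (rule sum_mono)
      fix k assume k: "k \<in> ?H"
      note hr = half_range[OF k b]
      have "\<bar>cotpi (real k / real b) - b / (pi * k)\<bar> \<le> 1" using cotpi_le[OF hr(1,2)] cotpi_ge[OF hr(1,2)] by (simp add: abs_le_iff)
      moreover have l: "0 \<le> ln (real b / real k)" "ln (real b / real k) \<le> real b / real k"
      proof -
        show "0 \<le> ln (real b / real k)" using hr(3) by (intro ln_ge_zero) linarith
        have "0 < real b / real k" using hr(3) by linarith
        from ln_le_minus_one[OF this] show "ln (real b / real k) \<le> real b / real k" by linarith
      qed
      ultimately have "\<bar>cotpi (real k / real b) - b / (pi * k)\<bar> * (ln (real b / real k) / real k) \<le> 1 * ((real b / real k) / real k)"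
        using hr by (intro mult_mono divide_right_mono) auto
      moreover have "\<bar>cotpi (real k / real b) * ln (real b / real k) / real k - (b / (pi * k)) * ln (real b / real k) / real k\<bar>
         = \<bar>cotpi (real k / real b) - b / (pi * k)\<bar> * (ln (real b / real k) / real k)"
      proof -
        have "cotpi (real k / real b) * ln (real b / real k) / real k - (b / (pi * k)) * ln (real b / real k) / real k
          = (cotpi (real k / real b) - b / (pi * k)) * (ln (real b / real k) / real k)" by (simp add: left_diff_distrib diff_divide_distrib)
        then show ?thesis using l by (simp only: abs_mult) simp
      qed
      ultimately show "\<bar>?m k - ?m' k\<bar> \<le> b * (1 / (real k)\<^sup>2)" by (auto simp: power2_eq_square)
    qed
    also have "\<dots> = b * (\<Sum>k\<in>?H. 1 / (real k)\<^sup>2)" by (simp only: sum_distrib_left)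
    also have "\<dots> \<le> real b * 2" using sq by (intro mult_left_mono) auto
    finally have d1: "\<bar>(\<Sum>k\<in>?H. ?m k) - (\<Sum>k\<in>?H. ?m' k)\<bar> \<le> 2 * b" by simp
    let ?A = "\<Sum>k\<in>?H. if w dvd k then 0 else 1 / (real k)\<^sup>2"
    let ?B = "\<Sum>k\<in>?H. if w dvd k then 0 else ln (real k) / (real k)\<^sup>2"
    have e: "(\<Sum>k\<in>?H. ?m' k) = b / pi * (ln b * ?A - ?B)"
    proof -
      have "?m' k = b / pi * (ln b * (if w dvd k then 0 else 1 / (real k)\<^sup>2) - (if w dvd k then 0 else ln (real k) / (real k)\<^sup>2))" if "k \<in> ?H" for k
        using half_range[OF that b] b by (simp add: ln_div power2_eq_square right_diff_distrib diff_divide_distrib mult_ac)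
      then have "(\<Sum>k\<in>?H. ?m' k) = (\<Sum>k\<in>?H. b / pi * (ln b * (if w dvd k then 0 else 1 / (real k)\<^sup>2) - (if w dvd k then 0 else ln (real k) / (real k)\<^sup>2)))"
        by (intro sum.cong refl)
      then show ?thesis by (simp only: sum_distrib_left[symmetric] sum_subtractf)
    qed
    have B: "0 \<le> ?B" "?B \<le> K"
    proof -
      show "0 \<le> ?B" by (intro sum_nonneg) auto
      have "?B \<le> (\<Sum>k\<in>?H. ln (real k) / (real k)\<^sup>2)" by (intro sum_mono) auto
      then show "?B \<le> K" using K[of "(b - 1) div 2"] by linarith
    qed
    \<comment> \<open>A remainder of order w/b in the series against the crude ln b \<le> b.\<close>
    have A: "\<bar>ln b * ?A - ln b * (pi\<^sup>2 / 6 * (1 - 1 / (real w)\<^sup>2))\<bar> \<le> 8 * w"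
    proof -
      have "\<bar>ln b * ?A - ln b * (pi\<^sup>2 / 6 * (1 - 1 / (real w)\<^sup>2))\<bar> = ln b * \<bar>?A - pi\<^sup>2 / 6 * (1 - 1 / (real w)\<^sup>2)\<bar>"
        unfolding right_diff_distrib[symmetric] abs_mult using lb by simp
      also have "\<dots> \<le> b * (4 * real w / real ((b - 1) div 2 + 1))"
        using lb by (intro mult_mono sum_not_dvd_inverse_squares) auto
      also have "\<dots> \<le> b * (4 * real w / (b / 2))"
      proof (intro mult_left_mono divide_left_mono)
        show "real b / 2 \<le> real ((b - 1) div 2 + 1)" by linarith
      qed (use b in auto)
      also have "\<dots> = 8 * w" using b by simp
      finally show ?thesis .
    qed
    have "main b - \<kappa> * b * ln b = ((\<Sum>k\<in>?H. ?m k) - (\<Sum>k\<in>?H. ?m' k)) / (2 * pi)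
       + b / (2 * pi\<^sup>2) * ((ln b * ?A - ln b * (pi\<^sup>2 / 6 * (1 - 1 / (real w)\<^sup>2))) - ?B)"
    proof -
      have p: "pi \<noteq> 0" by simp
      have "b / (2 * pi\<^sup>2) * ((ln b * ?A - ln b * (pi\<^sup>2 / 6 * (1 - 1 / (real w)\<^sup>2))) - ?B) = b / pi * (ln b * ?A - ?B) / (2 * pi) - \<kappa> * b * ln b"
        unfolding \<kappa>_def using p by (simp add: power2_eq_square divide_simps) (simp add: algebra_simps)
      then show ?thesis unfolding main_def e by (simp add: diff_divide_distrib)
    qed
    then have "\<bar>main b - \<kappa> * b * ln b\<bar> \<le> \<bar>(\<Sum>k\<in>?H. ?m k) - (\<Sum>k\<in>?H. ?m' k)\<bar> / (2 * pi) + b / (2 * pi\<^sup>2) * \<bar>(ln b * ?A - ln b * (pi\<^sup>2 / 6 * (1 - 1 / (real w)\<^sup>2))) - ?B\<bar>"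
      by (simp only:) (rule order_trans[OF abs_triangle_ineq], simp add: abs_mult abs_divide)
    also have "\<dots> \<le> 2 * real b / 1 + real b / 1 * (8 * real w + K)"
    proof (rule add_mono)
      have "1 \<le> 2 * pi" using pi_ge_two by linarith
      then show "\<bar>(\<Sum>k\<in>?H. ?m k) - (\<Sum>k\<in>?H. ?m' k)\<bar> / (2 * pi) \<le> 2 * real b / 1"
        using d1 by (intro frac_le) linarith+
      have "1 \<le> 2 * pi\<^sup>2" using power_mono[OF pi_ge_two, of 2] by simp
      then have "real b / (2 * pi\<^sup>2) \<le> real b / 1" by (intro divide_left_mono) auto
      moreover have "\<bar>(ln b * ?A - ln b * (pi\<^sup>2 / 6 * (1 - 1 / (real w)\<^sup>2))) - ?B\<bar> \<le> 8 * real w + K" using A B by linarith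
      ultimately show "real b / (2 * pi\<^sup>2) * \<bar>(ln b * ?A - ln b * (pi\<^sup>2 / 6 * (1 - 1 / (real w)\<^sup>2))) - ?B\<bar> \<le> real b / 1 * (8 * real w + K)"
        by (rule mult_mono) (simp_all only: abs_ge_zero of_nat_0_le_iff div_by_1)
    qed
    also have "\<dots> = (2 + K + 8 * w) * b" by (simp add: algebra_simps)
    finally show ?thesis .
  qed
  then show ?thesis by blast
qed

text \<open>The main term is kept as \<kappa> ln Q times the number of pairs, to match the dilated
  Farey counts exactly. Replacing ln b by ln Q costs b ln (Q/b) \<le> Q for each b.\<close>

lemma sum_T_approx: "\<exists>C. \<forall>Q>0. \<bar>(\<Sum>b\<in>{1..Q}. T b) - \<kappa> * ln Q * (\<Sum>b\<in>{1..Q}. real b)\<bar> \<le> C * (real Q)\<^sup>2"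
proof -
  obtain C where C: "\<And>b. b > 0 \<Longrightarrow> \<bar>main b - \<kappa> * b * ln b\<bar> \<le> C * real b" using main_approx by blast
  have k0: "0 \<le> \<kappa>" "\<kappa> \<le> 1" using w by (auto simp: \<kappa>_def field_simps)
  have C0: "C \<ge> 0" using C[of 1] by (simp add: abs_le_iff) 
  have "\<bar>(\<Sum>b\<in>{1..Q}. T b) - \<kappa> * ln Q * (\<Sum>b\<in>{1..Q}. real b)\<bar> \<le> (C + w + 6 + 40 + 1) * (real Q)\<^sup>2" if Q: "Q > 0" for Q
  proof -
    have "(\<Sum>b\<in>{1..Q}. T b) - \<kappa> * ln Q * (\<Sum>b\<in>{1..Q}. real b) =
      (\<Sum>b\<in>{1..Q}. T b - R b - main b) + (\<Sum>b\<in>{1..Q}. R b) + (\<Sum>b\<in>{1..Q}. main b - \<kappa> * b * ln b) - (\<Sum>b\<in>{1..Q}. \<kappa> * b * (ln Q - ln b))"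
      by (simp add: sum.distrib sum_subtractf sum_distrib_left algebra_simps)
    moreover have "\<bar>\<Sum>b\<in>{1..Q}. T b - R b - main b\<bar> \<le> (\<Sum>b\<in>{1..Q}. (w + 6) * real Q)"
      by (rule sum_abs[THEN order_trans], rule sum_mono, rule order_trans[OF T_approx]) (auto intro!: mult_left_mono)
    moreover have "\<bar>\<Sum>b\<in>{1..Q}. main b - \<kappa> * b * ln b\<bar> \<le> (\<Sum>b\<in>{1..Q}. C * real Q)"
      by (rule sum_abs[THEN order_trans], rule sum_mono, rule order_trans[OF C]) (auto intro!: mult_left_mono C0)
    moreover have "\<bar>\<Sum>b\<in>{1..Q}. \<kappa> * b * (ln Q - ln b)\<bar> \<le> (\<Sum>b\<in>{1..Q}. real Q)"
    proof (rule sum_abs[THEN order_trans], rule sum_mono)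
      fix b assume b: "b \<in> {1..Q}"
      have "ln Q - ln b = ln (real Q / real b)" using b Q by (simp add: ln_div)
      also have "\<dots> \<le> real Q / real b" using ln_le_minus_one[of "real Q / real b"] b Q by simp
      finally have "\<kappa> * (b * (ln Q - ln b)) \<le> 1 * (b * (real Q / real b))" using k0 b Q by (intro mult_mono mult_left_mono) auto
      moreover have "0 \<le> \<kappa> * (b * (ln Q - ln b))" using k0 b Q by (intro mult_nonneg_nonneg) auto
      ultimately show "\<bar>\<kappa> * b * (ln Q - ln b)\<bar> \<le> real Q" using b by (simp add: mult.assoc)
    qed
    ultimately show ?thesis using sum_R_le[of Q] by (simp add: power2_eq_square algebra_simps)
  qed
  then show ?thesis by blast
qed

end

section \<open>Farey fractions\<close>

text \<open>For n = r + q b the second factor depends on r only, and summing the first over q is the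
  multiplication formula of the sawtooth. This allows unreduced pairs in place of reduced
  fractions.\<close>

lemma dedekind_sum_scale:
  assumes k: "k > 0" and b: "b > 0"
  shows "dedekind_sum (int k * a) (int (k * b)) = dedekind_sum a (int b)"
proof -
  let ?s = "\<lambda>r. sawtooth (real r * of_int a / real b)"
  let ?F = "\<lambda>n. sawtooth (real n / real (k * b)) * sawtooth (real n * of_int (int k * a) / real (k * b))"
  have blk: "(\<Sum>n\<in>{q * b..<q * b + b}. ?F n) = (\<Sum>r<b. sawtooth (real r / real (k * b) + real q / real k) * ?s r)" for q
  proof (rule sum.reindex_bij_witness[of _ "\<lambda>r. r + q * b" "\<lambda>n. n - q * b"])
    fix n assume n: "n \<in> {q * b..<q * b + b}"
    define r where "r = n - q * b"
    have nr: "n = r + q * b" using n by (simp add: r_def)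
    have "real n / real (k * b) = real r / real (k * b) + real q / real k" using k b by (simp add: nr field_simps)
    moreover have "real n * of_int (int k * a) / real (k * b) = real r * of_int a / real b + of_int (int q * a)"
      using k b by (simp add: nr field_simps)
    ultimately show "sawtooth (real (n - q * b) / real (k * b) + real q / real k) * ?s (n - q * b) = ?F n"
      unfolding r_def[symmetric] by (simp only: sawtooth_add_int)
  qed auto
  have "dedekind_sum (int k * a) (int (k * b)) = (\<Sum>n<k * b. ?F n)"
    using k b by (intro dedekind_sum_nat) auto
  also have "\<dots> = (\<Sum>q<k. \<Sum>n\<in>{q * b..<q * b + b}. ?F n)" by (rule sum.nat_group[symmetric])
  also have "\<dots> = (\<Sum>r<b. (\<Sum>q<k. sawtooth (real r / real (k * b) + real q / real k)) * ?s r)"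
    unfolding blk sum_distrib_right by (rule sum.swap)
  also have "\<dots> = (\<Sum>r<b. sawtooth (real r / real b) * ?s r)"
    using k by (simp add: sawtooth_multiplication)
  also have "\<dots> = dedekind_sum a (int b)" using dedekind_sum_nat[OF b] by simp
  finally show ?thesis .
qed

lemma quotient_of_coprime_divide:
  assumes "q > 0" "coprime p q"
  shows "quotient_of (of_int p / of_int q) = (p, q)"
  using assms by (simp add: quotient_of_Fract normalize_stable flip: Fract_of_int_quotient)

lemma dedekind_rat_divide:
  assumes b: "b > 0"
  shows "dedekind_rat (of_int a / of_int (int b)) = dedekind_sum a (int b)"
proof -
  obtain p q where pq: "a = p * gcd a (int b)" "int b = q * gcd a (int b)" "coprime p q"
    using gcd_coprime_exists[of a "int b"] b by auto
  define g where "g = nat (gcd a (int b))"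
  have g: "int g = gcd a (int b)" "g > 0" using b by (auto simp: g_def)
  have q: "q > 0" using pq(2) b g by (metis of_nat_0_less_iff zero_less_mult_pos2)
  define n where "n = nat q"
  have n: "q = int n" "n > 0" using q by (auto simp: n_def)
  have ap: "a = p * int g" unfolding g(1) by (rule pq(1))
  have bn: "b = n * g" using pq(2) unfolding g(1)[symmetric] n(1) by (metis of_nat_eq_iff of_nat_mult)
  have "of_int a / of_int (int b) = (of_int p / of_int q :: rat)" using g n by (simp add: ap bn)
  then have "dedekind_rat (of_int a / of_int (int b)) = dedekind_sum p q"
    using quotient_of_coprime_divide[OF q pq(3)] by (simp add: dedekind_rat_def)
  also have "\<dots> = dedekind_sum (int g * p) (int (g * n))"
    using dedekind_sum_scale[of g n p] g n by simp
  also have "\<dots> = dedekind_sum a (int b)" by (simp add: ap bn mult.commute)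
  finally show ?thesis .
qed

section \<open>Farey fractions against all pairs\<close>

lemma finite_farey: "finite (farey n)"
proof (rule finite_subset)
  show "farey n \<subseteq> (\<lambda>(a, b). of_int a / of_int b) ` ({0..int n} \<times> {1..int n})"
  proof
    fix x :: rat assume "x \<in> farey n"
    then obtain a b where ab: "x = of_int a / of_int b" "1 \<le> b" "b \<le> int n" "0 \<le> x" "x \<le> 1" by (auto simp: farey_def)
    have "0 \<le> (of_int a / of_int b :: rat)" "(of_int a / of_int b :: rat) \<le> 1" using ab by simp_all
    then have "0 \<le> a" "a \<le> b" using ab(2) by (simp_all add: zero_le_divide_iff divide_le_eq_1)
    then show "x \<in> (\<lambda>(a, b). of_int a / of_int b) ` ({0..int n} \<times> {1..int n})" using ab by force
  qed
qed simp

lemma finite_farey_below: "finite (farey_below \<alpha> n)"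
  unfolding farey_below_def by (rule finite_subset[OF _ finite_farey]) auto

text \<open>The reduced denominator divides every other one, so membership, defined by the existence
  of some small denominator, can be tested on q.\<close>

lemma farey_below_divide_iff:
  assumes "\<alpha> \<le> 1" "q > 0" "coprime p q"
  shows "of_int p / of_int q \<in> farey_below \<alpha> n \<longleftrightarrow> 0 \<le> p \<and> of_int p < \<alpha> * of_int q \<and> q \<le> int n"
proof -
  have r: "real_of_rat (of_int p / of_int q) = of_int p / of_int q" by (simp add: of_rat_divide)
  have 1: "of_int p / of_int q \<in> farey n" if "0 \<le> p" "of_int p < \<alpha> * real_of_int q" "q \<le> int n"
  proof -
    have "\<alpha> * real_of_int q \<le> 1 * real_of_int q" using assms by (intro mult_right_mono) auto
    then have "p < q" using that by linarith
    then have "(0::rat) \<le> of_int p / of_int q" "of_int p / of_int q \<le> (1::rat)"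
      using that assms by (simp_all add: zero_le_divide_iff divide_le_eq_1)
    moreover have "1 \<le> q" using assms by simp
    ultimately show ?thesis using that(3) unfolding farey_def by (intro IntI CollectI exI[of _ p] exI[of _ q]) auto
  qed
  have 2: "q \<le> int n" if "of_int p / of_int q \<in> farey n"
  proof -
    have "\<exists>a b. of_int p / of_int q = (of_int a / of_int b :: rat) \<and> 1 \<le> b \<and> b \<le> int n"
      using that unfolding farey_def by (elim IntE CollectE)
    then obtain a b where ab: "of_int p / of_int q = (of_int a / of_int b :: rat)" "1 \<le> b" "b \<le> int n"
      by metis
    then have "(of_int (p * b) :: rat) = of_int (a * q)" using assms by (simp add: field_simps)
    then have "p * b = a * q" by (simp only: of_int_eq_iff)
    then have "q dvd p * b" by simp
    then have "q dvd b" using assms(3) by (simp add: coprime_commute coprime_dvd_mult_right_iff)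
    then show ?thesis using ab by (auto dest: zdvd_imp_le)
  qed
  have 3: "0 \<le> real_of_int p / of_int q \<longleftrightarrow> 0 \<le> p" "real_of_int p / of_int q < \<alpha> \<longleftrightarrow> of_int p < \<alpha> * of_int q"
    using assms by (auto simp: field_simps zero_le_divide_iff)
  show ?thesis using 1 2 unfolding farey_below_def mem_Collect_eq atLeastLessThan_iff r 3 by blast
qed

text \<open>A pair \<^term>\<open>(a, b)\<close> is \<^term>\<open>k\<close> times a reduced fraction of denominator at most \<^term>\<open>Q div k\<close>, where \<^term>\<open>k = gcd a b\<close>.\<close>

lemma sum_farey_below_dilates:
  fixes f :: "rat \<Rightarrow> real"
  assumes \<alpha>: "0 < \<alpha>" "\<alpha> \<le> 1"
  shows "(\<Sum>k\<in>{1..Q}. \<Sum>x\<in>farey_below \<alpha> (Q div k). f x) =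
    (\<Sum>b\<in>{1..Q}. \<Sum>a\<in>{0..<\<lceil>\<alpha> * real b\<rceil>}. f (of_int a / of_int (int b)))"
proof -
  let ?A = "SIGMA k:{1..Q}. farey_below \<alpha> (Q div k)"
  let ?B = "SIGMA b:{1..Q}. {0..<\<lceil>\<alpha> * real b\<rceil>}"
  let ?j = "\<lambda>(k, x). (k * nat (snd (quotient_of x)), int k * fst (quotient_of x))"
  let ?i = "\<lambda>(b, a). (nat (gcd a (int b)), of_int a / of_int (int b) :: rat)"
  have "(\<Sum>(k, x)\<in>?A. f x) = (\<Sum>(b, a)\<in>?B. f (of_int a / of_int (int b)))"
  proof (rule sum.reindex_bij_witness[of _ ?i ?j])
    fix y assume y: "y \<in> ?A"
    obtain k x where kx: "y = (k, x)" by (cases y)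
    obtain p q where pq: "quotient_of x = (p, q)" by (cases "quotient_of x")
    have q: "q > 0" "coprime p q" and x: "x = of_int p / of_int q"
      using pq quotient_of_denom_pos quotient_of_coprime quotient_of_div by auto
    have k: "k \<ge> 1" "k \<le> Q" and xF: "of_int p / of_int q \<in> farey_below \<alpha> (Q div k)" using y by (auto simp: kx x)
    have F: "0 \<le> p" "of_int p < \<alpha> * of_int q" "q \<le> int (Q div k)"
      using xF unfolding farey_below_divide_iff[OF \<alpha>(2) q] by auto
    define n where "n = nat q"
    have n: "q = int n" "n > 0" using q by (auto simp: n_def)
    have j: "?j y = (k * n, int k * p)" by (simp add: kx pq n_def)
    have "n \<le> Q div k" using F n by simp
    then have "k * n \<le> Q" using k by (simp add: less_eq_div_iff_mult_less_eq mult.commute)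
    moreover have "real_of_int (int k * p) < \<alpha> * real (k * n)"
    proof -
      have "real k * of_int p < real k * (\<alpha> * of_int q)" using F k by (intro mult_strict_left_mono) auto
      then show ?thesis using n by (simp add: mult.left_commute)
    qed
    ultimately show "?j y \<in> ?B" unfolding j using k n F by (simp add: less_ceiling_iff Suc_le_eq)
    have e: "of_int (int k * p) / of_int (int (k * n)) = x" using k n by (simp add: x)
    have "gcd (int k * p) (int (k * n)) = int k"
      using q n by (simp add: gcd_mult_left)
    then show "?i (?j y) = y" unfolding j using e by (simp add: kx)
    show "(case ?j y of (b, a) \<Rightarrow> f (of_int a / of_int (int b))) = (case y of (k, x) \<Rightarrow> f x)"
      unfolding j using e by (simp add: kx)
  next
    fix y assume y: "y \<in> ?B"
    obtain b a where ba: "y = (b, a)" by (cases y)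
    have b: "1 \<le> b" "b \<le> Q" and a: "0 \<le> a" "of_int a < \<alpha> * real b" using y by (auto simp: ba less_ceiling_iff)
    obtain p q where pq: "a = p * gcd a (int b)" "int b = q * gcd a (int b)" "coprime p q"
      using gcd_coprime_exists[of a "int b"] b by auto
    define g where "g = nat (gcd a (int b))"
    have g: "int g = gcd a (int b)" "g > 0" using b by (auto simp: g_def)
    have "b > 0" using b by simp
    then have q: "q > 0" using pq(2) g by (metis of_nat_0_less_iff zero_less_mult_pos2)
    define n where "n = nat q"
    have n: "q = int n" "n > 0" using q by (auto simp: n_def)
    have ap: "a = p * int g" unfolding g(1) by (rule pq(1))
    have bn: "b = n * g" using pq(2) unfolding g(1)[symmetric] n(1) by (metis of_nat_eq_iff of_nat_mult)
    have e: "of_int a / of_int (int b) = (of_int p / of_int q :: rat)" using g n by (simp add: ap bn)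
    have i: "?i y = (g, of_int p / of_int q)" using e by (simp add: ba g_def)
    show "?j (?i y) = y" unfolding i using quotient_of_coprime_divide[OF q pq(3)] by (simp add: ba ap bn n)
    have "g \<le> b" using bn n by simp
    moreover have "n \<le> Q div g" using bn b g by (simp add: less_eq_div_iff_mult_less_eq)
    moreover have "0 \<le> p" using a g unfolding ap by (simp add: zero_le_mult_iff)
    moreover have "of_int p < \<alpha> * of_int q"
    proof -
      have "of_int p * real g < \<alpha> * of_int q * real g" using a(2) by (simp add: ap bn n mult_ac)
      then show ?thesis using g by simp
    qed
    ultimately have "of_int p / of_int q \<in> farey_below \<alpha> (Q div g)"
      unfolding farey_below_divide_iff[OF \<alpha>(2) q pq(3)] using n by simp
    then show "?i y \<in> ?A" unfolding i using g b \<open>g \<le> b\<close> by simp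
  qed
  then show ?thesis by (simp add: sum.Sigma finite_farey_below)
qed

lemma sum_inverse_squares_from_2: "(\<Sum>k\<in>{2..Q}. 1 / (real k)\<^sup>2) \<le> 3/4"
proof (cases "2 \<le> Q")
  case True
  then have "(\<Sum>k\<in>{2..Q}. 1 / (real k)\<^sup>2) = 1/4 + (\<Sum>k\<in>{2+1..Q}. 1 / (real k)\<^sup>2)"
    by (subst sum.atLeast_Suc_atMost) auto
  also have "(\<Sum>k\<in>{2+1..Q}. 1 / (real k)\<^sup>2) \<le> 1 / real 2" by (rule sum_inverse_squares_tail_le) simp
  finally show ?thesis by simp
qed auto

lemma sum_split_first: "Q > 0 \<Longrightarrow> (\<Sum>k\<in>{1..Q}. F (Q div k)) = F Q + (\<Sum>k\<in>{2..Q}. F (Q div k :: nat) :: real)"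
  by (subst sum.atLeast_Suc_atMost) (auto simp: numeral_2_eq_2)

text \<open>This replaces Moebius inversion: the terms with \<^term>\<open>k \<ge> 2\<close> can be absorbed because
  the sum of \<^term>\<open>1 / k^2\<close> over \<^term>\<open>k \<ge> 2\<close> is less than \<^term>\<open>1\<close>.\<close>

lemma dilate_sum_inversion:
  fixes \<Delta> :: "nat \<Rightarrow> real"
  assumes C: "\<And>Q. Q > 0 \<Longrightarrow> \<bar>\<Sum>k\<in>{1..Q}. \<Delta> (Q div k)\<bar> \<le> C * (real Q)\<^sup>2" and "Q > 0"
  shows "\<bar>\<Delta> Q\<bar> \<le> 4 * C * (real Q)\<^sup>2"
  using \<open>Q > 0\<close>
proof (induction Q rule: less_induct)
  case (less Q)
  have C0: "C \<ge> 0" using C[of 1] by simp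
  have "\<bar>\<Sum>k\<in>{2..Q}. \<Delta> (Q div k)\<bar> \<le> (\<Sum>k\<in>{2..Q}. \<bar>\<Delta> (Q div k)\<bar>)" by (rule sum_abs)
  \<comment> \<open>The constant 4 solves c = 1 + (3/4) c: the terms with k \<ge> 2 amount to at
    most 3 C, and the whole sum adds C.\<close>
  also have "\<dots> \<le> (\<Sum>k\<in>{2..Q}. 4 * C * (real Q)\<^sup>2 * (1 / (real k)\<^sup>2))"
  proof (rule sum_mono)
    fix k assume k: "k \<in> {2..Q}"
    have "\<bar>\<Delta> (Q div k)\<bar> \<le> 4 * C * (real (Q div k))\<^sup>2"
      using k by (intro less.IH) (auto simp: div_greater_zero_iff)
    also have "\<dots> \<le> 4 * C * (real Q / real k)\<^sup>2"
      using C0 by (intro mult_left_mono power_mono of_nat_div_le_of_nat) auto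
    finally show "\<bar>\<Delta> (Q div k)\<bar> \<le> 4 * C * (real Q)\<^sup>2 * (1 / (real k)\<^sup>2)" by (simp add: power_divide)
  qed
  also have "\<dots> = 4 * C * (real Q)\<^sup>2 * (\<Sum>k\<in>{2..Q}. 1 / (real k)\<^sup>2)" by (simp only: sum_distrib_left)
  also have "\<dots> \<le> 4 * C * (real Q)\<^sup>2 * (3/4)" using C0 by (intro mult_left_mono sum_inverse_squares_from_2) auto
  finally have "\<bar>\<Sum>k\<in>{2..Q}. \<Delta> (Q div k)\<bar> \<le> 3 * C * (real Q)\<^sup>2" by simp
  then show ?case using C[OF less.prems] sum_split_first[of Q \<Delta>] less.prems by (simp add: algebra_simps)
qed

lemma card_farey: "n > 0 \<Longrightarrow> card (farey n) = card (farey_below 1 n) + 1"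
proof -
  assume n: "n > 0"
  have "1 \<in> farey n" unfolding farey_def using n by (auto intro!: exI[of _ "1::int"])
  moreover have "1 \<notin> farey_below 1 n" by (simp add: farey_below_def)
  moreover have "x \<in> farey_below 1 n" if "x \<in> farey n" "x \<noteq> 1" for x
    using that by (auto simp: farey_below_def farey_def of_rat_less_1_iff)
  moreover have "farey_below 1 n \<subseteq> farey n" by (auto simp: farey_below_def)
  ultimately have "farey n = insert 1 (farey_below 1 n)" by auto
  then show ?thesis using \<open>1 \<notin> farey_below 1 n\<close> finite_farey_below by simp
qed

text \<open>Fractions in [0, 1) rather than [0, 1]: the pairs are then 0 \<le> a < b, exactly b of
  them for each b.\<close>

definition farey_count :: "nat \<Rightarrow> real" where "farey_count n = real (card (farey_below 1 n))"

lemma sum_farey_count: "(\<Sum>k\<in>{1..Q}. farey_count (Q div k)) = (\<Sum>b\<in>{1..Q}. real b)"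
  using sum_farey_below_dilates[of 1 "\<lambda>_. 1" Q] by (simp add: farey_count_def)

lemma sum_of_nat_atMost: "(\<Sum>b\<in>{1..Q}. real b) = real Q * (real Q + 1) / 2"
  by (induction Q) (auto simp: field_simps)

lemma farey_count_le:
  assumes "n > 0" shows "farey_count n \<le> real n * (real n + 1) / 2"
proof -
  have "0 \<le> (\<Sum>k\<in>{2..n}. farey_count (n div k))" by (intro sum_nonneg) (simp add: farey_count_def)
  then show ?thesis using sum_split_first[of n farey_count] sum_farey_count[of n] sum_of_nat_atMost[of n] assms by simp
qed

text \<open>Of about Q^2/2 pairs the dilates with k \<ge> 2 take at most (3/8) Q^2 + Q sqrt Q, and Q
  \<ge> 256 gives sqrt Q \<le> Q/16; what remains is 1/8 - 1/16. The order of magnitude suffices for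
  an O(1) statement.\<close>

lemma farey_count_ge:
  assumes Q: "Q \<ge> 256" shows "farey_count Q \<ge> (real Q)\<^sup>2 / 16"
proof -
  have "(\<Sum>k\<in>{2..Q}. farey_count (Q div k)) \<le> (\<Sum>k\<in>{2..Q}. (real Q)\<^sup>2 / 2 * (1 / (real k)\<^sup>2) + real Q / 2 * (1 / real k))"
  proof (rule sum_mono)
    fix k assume k: "k \<in> {2..Q}"
    define m where "m = real (Q div k)"
    have m: "0 \<le> m" "m \<le> real Q / real k" unfolding m_def by (auto simp: of_nat_div_le_of_nat)
    have "farey_count (Q div k) \<le> m * (m + 1) / 2"
      unfolding m_def using k by (intro farey_count_le) (auto simp: div_greater_zero_iff)
    also have "\<dots> \<le> (real Q / real k) * (real Q / real k + 1) / 2"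
      using m by (intro divide_right_mono mult_mono) auto
    also have "\<dots> = (real Q)\<^sup>2 / 2 * (1 / (real k)\<^sup>2) + real Q / 2 * (1 / real k)"
      using k by (simp add: field_simps power2_eq_square)
    finally show "farey_count (Q div k) \<le> (real Q)\<^sup>2 / 2 * (1 / (real k)\<^sup>2) + real Q / 2 * (1 / real k)" .
  qed
  also have "\<dots> = (real Q)\<^sup>2 / 2 * (\<Sum>k\<in>{2..Q}. 1 / (real k)\<^sup>2) + real Q / 2 * (\<Sum>k\<in>{2..Q}. 1 / real k)"
    by (simp only: sum.distrib sum_distrib_left)
  also have "\<dots> \<le> (real Q)\<^sup>2 / 2 * (3/4) + real Q / 2 * (2 * sqrt Q)"
  proof (intro add_mono mult_left_mono sum_inverse_squares_from_2)
    have "(\<Sum>k\<in>{2..Q}. 1 / real k) \<le> (\<Sum>k\<in>{1..Q}. 1 / real k)" by (intro sum_mono2) auto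
    then show "(\<Sum>k\<in>{2..Q}. 1 / real k) \<le> 2 * sqrt Q" using sum_inverse_le_sqrt[of Q] by linarith
  qed auto
  finally have u: "(\<Sum>k\<in>{2..Q}. farey_count (Q div k)) \<le> (real Q)\<^sup>2 / 2 * (3/4) + real Q / 2 * (2 * sqrt Q)" .
  have "sqrt 256 \<le> sqrt Q" using Q by (intro real_sqrt_le_mono) simp
  moreover have "sqrt 256 = (16::real)" by (rule real_sqrt_unique) auto
  ultimately have "16 * sqrt Q \<le> sqrt Q * sqrt Q" by (intro mult_right_mono) auto
  then have "16 * sqrt Q \<le> Q" by simp
  then have "real Q * (16 * sqrt Q) \<le> real Q * real Q" by (intro mult_left_mono) auto
  moreover have "farey_count Q = real Q * (real Q + 1) / 2 - (\<Sum>k\<in>{2..Q}. farey_count (Q div k))"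
    using sum_split_first[of Q farey_count] sum_farey_count[of Q] sum_of_nat_atMost[of Q] Q by simp
  ultimately show ?thesis using u by (simp add: power2_eq_square algebra_simps)
qed

theorem theorem1p1:
  fixes \<alpha> :: real and v w :: nat
  assumes "0 < v" and "0 < w" and "coprime v w"
    and "\<alpha> = real v / real w" and "\<alpha> \<in> {0<..1/2}"
  shows "(\<lambda>Q::nat. 1 / real (card (farey Q)) * (\<Sum>x\<in>farey_below \<alpha> Q. dedekind_rat x)
            - 1/12 * (1 - 1 / (real w)\<^sup>2) * ln (real Q)) \<in> O[at_top](\<lambda>_. 1 :: real)"
proof -
  have "\<alpha> \<le> 1" using assms(5) by auto
  then have "real v / real w \<le> 1" by (simp only: assms(4))
  then have "v \<le> w" using assms(2) by simp
  then interpret rational_cutoff v w using assms by unfold_locales auto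
  have \<alpha>_eq: "rational_cutoff.\<alpha> v w = \<alpha>" using assms(4) by (simp add: \<alpha>_def)
  have \<kappa>: "1/12 * (1 - 1 / (real w)\<^sup>2) = \<kappa>" by (simp add: \<kappa>_def)
  have k0: "0 \<le> \<kappa>" "\<kappa> \<le> 1" using w by (auto simp: \<kappa>_def field_simps)
  define S where "S n = (\<Sum>x\<in>farey_below \<alpha> n. dedekind_rat x)" for n
  \<comment> \<open>The deviation is taken from a multiple of the exact count. Its dilated sum is
    then the difference already estimated for pairs, up to the exchange of ln Q for ln (Q div
    k).\<close>
  define \<Delta> where "\<Delta> n = S n - \<kappa> * ln (real n) * farey_count n" for n
  obtain C where C: "\<And>Q. Q > 0 \<Longrightarrow> \<bar>(\<Sum>b\<in>{1..Q}. T b) - \<kappa> * ln Q * (\<Sum>b\<in>{1..Q}. real b)\<bar> \<le> C * (real Q)\<^sup>2"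
    using sum_T_approx by blast
  obtain K where K: "\<And>n. (\<Sum>k\<in>{1..n}. ln (real k) / (real k)\<^sup>2) \<le> K" using sum_ln_over_squares_bounded by blast
  have ST: "(\<Sum>k\<in>{1..Q}. S (Q div k)) = (\<Sum>b\<in>{1..Q}. T b)" for Q
  proof -
    have "(\<Sum>k\<in>{1..Q}. S (Q div k)) = (\<Sum>b\<in>{1..Q}. \<Sum>a\<in>{0..<\<lceil>\<alpha> * real b\<rceil>}. dedekind_rat (of_int a / of_int (int b)))"
      unfolding S_def using assms(5) by (intro sum_farey_below_dilates) auto
    also have "\<dots> = (\<Sum>b\<in>{1..Q}. T b)"
      unfolding T_def \<alpha>_eq by (intro sum.cong refl dedekind_rat_divide) auto
    finally show ?thesis .
  qed
  have \<Delta>S: "\<bar>\<Sum>k\<in>{1..Q}. \<Delta> (Q div k)\<bar> \<le> (C + 2 + K) * (real Q)\<^sup>2" if Q: "Q > 0" for Q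
  proof -
    let ?E = "\<lambda>k. \<kappa> * (ln (real Q) - ln (real (Q div k))) * farey_count (Q div k)"
    have "(\<Sum>k\<in>{1..Q}. \<Delta> (Q div k)) = (\<Sum>k\<in>{1..Q}. S (Q div k) - \<kappa> * ln Q * farey_count (Q div k) + ?E k)"
      unfolding \<Delta>_def by (intro sum.cong refl) (simp add: algebra_simps)
    also have "\<dots> = (\<Sum>k\<in>{1..Q}. S (Q div k)) - \<kappa> * ln Q * (\<Sum>k\<in>{1..Q}. farey_count (Q div k)) + (\<Sum>k\<in>{1..Q}. ?E k)"
      by (simp only: sum.distrib sum_subtractf sum_distrib_left)
    finally have e: "(\<Sum>k\<in>{1..Q}. \<Delta> (Q div k)) = ((\<Sum>b\<in>{1..Q}. T b) - \<kappa> * ln Q * (\<Sum>b\<in>{1..Q}. real b)) + (\<Sum>k\<in>{1..Q}. ?E k)"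
      unfolding ST sum_farey_count .
    have "\<bar>\<Sum>k\<in>{1..Q}. ?E k\<bar> \<le> (\<Sum>k\<in>{1..Q}. \<bar>?E k\<bar>)" by (rule sum_abs)
    also have "\<dots> \<le> (\<Sum>k\<in>{1..Q}. (real Q)\<^sup>2 * (1 / (real k)\<^sup>2 + ln (real k) / (real k)\<^sup>2))"
    proof (rule sum_mono)
      fix k assume k: "k \<in> {1..Q}"
      define m where "m = Q div k"
      have m: "m \<ge> 1" unfolding m_def using k by (simp add: Suc_le_eq div_greater_zero_iff)
      have mQ: "real m \<le> real Q / real k" unfolding m_def by (rule of_nat_div_le_of_nat)
      have "m \<le> Q" unfolding m_def by simp
      \<comment> \<open>From m \<ge> 1 follows Q < (m + 1) k \<le> 2 m k, so exchanging ln Q for ln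
        m loses at most ln 2 + ln k, which is summable against 1/k^2.\<close>
      have "Q \<le> 2 * k * m"
      proof -
        have "Q < k + m * k" unfolding m_def using dividend_less_div_times[of k Q] k by simp
        also have "\<dots> \<le> m * k + m * k" using m by simp
        finally show ?thesis by (simp add: mult_ac)
      qed
      then have "real Q \<le> 2 * real k * real m" by (metis of_nat_le_iff of_nat_mult of_nat_numeral)
      then have "ln (real Q) \<le> ln (2 * real k * real m)" using Q by (intro ln_mono) auto
      also have "\<dots> = ln 2 + ln (real k) + ln (real m)" using k m by (simp add: ln_mult)
      finally have l: "ln (real Q) - ln (real m) \<le> 1 + ln (real k)" using ln_2_less_1 by simp
      have l0: "0 \<le> ln (real Q) - ln (real m)" using m \<open>m \<le> Q\<close> by simp
      have "farey_count m \<le> real m * (real m + 1) / 2" using m by (intro farey_count_le) auto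
      also have "\<dots> \<le> real m * real m" using m by (simp add: field_simps)
      also have "\<dots> \<le> (real Q / real k) * (real Q / real k)" using mQ by (intro mult_mono) auto
      finally have f: "farey_count m \<le> (real Q)\<^sup>2 / (real k)\<^sup>2" by (simp add: power2_eq_square)
      have f0: "0 \<le> farey_count m" by (simp add: farey_count_def)
      have "\<kappa> * (ln (real Q) - ln (real m)) * farey_count m \<le> 1 * (1 + ln (real k)) * ((real Q)\<^sup>2 / (real k)\<^sup>2)"
        using k0 l l0 f f0 k by (intro mult_mono) auto
      moreover have "0 \<le> \<kappa> * (ln (real Q) - ln (real m)) * farey_count m" using k0 l0 f0 by simp
      ultimately show "\<bar>?E k\<bar> \<le> (real Q)\<^sup>2 * (1 / (real k)\<^sup>2 + ln (real k) / (real k)\<^sup>2)"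
        unfolding m_def by (simp add: algebra_simps add_divide_distrib)
    qed
    also have "\<dots> = (real Q)\<^sup>2 * ((\<Sum>k\<in>{1..Q}. 1 / (real k)\<^sup>2) + (\<Sum>k\<in>{1..Q}. ln (real k) / (real k)\<^sup>2))"
      by (simp only: sum_distrib_left[symmetric] sum.distrib)
    also have "\<dots> \<le> (real Q)\<^sup>2 * (2 + K)"
    proof (intro mult_left_mono add_mono K)
      have "0 \<le> (if Q = 0 then 2 else 1 / real Q)" by simp
      then show "(\<Sum>k\<in>{1..Q}. 1 / (real k)\<^sup>2) \<le> 2" using sum_inverse_squares_le[of Q] by linarith
    qed auto
    finally show ?thesis using C[OF Q] unfolding e by (simp add: algebra_simps)
  qed
  define D where "D = 4 * (C + 2 + K)"
  have \<Delta>: "\<bar>\<Delta> Q\<bar> \<le> D * (real Q)\<^sup>2" if "Q > 0" for Q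
    unfolding D_def by (rule dilate_sum_inversion[OF \<Delta>S that])
  show ?thesis
  proof (rule bigoI)
    show "\<forall>\<^sub>F Q in at_top. norm (1 / real (card (farey Q)) * (\<Sum>x\<in>farey_below \<alpha> Q. dedekind_rat x)
            - 1/12 * (1 - 1 / (real w)\<^sup>2) * ln (real Q)) \<le> (16 * (D + 1)) * norm (1::real)"
      using eventually_ge_at_top[of "256::nat"]
    proof eventually_elim
      case (elim Q)
      then have Q: "Q > 0" by simp
      define N where "N = farey_count Q"
      have cardN: "real (card (farey Q)) = N + 1" using card_farey[OF Q] by (simp add: N_def farey_count_def)
      have N: "N \<ge> (real Q)\<^sup>2 / 16" unfolding N_def by (rule farey_count_ge[OF elim])
      have Q2: "(real Q)\<^sup>2 > 0" using Q by simp
      have Np: "N + 1 > 0" using N Q2 by linarith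
      \<comment> \<open>The fraction 1 belongs to \<open>farey Q\<close> but not to the count N, so
        one more \<kappa> ln Q joins \<Delta> Q; it is at most Q^2.\<close>
      have "1 / (N + 1) * S Q - \<kappa> * ln (real Q) = (\<Delta> Q - \<kappa> * ln (real Q)) / (N + 1)"
        using Np by (simp add: \<Delta>_def N_def[symmetric] field_simps)
      moreover have "\<bar>\<Delta> Q - \<kappa> * ln (real Q)\<bar> \<le> (D + 1) * (real Q)\<^sup>2"
      proof -
        have "0 \<le> ln (real Q)" using Q by simp
        have "ln (real Q) \<le> real Q" using ln_le_minus_one[of "real Q"] Q by simp
        also have "real Q \<le> (real Q)\<^sup>2" using Q by (simp add: power2_eq_square)
        finally have "\<kappa> * ln (real Q) \<le> 1 * (real Q)\<^sup>2" using k0 \<open>0 \<le> ln (real Q)\<close> by (intro mult_mono) auto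
        moreover have "0 \<le> \<kappa> * ln (real Q)" using k0 \<open>0 \<le> ln (real Q)\<close> by simp
        ultimately show ?thesis using \<Delta>[OF Q] by (simp add: algebra_simps)
      qed
      ultimately have "\<bar>1 / (N + 1) * S Q - \<kappa> * ln (real Q)\<bar> \<le> (D + 1) * (real Q)\<^sup>2 / (N + 1)"
        using Np by (simp add: abs_divide divide_right_mono)
      also have "\<dots> \<le> (D + 1) * (real Q)\<^sup>2 / ((real Q)\<^sup>2 / 16)"
      proof (rule divide_left_mono)
        have "0 \<le> D" using \<Delta>[of 1] by simp
        then show "0 \<le> (D + 1) * (real Q)\<^sup>2" by simp
        show "0 < (N + 1) * ((real Q)\<^sup>2 / 16)" using Np Q2 by simp
        show "(real Q)\<^sup>2 / 16 \<le> N + 1" using N by simp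
      qed
      also have "\<dots> = 16 * (D + 1)" using Q2 by simp
      finally show ?case unfolding \<kappa> cardN S_def[symmetric] by simp
    qed
  qed
qed

end
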